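(* Let $w>2$ and let $\Gamma_w$ be the Hecke triangle group. For $s \in \mathbb{C} \setminus \frac{1}{2}(1-2\mathbb{N}_0)$ and $N \in \mathbb{N}$, let $F_N(s)=\det(1-L(s))$, where $L(s)$ is the $N\times N$ matrix (indices $i,j=0,\dots,N-1$) with entries $$\ell_{ij}(s) = 2\sqrt{\frac{j+1}{i+1}}\cdot \frac{\zeta(2s+i+j)}{w^{2s+i+j}}\binom{2s+i+j-1}{i}\ \text{ if } i+j \text{ is even},\qquad \ell_{ij}(s)=0 \ \text{ if } i+j \text{ is odd}.$$ Then the Selberg zeta function $Z_{\Gamma_w}(s)$ admits a meromorphic continuation to $\mathbb{C} \setminus \frac{1}{2}(1-2\mathbb{N}_0)$, and for every $s$ in that domain and every $N\in\mathbb{N}$, $$|Z_{\Gamma_w}(s) - F_N(s)| \le P_N(s)\, e^{P_N(s)+Q(s)+1},$$ where $$P_N(s) = \left(\frac{2}{w}\right)^N (N+1)^{1/2}\cdot w\, C(s)\, \frac{2^{\lceil 2|s|\rceil}}{w^{2\operatorname{Re}(s)}}\operatorname{Li}_{-\frac12}\!\left(\frac{2}{w}\right)\left[1+\sqrt{2}\operatorname{Li}_{-\frac12}\!\left(\frac{2}{w}\right)\right],$$ $$Q(s) = 2C(s)\,\frac{w^{2|s|-2\operatorname{Re}(s)}}{(w-1)^{2|s|-1}}\operatorname{Li}_{-\frac32}\!\left(\frac{1}{w-1}\right),\qquad C(s)=\sup_{n\in 2\mathbb{N}_0}|\zeta(2s+n)|.$$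
   Context: $\mathbb{N}=\{1,2,\dots\}$, $\mathbb{N}_0=\{0,1,2,\dots\}$, so $\frac12(1-2\mathbb{N}_0)=\{\frac12,-\frac12,-\frac32,\dots\}$. The Hecke triangle group $\Gamma_w$ ($w>0$) is the subgroup of $\mathrm{PSL}_2(\mathbb{R})$ generated by $T_w=\begin{bmatrix}1&w\\0&1\end{bmatrix}$ and $S=\begin{bmatrix}0&1\\-1&0\end{bmatrix}$, acting on the upper half-plane $\mathbb{H}$. Its Selberg zeta function is defined for $\operatorname{Re}(s)$ sufficiently large by $Z_{\Gamma_w}(s)=\prod_{[\gamma]}\prod_{k=0}^\infty(1-e^{-(s+k)\ell(\gamma)})$, where $[\gamma]$ runs over conjugacy classes of primitive hyperbolic elements of $\Gamma_w$ and $\ell(\gamma)$ is the length of the corresponding closed geodesic on $\Gamma_w\backslash\mathbb{H}$. $\zeta$ is the Riemann zeta function (meromorphically continued), $\binom{x}{i}=x(x-1)\cdots(x-i+1)/i!$ is the generalized binomial coefficient, and $\operatorname{Li}_\nu(z)=\sum_{k\ge1}z^k/k^\nu$ is the polylogarithm. *)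

theory Defs
  imports
    "HOL-Complex_Analysis.Complex_Analysis"
    "HOL-Algebra.Coset"
    "HOL-Algebra.Generated_Groups"
    "Jordan_Normal_Form.Determinant"
begin

section \<open>The group PSL(2,R) and its action on the upper half-plane\<close>

definition mat2 :: "real \<Rightarrow> real \<Rightarrow> real \<Rightarrow> real \<Rightarrow> real mat" where
  "mat2 a b c d = mat_of_rows_list 2 [[a, b], [c, d]]"

definition SL2R :: "real mat monoid" where
  "SL2R = \<lparr>carrier = {A \<in> carrier_mat 2 2. Determinant.det A = 1},
           monoid.mult = (*), one = 1\<^sub>m 2\<rparr>"

text \<open>Elements of \<open>PSL2R\<close> are the cosets \<open>{A, -A}\<close>.\<close>

definition PSL2R :: "real mat set monoid" where
  "PSL2R = SL2R Mod {1\<^sub>m 2, - 1\<^sub>m 2}"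

definition psl :: "real mat \<Rightarrow> real mat set" where
  "psl A = {1\<^sub>m 2, - 1\<^sub>m 2} #>\<^bsub>SL2R\<^esub> A"

definition upper_half_plane :: "complex set" where
  "upper_half_plane = {z. Im z > 0}"

definition moebius :: "real mat \<Rightarrow> complex \<Rightarrow> complex" where
  "moebius A z = (of_real (A $$ (0,0)) * z + of_real (A $$ (0,1))) /
                 (of_real (A $$ (1,0)) * z + of_real (A $$ (1,1)))"

text \<open>The distance induced on the upper half-plane by the metric \<open>(dx\<^sup>2 + dy\<^sup>2) / y\<^sup>2\<close>.\<close>

definition hyp_dist :: "complex \<Rightarrow> complex \<Rightarrow> real" where
  "hyp_dist z z' = arcosh (1 + (cmod (z - z'))\<^sup>2 / (2 * Im z * Im z'))"

definition hyperbolic :: "real mat set \<Rightarrow> bool" where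
  "hyperbolic g \<longleftrightarrow> (\<forall>A\<in>g. \<bar>A $$ (0,0) + A $$ (1,1)\<bar> > 2)"

text \<open>A unit-speed geodesic line of the upper half-plane that \<open>g\<close> translates along itself by
  \<open>l > 0\<close> projects to the closed geodesic associated with \<open>g\<close>, and \<open>l\<close> is the length of the latter.\<close>

definition geodesic_line :: "(real \<Rightarrow> complex) \<Rightarrow> bool" where
  "geodesic_line c \<longleftrightarrow> range c \<subseteq> upper_half_plane \<and> (\<forall>t u. hyp_dist (c t) (c u) = \<bar>t - u\<bar>)"

definition closed_geodesic_length :: "real mat set \<Rightarrow> real" where
  "closed_geodesic_length g =
     (THE l. l > 0 \<and> (\<exists>c. geodesic_line c \<and> (\<forall>A\<in>g. \<forall>t. moebius A (c t) = c (t + l))))"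

section \<open>Hecke triangle groups and the Selberg zeta function\<close>

definition Hecke_group :: "real \<Rightarrow> real mat set monoid" where
  "Hecke_group w =
     PSL2R\<lparr>carrier := generate PSL2R {psl (mat2 1 w 0 1), psl (mat2 0 1 (-1) 0)}\<rparr>"

definition primitive :: "('a, 'b) monoid_scheme \<Rightarrow> 'a \<Rightarrow> bool" where
  "primitive G g \<longleftrightarrow> \<not> (\<exists>h\<in>carrier G. \<exists>n::nat. n \<ge> 2 \<and> g = h [^]\<^bsub>G\<^esub> n)"

definition conjugacy_class :: "('a, 'b) monoid_scheme \<Rightarrow> 'a \<Rightarrow> 'a set" where
  "conjugacy_class G g = {h \<otimes>\<^bsub>G\<^esub> g \<otimes>\<^bsub>G\<^esub> inv\<^bsub>G\<^esub> h | h. h \<in> carrier G}"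

definition prim_hyp_classes :: "real mat set monoid \<Rightarrow> real mat set set set" where
  "prim_hyp_classes G = conjugacy_class G ` {g \<in> carrier G. hyperbolic g \<and> primitive G g}"

text \<open>The length is constant on each conjugacy class, so the choice of representative is
  immaterial.\<close>

definition class_length :: "real mat set set \<Rightarrow> real" where
  "class_length K = closed_geodesic_length (SOME g. g \<in> K)"

text \<open>The product over conjugacy classes has no preferred order: it is the limit of the finite
  partial products along the net of finite sets of classes. It is meaningful where
  \<open>Selberg_product_converges\<close> holds, i.e. where the double product converges absolutely.\<close>

definition Selberg_product :: "real mat set monoid \<Rightarrow> complex \<Rightarrow> complex" where
  "Selberg_product G s =
     Lim (finite_subsets_at_top (prim_hyp_classes G))
       (\<lambda>X. \<Prod>K\<in>X. \<Prod>k. 1 - exp (- (s + of_nat k) * of_real (class_length K)))"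

definition Selberg_product_converges :: "real mat set monoid \<Rightarrow> complex \<Rightarrow> bool" where
  "Selberg_product_converges G s \<longleftrightarrow>
     (\<lambda>(K, k::nat). cmod (exp (- (s + of_nat k) * of_real (class_length K))))
       summable_on (prim_hyp_classes G \<times> UNIV)"

text \<open>\<open>(nicely_meromorphic_on)\<close> only normalises the values of a meromorphic function: removable
  singularities are filled in and the value at a pole is 0. The continuation need not be related
  to the product outside \<open>D\<close>.\<close>

definition Selberg_zeta_continuation ::
    "real mat set monoid \<Rightarrow> complex set \<Rightarrow> (complex \<Rightarrow> complex) \<Rightarrow> bool" where
  "Selberg_zeta_continuation G D Z \<longleftrightarrow>
     Z nicely_meromorphic_on D \<and>
     (\<exists>\<sigma>::real. \<forall>s. Re s > \<sigma> \<longrightarrow>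
        s \<in> D \<and> Selberg_product_converges G s \<and> Z s = Selberg_product G s)"

section \<open>The Riemann zeta function and polylogarithms\<close>

text \<open>The meromorphic continuation to the whole plane of the Dirichlet series; it is unique by the
  identity theorem, the value at the pole 1 being 0 by convention.\<close>

definition Riemann_zeta :: "complex \<Rightarrow> complex" where
  "Riemann_zeta =
     (THE f. f nicely_meromorphic_on UNIV \<and>
        (\<forall>s. Re s > 1 \<longrightarrow> (\<lambda>n. 1 / of_nat (Suc n) powr s) sums f s))"

definition polylog :: "real \<Rightarrow> real \<Rightarrow> real" where
  "polylog \<nu> z = (\<Sum>k. z ^ Suc k / real (Suc k) powr \<nu>)"

section \<open>The approximating determinants and the error terms\<close>

text \<open>The complement of \<open>{1/2, -1/2, -3/2, \<dots>}\<close>\<close>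

definition zeta_domain :: "complex set" where
  "zeta_domain = - {(1 - 2 * of_nat n) / 2 | n :: nat. True}"

definition L_entry :: "real \<Rightarrow> complex \<Rightarrow> nat \<Rightarrow> nat \<Rightarrow> complex" where
  "L_entry w s i j =
     (if even (i + j) then
        2 * of_real (sqrt ((real j + 1) / (real i + 1)))
          * (Riemann_zeta (2 * s + of_nat i + of_nat j)
               / of_real w powr (2 * s + of_nat i + of_nat j))
          * ((2 * s + of_nat i + of_nat j - 1) gchoose i)
      else 0)"

definition L_mat :: "real \<Rightarrow> nat \<Rightarrow> complex \<Rightarrow> complex mat" where
  "L_mat w N s = Matrix.mat N N (\<lambda>(i, j). L_entry w s i j)"

definition F_det :: "real \<Rightarrow> nat \<Rightarrow> complex \<Rightarrow> complex" where
  "F_det w N s = Determinant.det (1\<^sub>m N - L_mat w N s)"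

text \<open>For \<open>s \<in> zeta_domain\<close> the supremum is over a bounded set: no \<open>2 * s + n\<close> with \<open>n\<close> even
  is the pole 1, and the zeta function tends to 1 along \<open>2 * s + n\<close>.\<close>

definition C_sup :: "complex \<Rightarrow> real" where
  "C_sup s = (SUP n\<in>{n::nat. even n}. cmod (Riemann_zeta (2 * s + of_nat n)))"

definition P_bound :: "real \<Rightarrow> nat \<Rightarrow> complex \<Rightarrow> real" where
  "P_bound w N s =
     (2 / w) ^ N * (real N + 1) powr (1/2) * w * C_sup s
       * (2 ^ nat \<lceil>2 * cmod s\<rceil> / w powr (2 * Re s))
       * polylog (-1/2) (2 / w) * (1 + sqrt 2 * polylog (-1/2) (2 / w))"

definition Q_bound :: "real \<Rightarrow> complex \<Rightarrow> real" where
  "Q_bound w s =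
     2 * C_sup s * (w powr (2 * cmod s - 2 * Re s) / (w - 1) powr (2 * cmod s - 1))
       * polylog (-3/2) (1 / (w - 1))"

end

theory Submission
  imports Defs "Jordan_Normal_Form.Schur_Decomposition"
begin

text \<open>\<open>\<Gamma>\<^sub>w\<close> is the free product of the infinite cyclic group generated by \<open>T\<close> and the group of
  order two generated by \<open>S\<close>. Hence its primitive hyperbolic classes correspond to the primitive
  cyclic words in \<open>T\<^sup>n S\<close> with \<open>n \<noteq> 0\<close>, and expanding the logarithm turns the Selberg
  product into the exponential of minus a sum over all nonempty words, in which a word \<open>l\<close> of
  length \<open>m\<close> contributes \<open>q\<^sup>s / (1 - q) / m\<close> with \<open>q = exp (- word_length l)\<close>. A word also acts as
  a weighted composition operator on functions on the unit disc. Its trace, computed by a residue at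
  its fixed point, is \<open>q\<^sup>s / (1 - q)\<close>, and the Taylor coefficients of the sum of these operators
  over the words of length one are, up to a diagonal conjugation, the entries of \<open>L\<close>. So for large
  real \<open>s\<close> the product is the limit of the determinants \<open>F\<^sub>N\<close>, and the identity theorem extends
  this to a half-plane. The entries of \<open>L\<close> decay geometrically in both indices, locally uniformly in
  \<open>s\<close>; therefore \<open>F\<^sub>N\<close> converges to a holomorphic function on the whole domain, and comparing
  determinants through the \<open>l\<^sup>1\<close> norms of their rows gives the explicit bound.\<close>

text \<open>The zeta function and the length of a closed geodesic are given by definite
  descriptions, so a continuation and a translation axis must be constructed, each with uniqueness,
  before anything can be estimated. Operators are replaced by infinite matrices with absolutely
  summable entries; products, traces and limits of truncations then reduce to dominated convergence,
  and only finite determinants occur. For large real \<open>s\<close> the total of the absolute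
  values of the letter matrices falls below 1, so the logarithm of every truncated determinant is a
  series in traces of powers with a majorant independent of \<open>N\<close>. By
  \<open>w > 2\<close> the inverse of every nonempty word maps the disc of radius
  \<open>w / 2 > 1\<close> into the disc of radius \<open>2 / w < 1\<close>; the ratio
  \<open>2 / w\<close> in the error arises from binomial coefficients of size
  \<open>2 ^ (i + j)\<close> against \<open>w ^ (- i - j)\<close>. The bound
  \<open>P * exp (P + Q + 1)\<close> has the shape of the trace norm estimate for Fredholm
  determinants; row sums of absolute values give \<open>P * exp Q\<close>, which lies below
  it.\<close>

no_notation Infinite_Set_Sum.abs_summable_on (infix \<open>abs'_summable'_on\<close> 50)

section \<open>The Riemann zeta function\<close>

lemma norm_gbinomial_le:
  fixes a :: complex
  assumes "norm a \<le> b"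
  shows "norm (a gchoose k) \<le> pochhammer b k / fact k"
proof -
  have "norm (a gchoose k) = (\<Prod>i<k. norm (- a + of_nat i)) / fact k"
    by (simp add: gbinomial_pochhammer pochhammer_prod norm_mult norm_divide norm_power prod_norm
        atLeast0LessThan)
  moreover have "(\<Prod>i<k. norm (- a + of_nat i)) \<le> (\<Prod>i<k. b + of_nat i)"
  proof (intro prod_mono conjI)
    fix i
    show "norm (- a + of_nat i) \<le> b + real i"
      using assms norm_triangle_ineq[of "- a" "of_nat i"] by simp
  qed auto
  ultimately show ?thesis by (simp add: pochhammer_prod atLeast0LessThan divide_right_mono)
qed

text \<open>An integer bound \<open>p\<close> turns the majorant into the ordinary coefficient
  \<open>(p + k - 1) choose k\<close>, a single summand of \<open>2 ^ (p + k - 1)\<close>. The case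
  \<open>p + k = 0\<close> is split off because of the truncated subtraction.\<close>

lemma norm_gbinomial_le_power2:
  fixes a :: complex
  assumes "norm a \<le> real p"
  shows "norm (a gchoose k) \<le> 2 ^ (p + k)"
proof (cases "p + k = 0")
  case False
  have "norm (a gchoose k) \<le> pochhammer (real p) k / fact k"
    using assms by (rule norm_gbinomial_le)
  also have "\<dots> = real (p + k - 1) gchoose k"
    using False by (simp add: gbinomial_pochhammer' of_nat_diff Suc_leI)
  also have "\<dots> = real ((p + k - 1) choose k)" by (simp add: binomial_gbinomial)
  also have "\<dots> \<le> real (2 ^ (p + k - 1))" using binomial_le_pow2 of_nat_le_iff by blast
  also have "\<dots> \<le> 2 ^ (p + k)" by simp
  finally show ?thesis .
qed auto

lemma abs_summable_on_times:
  fixes f :: "'a \<Rightarrow> 'c::real_normed_div_algebra"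
  assumes "f abs_summable_on A" "g abs_summable_on B"
  shows "(\<lambda>(x, y). f x * g y) abs_summable_on A \<times> B"
proof -
  have "(\<lambda>x. norm (f x) * (\<Sum>\<^sub>\<infinity>y\<in>B. norm (g y))) summable_on A"
    using assms(1) by (rule summable_on_cmult_left)
  then show ?thesis using assms unfolding Infinite_Sum.abs_summable_on_Sigma_iff
    by (auto simp: norm_mult infsum_cmult_right' infsum_nonneg intro!: summable_on_cmult_right)
qed

text \<open>A product majorant makes the family absolutely summable over pairs, so Fubini for
  unordered sums applies. The conclusion in terms of \<open>sums\<close> records convergence of the
  outer series as well as its value.\<close>

lemma suminf_swap_dominated:
  fixes F :: "nat \<Rightarrow> nat \<Rightarrow> complex"
  assumes le: "\<And>n k. norm (F n k) \<le> a n * b k" and a: "summable a" and b: "summable b"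
    and a0: "\<And>n. a n \<ge> 0" and b0: "\<And>k. b k \<ge> 0"
  shows "(\<lambda>k. \<Sum>n. F n k) sums (\<Sum>n. \<Sum>k. F n k)"
proof -
  have ab: "(\<lambda>(n, k). a n * b k) summable_on UNIV \<times> UNIV"
    using abs_summable_on_times[of a UNIV b UNIV] a b a0 b0
    by (simp add: case_prod_unfold summable_on_UNIV_nonneg_real_iff)
  have F: "(\<lambda>(n, k). F n k) abs_summable_on UNIV \<times> UNIV"
    by (rule Infinite_Sum.abs_summable_on_comparison_test'[OF ab]) (auto simp: le)
  have n: "(\<lambda>k. F n k) abs_summable_on UNIV" for n
    using F by (subst (asm) Infinite_Sum.abs_summable_on_Sigma_iff) auto
  have F': "(\<lambda>(k, n). F n k) abs_summable_on UNIV \<times> UNIV"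
    using F summable_on_swap[of "\<lambda>(k, n). norm (F n k)" UNIV UNIV] by (auto simp: case_prod_unfold)
  have k: "(\<lambda>n. F n k) abs_summable_on UNIV" for k
    using F' by (subst (asm) Infinite_Sum.abs_summable_on_Sigma_iff) auto
  have 1: "(\<Sum>k. F n k) = (\<Sum>\<^sub>\<infinity>k. F n k)" for n
    using abs_summable_summable[OF n] by (metis has_sum_imp_sums has_sum_infsum sums_unique)
  have 2: "(\<Sum>n. F n k) = (\<Sum>\<^sub>\<infinity>n. F n k)" for k
    using abs_summable_summable[OF k] by (metis has_sum_imp_sums has_sum_infsum sums_unique)
  have "(\<lambda>k. \<Sum>\<^sub>\<infinity>n. F n k) summable_on UNIV"
    using abs_summable_summable[OF F'] summable_on_Sigma_banach[of "\<lambda>k n. F n k" UNIV "\<lambda>_. UNIV"] by simp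
  then have A: "(\<lambda>k. \<Sum>\<^sub>\<infinity>n. F n k) sums (\<Sum>\<^sub>\<infinity>k. \<Sum>\<^sub>\<infinity>n. F n k)"
    by (intro has_sum_imp_sums has_sum_infsum)
  have "(\<lambda>n. \<Sum>\<^sub>\<infinity>k. F n k) summable_on UNIV"
    using abs_summable_summable[OF F] summable_on_Sigma_banach[of "\<lambda>n k. F n k" UNIV "\<lambda>_. UNIV"] by simp
  then have B: "(\<lambda>n. \<Sum>\<^sub>\<infinity>k. F n k) sums (\<Sum>\<^sub>\<infinity>n. \<Sum>\<^sub>\<infinity>k. F n k)"
    by (intro has_sum_imp_sums has_sum_infsum)
  have "(\<Sum>\<^sub>\<infinity>k. \<Sum>\<^sub>\<infinity>n. F n k) = (\<Sum>\<^sub>\<infinity>n. \<Sum>\<^sub>\<infinity>k. F n k)"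
    using abs_summable_summable[OF F] by (intro infsum_swap_banach[symmetric]) auto
  then show ?thesis using A B by (simp add: 1 2 sums_iff)
qed

text \<open>The series starts at 4 so that its tail beats the bound \<open>2 ^ (p + k)\<close> on the binomial
  coefficients.\<close>

definition zeta_tail :: "complex \<Rightarrow> complex" where
  "zeta_tail s = (\<Sum>n. of_nat (n + 4) powr (-s))"

lemma norm_of_nat_powr: "n > 0 \<Longrightarrow> norm (of_nat n powr s :: complex) = real n powr Re s"
  using norm_powr_real_powr[of "of_nat n" s] by simp

lemma summable_shift_powr:
  assumes "x > 1"
  shows "summable (\<lambda>n. real (n + 4) powr (-x))"
  using summable_ignore_initial_segment[of "\<lambda>n. real n powr (-x)" 4] assms
  by (simp add: summable_real_powr_iff)

lemma zeta_tail_summable: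
  assumes "Re s > 1"
  shows "summable (\<lambda>n. norm (of_nat (n + 4) powr (-s) :: complex))"
  using summable_shift_powr[OF assms] by (subst norm_of_nat_powr) auto

lemma zeta_tail_sums:
  assumes "Re s > 1"
  shows "(\<lambda>n. of_nat (n + 4) powr (-s)) sums zeta_tail s"
  unfolding zeta_tail_def by (rule summable_sums[OF summable_norm_cancel[OF zeta_tail_summable[OF assms]]])

definition zeta_tail_const :: real where
  "zeta_tail_const = (\<Sum>n. real (n + 4) powr (-2))"

text \<open>All bases are at least 4, so beyond exponent 2 every further unit in the real part gains
  a factor 4.\<close>

lemma norm_zeta_tail_le:
  assumes "Re s \<ge> 2"
  shows "norm (zeta_tail s) \<le> zeta_tail_const * 4 powr (2 - Re s)"
proof -
  have "norm (zeta_tail s) \<le> (\<Sum>n. norm (of_nat (n + 4) powr (-s) :: complex))"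
    unfolding zeta_tail_def using assms by (intro summable_norm zeta_tail_summable) auto
  also have "\<dots> \<le> (\<Sum>n. real (n + 4) powr (-2) * 4 powr (2 - Re s))"
  proof (intro suminf_le)
    fix n
    have "norm (of_nat (n + 4) powr (-s) :: complex) = real (n + 4) powr (- 2) * real (n + 4) powr (2 - Re s)"
      by (subst norm_of_nat_powr) (simp_all flip: powr_add)
    moreover have "real (n + 4) powr (2 - Re s) \<le> 4 powr (2 - Re s)"
      using assms by (intro powr_mono2') auto
    ultimately show "norm (of_nat (n + 4) powr (-s) :: complex) \<le> real (n + 4) powr (- 2) * 4 powr (2 - Re s)"
      by (simp add: mult_left_mono del: of_nat_add)
  qed (use assms summable_shift_powr[of 2] zeta_tail_summable in \<open>auto intro!: summable_mult2\<close>)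
  also have "\<dots> = zeta_tail_const * 4 powr (2 - Re s)"
    unfolding zeta_tail_const_def using summable_shift_powr[of 2] by (intro suminf_mult2[symmetric]) auto
  finally show ?thesis .
qed

lemma zeta_tail_holomorphic: "zeta_tail holomorphic_on {s. Re s > 1}"
proof (rule holomorphic_uniform_sequence)
  show "open {s::complex. 1 < Re s}" by (simp add: open_halfspace_Re_gt)
  show "(\<lambda>s. \<Sum>n<N. of_nat (n + 4) powr (-s)) holomorphic_on {s. 1 < Re s}" for N :: nat
    by (intro holomorphic_intros)
  fix x :: complex assume "x \<in> {s. 1 < Re s}"
  define d where "d = (Re x - 1) / 2"
  have d: "d > 0" "Re x = 1 + 2 * d" using \<open>x \<in> _\<close> by (auto simp: d_def field_simps)
  have Re: "Re y \<ge> 1 + d" if "y \<in> cball x d" for y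
    using abs_Re_le_cmod[of "x - y"] that d by (auto simp: dist_norm)
  have "uniform_limit (cball x d) (\<lambda>N s. \<Sum>n<N. of_nat (n + 4) powr (-s)) (\<lambda>s. \<Sum>n. of_nat (n + 4) powr (-s)) sequentially"
  proof (rule Weierstrass_m_test)
    fix n y assume y: "y \<in> cball x d"
    show "norm (of_nat (n + 4) powr (-y) :: complex) \<le> real (n + 4) powr (-(1 + d))"
      using Re[OF y] by (subst norm_of_nat_powr) (auto simp del: of_nat_add intro!: powr_mono)
  qed (rule summable_shift_powr, use d in auto)
  then show "\<exists>d>0. cball x d \<subseteq> {s. 1 < Re s} \<and> uniform_limit (cball x d) (\<lambda>N s. \<Sum>n<N. of_nat (n + 4) powr (-s)) zeta_tail sequentially"
    using d Re unfolding zeta_tail_def[abs_def] by (intro exI[of _ d]) force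
qed

text \<open>\<open>s + of_nat k\<close> is the factor \<open>z - 1\<close> at
  \<open>z = s + of_nat (Suc k)\<close>. The identity converts the coefficient in front of
  \<open>(z - 1) * zeta_tail z\<close> into the one in front of \<open>zeta_tail z\<close>, with no
  division by a quantity that can vanish.\<close>

lemma gbinomial_two_steps:
  fixes s :: complex
  shows "((1 - s) gchoose Suc k) / of_nat (k + 2) * (s + of_nat k) = - ((1 - s) gchoose (k + 2))"
proof -
  have "of_nat (k + 2) * ((1 - s) gchoose (k + 2)) = (1 - s - of_nat (Suc k)) * ((1 - s) gchoose Suc k)"
    using gbinomial_mult_1[of "1 - s" "Suc k"]
    by (metis add_2_eq_Suc' add_diff_cancel_left' left_diff_distrib)
  moreover have "of_nat (k + 2) \<noteq> (0::complex)" unfolding of_nat_eq_0_iff by simp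
  moreover have "(1 - s - of_nat (Suc k)) * ((1 - s) gchoose Suc k) = - ((s + of_nat k) * ((1 - s) gchoose Suc k))"
    by (simp add: algebra_simps)
  ultimately have "(s + of_nat k) * ((1 - s) gchoose Suc k) / of_nat (k + 2) = - ((1 - s) gchoose (k + 2))"
    by (metis minus_divide_left minus_minus nonzero_mult_div_cancel_left)
  then show ?thesis by (simp add: mult_ac)
qed

text \<open>Expanding \<open>(n + 1) powr (1 - s)\<close> binomially in \<open>1 / n\<close> and telescoping over \<open>n\<close>.\<close>

lemma zeta_tail_recursion:
  assumes s: "Re s > 1"
  shows "(\<lambda>k. ((1 - s) gchoose (k + 2)) * zeta_tail (s + of_nat (Suc k))) sums
    ((s - 1) * zeta_tail s - 4 powr (1 - s))"
proof -
  define F where "F = (\<lambda>n k. ((1 - s) gchoose (k + 2)) * of_nat (n + 4) powr (- (s + of_nat (Suc k))))"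
  define b where "b = (\<lambda>k. norm (((1 - s) gchoose (k + 2)) * (1 / 4) ^ k))"
  \<comment> \<open>Convergence of the binomial series at 1/2 gives absolute convergence at 1/4, the
    largest value of \<open>1 / (n + 4)\<close>.\<close>
  have "summable (\<lambda>k. ((1 - s) gchoose k) * (1 / 2) ^ k)"
    using gen_binomial_complex[of "1/2" "1 - s"] by (auto simp: summable_def)
  then have 0: "summable (\<lambda>k. norm (((1 - s) gchoose k) * (1 / 4) ^ k))"
    by (rule powser_insidea) (simp add: norm_divide)
  have "summable (\<lambda>k. 16 * norm (((1 - s) gchoose (k + 2)) * (1 / 4) ^ (k + 2)))"
    by (rule summable_mult[OF summable_ignore_initial_segment[OF 0, of 2]])
  moreover have "16 * norm (((1 - s) gchoose (k + 2)) * (1 / 4) ^ (k + 2)) = b k" for k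
    unfolding b_def norm_mult norm_power norm_divide by (simp add: power_add)
  ultimately have b: "summable b" by simp
  have le: "norm (F n k) \<le> real (n + 4) powr (- Re s) * b k" for n k
  proof -
    have "real (n + 4) powr (- real (Suc k)) \<le> real (n + 4) powr (- real k)"
      by (intro powr_mono) auto
    also have "\<dots> \<le> 4 powr (- real k)" by (intro powr_mono2') auto
    also have "\<dots> = (1 / 4) ^ k" by (simp add: powr_minus powr_realpow power_one_over field_simps)
    finally have "real (n + 4) powr (- Re s) * real (n + 4) powr (- real (Suc k)) \<le> real (n + 4) powr (- Re s) * (1 / 4) ^ k"
      by (rule mult_left_mono) simp
    moreover have "real (n + 4) powr (- (Re s + real (Suc k))) = real (n + 4) powr (- Re s) * real (n + 4) powr (- real (Suc k))"
      by (simp flip: powr_add)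
    ultimately have "norm ((1 - s) gchoose (k + 2)) * real (n + 4) powr (- (Re s + real (Suc k)))
        \<le> norm ((1 - s) gchoose (k + 2)) * (real (n + 4) powr (- Re s) * (1 / 4) ^ k)"
      by (intro mult_left_mono) auto
    then show ?thesis unfolding F_def b_def norm_mult
      by (subst norm_of_nat_powr) (simp_all add: norm_power norm_divide mult_ac del: of_nat_add of_nat_Suc)
  qed
  have "(\<lambda>k. \<Sum>n. F n k) sums (\<Sum>n. \<Sum>k. F n k)"
    by (rule suminf_swap_dominated[OF le summable_shift_powr[OF s] b]) (auto simp: b_def)
  moreover have "(\<Sum>n. F n k) = ((1 - s) gchoose (k + 2)) * zeta_tail (s + of_nat (Suc k))" for k
    unfolding F_def using s
    by (intro sums_unique[symmetric] sums_mult zeta_tail_sums) auto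
  \<comment> \<open>Two terms of the expansion of \<open>(1 + 1 / (n + 4)) powr (1 - s)\<close> are
    split off: the constant one yields the difference that telescopes, the linear one the summand of
    \<open>(s - 1) * zeta_tail s\<close>.\<close>
  moreover have "(\<Sum>k. F n k) = (of_nat (Suc n + 4) powr (1 - s) - of_nat (n + 4) powr (1 - s)) + (s - 1) * of_nat (n + 4) powr (-s)" for n
  proof -
    define N where "N = (of_nat (n + 4) :: complex)"
    have N: "N \<noteq> 0" unfolding N_def of_nat_eq_0_iff by simp
    have "norm (inverse N) < 1" unfolding N_def norm_inverse norm_of_nat by (simp add: field_simps)
    from gen_binomial_complex[OF this, of "1 - s"]
    have "(\<lambda>k. ((1 - s) gchoose (k + 2)) * inverse N ^ (k + 2)) sums ((1 + inverse N) powr (1 - s) - (\<Sum>k<2. ((1 - s) gchoose k) * inverse N ^ k))"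
      by (rule sums_split_initial_segment)
    from sums_mult[OF this, of "N powr (1 - s)"]
    have *: "(\<lambda>k. N powr (1 - s) * (((1 - s) gchoose (k + 2)) * inverse N ^ (k + 2))) sums
       (N powr (1 - s) * (1 + inverse N) powr (1 - s) - N powr (1 - s) * (1 + (1 - s) * inverse N))"
      by (simp add: numeral_2_eq_2 algebra_simps)
    have "N powr (1 - s) * (1 + inverse N) powr (1 - s) = (N * (1 + inverse N)) powr (1 - s)"
    proof -
      have "N = of_real (real (n + 4))" "1 + inverse N = of_real (1 + inverse (real (n + 4)))"
        by (simp_all add: N_def)
      then show ?thesis by (metis powr_times_real Reals_of_real Re_complex_of_real of_nat_0_le_iff
            add_nonneg_nonneg zero_le_one inverse_nonnegative_iff_nonnegative)
    qed
    also have "N * (1 + inverse N) = of_nat (Suc n + 4)"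
    proof -
      have "N * (1 + inverse N) = N + 1" using N by (simp add: field_simps)
      then show ?thesis by (simp add: N_def)
    qed
    finally have 1: "N powr (1 - s) * (1 + inverse N) powr (1 - s) = of_nat (Suc n + 4) powr (1 - s)" .
    have 2: "N powr (1 - s) * (1 + (1 - s) * inverse N) = N powr (1 - s) + (1 - s) * N powr (- s)"
    proof -
      have "N powr (1 - s) = N * N powr (- s)" using N by (simp add: powr_diff powr_minus field_simps)
      then show ?thesis using N by (simp add: field_simps)
    qed
    have 3: "N powr (1 - s) * (((1 - s) gchoose (k + 2)) * inverse N ^ (k + 2)) = F n k" for k
    proof -
      have "inverse N ^ (k + 2) = inverse (N powr of_nat (k + 2))"
        using N by (subst powr_nat') (auto simp: power_inverse)
      then have "N powr (1 - s) * inverse N ^ (k + 2) = N powr (1 - s) * N powr (- of_nat (k + 2))"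
        by (simp only: powr_minus)
      also have "\<dots> = N powr (- (s + of_nat (Suc k)))" by (simp add: algebra_simps flip: powr_add)
      finally show ?thesis
        unfolding F_def N_def[symmetric] by (simp add: mult_ac)
    qed
    show ?thesis using * unfolding 1 2 3 by (simp add: sums_iff N_def algebra_simps)
  qed
  moreover have "(\<lambda>n. (of_nat (Suc n + 4) powr (1 - s) - of_nat (n + 4) powr (1 - s)) + (s - 1) * of_nat (n + 4) powr (-s)) sums
      ((0 - of_nat (0 + 4) powr (1 - s)) + (s - 1) * zeta_tail s)"
  proof (intro sums_add sums_mult zeta_tail_sums s telescope_sums)
    have "(\<lambda>n. real (n + 4) powr (- (Re s - 1))) \<longlonglongrightarrow> 0"
      using s by (intro tendsto_neg_powr filterlim_compose[OF filterlim_real_sequentially] filterlim_add_const_nat_at_top) auto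
    then show "(\<lambda>n. of_nat (n + 4) powr (1 - s) :: complex) \<longlonglongrightarrow> 0"
      by (subst tendsto_norm_zero_iff[symmetric], subst norm_of_nat_powr) auto
  qed
  ultimately show ?thesis by (simp add: sums_iff)
qed

text \<open>Level \<open>m\<close> represents \<open>(s - 1) * zeta_tail s\<close> for
  \<open>Re s > 1 - m\<close>: the recursion for the tail is read as a formula for the value at
  \<open>s\<close> in terms of the arguments \<open>s + k + 1\<close>. The factor
  \<open>s - 1\<close> removes the pole at 1, and dividing by \<open>k + 2\<close> instead of
  \<open>s + k\<close> keeps every summand holomorphic.\<close>

fun zeta_cont :: "nat \<Rightarrow> complex \<Rightarrow> complex" where
  "zeta_cont 0 s = (s - 1) * zeta_tail s"
| "zeta_cont (Suc m) s = 4 powr (1 - s)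
     - (\<Sum>k. ((1 - s) gchoose Suc k) / of_nat (k + 2) * zeta_cont m (s + of_nat (Suc k)))"

lemma zeta_cont_eq: "Re s > 1 \<Longrightarrow> zeta_cont m s = (s - 1) * zeta_tail s"
proof (induction m arbitrary: s)
  case (Suc m)
  have "zeta_cont m (s + of_nat (Suc k)) = (s + of_nat k) * zeta_tail (s + of_nat (Suc k))" for k
    using Suc.prems by (subst Suc.IH) auto
  then have "((1 - s) gchoose Suc k) / of_nat (k + 2) * zeta_cont m (s + of_nat (Suc k))
      = - (((1 - s) gchoose (k + 2)) * zeta_tail (s + of_nat (Suc k)))" for k
    using gbinomial_two_steps[of s k] by (metis (no_types, lifting) mult.assoc mult_minus_left)
  moreover have "(\<Sum>k. - (((1 - s) gchoose (k + 2)) * zeta_tail (s + of_nat (Suc k))))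
      = - ((s - 1) * zeta_tail s - 4 powr (1 - s))"
    using zeta_tail_recursion[OF Suc.prems] by (intro sums_unique[symmetric] sums_minus)
  ultimately show ?case by simp
qed simp

text \<open>Each summand is holomorphic by the induction hypothesis. Far out in the series the
  shifted arguments lie in \<open>Re z \<ge> 2\<close>, where the previous level is explicit and its
  decay \<open>4 ^ (- k)\<close> beats the binomial growth \<open>2 ^ k\<close>.\<close>

lemma zeta_cont_holomorphic: "zeta_cont m holomorphic_on {s. Re s > 1 - real m}"
proof (induction m)
  case 0
  have "(\<lambda>s. (s - 1) * zeta_tail s) holomorphic_on {s. Re s > 1}"
    by (intro holomorphic_intros zeta_tail_holomorphic)
  then show ?case by (simp add: zeta_cont.simps(1)[abs_def])
next
  case (Suc m)
  define S where "S = {s. Re s > 1 - real (Suc m)}"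
  have S: "open S" by (simp add: S_def open_halfspace_Re_gt)
  define T where "T = (\<lambda>k s. ((1 - s) gchoose Suc k) / of_nat (k + 2) * zeta_cont m (s + of_nat (Suc k)))"
  have hol: "T k holomorphic_on S" for k
  proof -
    have "zeta_cont m \<circ> (\<lambda>s. s + of_nat (Suc k)) holomorphic_on S"
      by (rule holomorphic_on_compose_gen[OF _ Suc.IH]) (auto simp: S_def intro!: holomorphic_intros)
    then have "(\<lambda>s. zeta_cont m (s + of_nat (Suc k))) holomorphic_on S" by (simp add: o_def)
    then show ?thesis unfolding T_def gbinomial_prod_rev
      by (intro holomorphic_intros) auto
  qed
  have "(\<lambda>s. \<Sum>k. T k s) holomorphic_on S"
  proof (rule holomorphic_uniform_sequence[OF S])
    show "(\<lambda>s. \<Sum>k<N. T k s) holomorphic_on S" for N by (intro holomorphic_intros hol)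
    fix x assume "x \<in> S"
    then obtain d where d: "d > 0" "cball x d \<subseteq> S" using S open_contains_cball by blast
    obtain p :: nat where p: "norm (1 - x) + d \<le> real p" using real_arch_simple by blast
    have np: "norm (1 - s) \<le> real p" if "s \<in> cball x d" for s
    proof -
      have "norm (1 - s) \<le> norm (1 - x) + norm (x - s)" using norm_triangle_ineq[of "1 - x" "x - s"] by simp
      moreover have "norm (x - s) \<le> d" using that by (simp add: dist_norm)
      ultimately show ?thesis using p by linarith
    qed
    define M where "M = (\<lambda>k. 2 ^ (p + 2) * zeta_tail_const * 4 ^ p * (1 / 2 :: real) ^ k)"
    have "uniform_limit (cball x d) (\<lambda>N s. \<Sum>k<N. T k s) (\<lambda>s. \<Sum>k. T k s) sequentially"
    proof (rule Weierstrass_m_test_ev)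
      show "summable M" unfolding M_def by (intro summable_mult summable_geometric) auto
      \<comment> \<open>Only for \<open>k > p\<close> is the shifted argument known to lie to the
        right of 2; finitely many earlier summands do not affect uniform convergence.\<close>
      show "\<forall>\<^sub>F k in sequentially. \<forall>s\<in>cball x d. norm (T k s) \<le> M k"
        using eventually_ge_at_top[of "Suc p"]
      proof eventually_elim
        case (elim k)
        show ?case
        proof
          fix s assume s: "s \<in> cball x d"
          have Re: "Re s \<ge> 1 - real p" using np[OF s] abs_Re_le_cmod[of "1 - s"] by simp
          have "Re (s + of_nat (Suc k)) \<ge> 2" using Re elim by simp
          have "T k s = ((1 - s) gchoose Suc k) / of_nat (k + 2) * (s + of_nat k) * zeta_tail (s + of_nat (Suc k))"
            unfolding T_def using Re elim by (subst zeta_cont_eq) auto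
          also have "\<dots> = - ((1 - s) gchoose (k + 2)) * zeta_tail (s + of_nat (Suc k))"
            by (subst gbinomial_two_steps) simp
          finally have Teq: "norm (T k s) = norm ((1 - s) gchoose (k + 2)) * norm (zeta_tail (s + of_nat (Suc k)))"
            by (simp add: norm_mult)
          note Teq
          also have "norm ((1 - s) gchoose (k + 2)) * norm (zeta_tail (s + of_nat (Suc k))) \<le> 2 ^ (p + (k + 2)) * (zeta_tail_const * 4 powr (2 - Re (s + of_nat (Suc k))))"
            using \<open>2 \<le> Re (s + of_nat (Suc k))\<close> by (intro mult_mono norm_gbinomial_le_power2 np s norm_zeta_tail_le) auto
          also have "\<dots> \<le> 2 ^ (p + (k + 2)) * (zeta_tail_const * 4 powr (real p - real k))"
            using Re summable_shift_powr[of 2] by (intro mult_left_mono powr_mono) (auto simp: zeta_tail_const_def intro!: suminf_nonneg)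
          also have "2 ^ (p + (k + 2)) * (zeta_tail_const * 4 powr (real p - real k)) = M k"
          proof -
            have "4 powr (real p - real k) = (4 ^ p / 4 ^ k :: real)" by (simp add: powr_diff powr_realpow)
            moreover
            have "(2::real) ^ k / 4 ^ k = (1 / 2) ^ k" by (simp flip: power_divide)
            ultimately show ?thesis unfolding M_def by (simp add: power_add field_simps)
          qed
          finally show "norm (T k s) \<le> M k" .
        qed
      qed
    qed
    then show "\<exists>d>0. cball x d \<subseteq> S \<and> uniform_limit (cball x d) (\<lambda>N s. \<Sum>k<N. T k s) (\<lambda>s. \<Sum>k. T k s) sequentially"
      using d by blast
  qed
  then have "(\<lambda>s. 4 powr (1 - s) - (\<Sum>k. T k s)) holomorphic_on S" by (intro holomorphic_intros) auto
  then show ?case unfolding S_def T_def by (simp add: zeta_cont.simps(2)[abs_def])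
qed

lemma zeta_cont_Suc: "Re s > 1 - real m \<Longrightarrow> zeta_cont (Suc m) s = zeta_cont m s"
proof (induction m arbitrary: s)
  case 0
  then show ?case using zeta_cont_eq[of s 1] by simp
next
  case (Suc m)
  have "zeta_cont (Suc m) (s + of_nat (Suc k)) = zeta_cont m (s + of_nat (Suc k))" for k
    using Suc.prems by (intro Suc.IH) auto
  then show ?case by (simp only: zeta_cont.simps(2))
qed

lemma zeta_cont_mono: "Re s > 1 - real m \<Longrightarrow> m \<le> n \<Longrightarrow> zeta_cont n s = zeta_cont m s"
proof (induction n)
  case (Suc n)
  then show ?case by (cases "m = Suc n") (auto simp: zeta_cont_Suc simp del: zeta_cont.simps)
qed simp

text \<open>Each point lies in the half-plane of some level, and larger levels agree with smaller
  ones there, so the pointwise choice of a level defines one entire function.\<close>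

lemma zeta_entire_exists:
  obtains g where "g holomorphic_on UNIV" "\<And>s. Re s > 1 \<Longrightarrow> g s = (s - 1) * zeta_tail s"
proof
  define M where "M = (\<lambda>s::complex. Suc (nat \<lceil>1 - Re s\<rceil>))"
  have M: "Re s > 1 - real (M s)" for s unfolding M_def by linarith
  define g where "g = (\<lambda>s. zeta_cont (M s) s)"
  have g: "g s = zeta_cont m s" if "Re s > 1 - real m" for s m
    using zeta_cont_mono[OF M, of s "max m (M s)"] zeta_cont_mono[OF that, of "max m (M s)"]
    by (simp add: g_def)
  have "g holomorphic_on (\<Union>m. {s. Re s > 1 - real m})"
  proof (rule holomorphic_on_UN_open)
    fix m
    show "g holomorphic_on {s. Re s > 1 - real m}"
      using zeta_cont_holomorphic[of m] by (rule holomorphic_transform) (simp add: g)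
  qed (simp add: open_halfspace_Re_gt)
  moreover have "(\<Union>m. {s. Re s > 1 - real m}) = UNIV" using M by blast
  ultimately show "g holomorphic_on UNIV" by simp
  show "g s = (s - 1) * zeta_tail s" if "Re s > 1" for s
    using g[of 0 s] that by simp
qed

text \<open>The difference with its singularities removed vanishes near 2, hence everywhere, so the
  functions agree on punctured neighbourhoods of every point. The normalisation (limit, or 0 at a
  pole) then fixes the value at the point itself.\<close>

lemma nicely_meromorphic_eqI:
  assumes f: "f nicely_meromorphic_on UNIV" and g: "g nicely_meromorphic_on UNIV"
    and eq: "\<And>s. Re s > 1 \<Longrightarrow> f s = g s"
  shows "f = g"
proof
  fix z
  define h where "h = remove_sings (\<lambda>s. f s - g s)"
  have mero: "(\<lambda>s. f s - g s) meromorphic_on UNIV"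
    using f g unfolding nicely_meromorphic_on_def by (intro meromorphic_intros) auto
  have h: "h nicely_meromorphic_on UNIV" unfolding h_def by (rule remove_sings_nicely_meromorphic[OF mero])
  have o: "open {s::complex. Re s > 1}" by (simp add: open_halfspace_Re_gt)
  have "\<forall>\<^sub>F s in at 2. s \<in> {s::complex. Re s > 1}"
    by (rule eventually_at_in_open') (use o in auto)
  moreover have "\<forall>\<^sub>F s in at 2. h s = f s - g s"
    unfolding h_def by (intro eventually_remove_sings_eq_at) (use mero meromorphic_on_isolated_singularity meromorphic_on_subset in blast)
  ultimately have "\<forall>\<^sub>F s in at 2. h s = 0"
    by eventually_elim (simp add: eq)
  then have "\<exists>\<^sub>F s in at 2. h s = 0" by (rule eventually_frequently[rotated]) simp
  from frequently_eq_meromorphic_imp_constant[OF this h] have h0: "h w = 0" for w by auto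
  have "\<forall>\<^sub>F s in at z. h s = f s - g s"
    unfolding h_def by (intro eventually_remove_sings_eq_at) (use mero meromorphic_on_isolated_singularity meromorphic_on_subset in blast)
  then have ev: "\<forall>\<^sub>F s in at z. f s = g s" by eventually_elim (simp add: h0)
  have pole: "is_pole f z \<longleftrightarrow> is_pole g z" by (rule is_pole_cong[OF ev]) simp
  have lim: "f \<midarrow>z\<rightarrow> c \<longleftrightarrow> g \<midarrow>z\<rightarrow> c" for c by (rule tendsto_cong[OF ev])
  have F: "(is_pole f z \<and> f z = 0) \<or> f \<midarrow>z\<rightarrow> f z" and G: "(is_pole g z \<and> g z = 0) \<or> g \<midarrow>z\<rightarrow> g z"
    using f g unfolding nicely_meromorphic_on_def by auto
  show "f z = g z"
  proof (cases "is_pole f z")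
    case True
    then have "\<not> f \<midarrow>z\<rightarrow> c" for c using is_pole_def not_tendsto_and_filterlim_at_infinity at_neq_bot by metis
    then show ?thesis using F G lim by auto
  next
    case False
    then have "f \<midarrow>z\<rightarrow> f z" "f \<midarrow>z\<rightarrow> g z" using F G pole lim by auto
    then show ?thesis by (rule tendsto_unique[rotated]) simp
  qed
qed

text \<open>The candidate is the entire continuation divided by \<open>s - 1\<close>, plus the three
  terms of the Dirichlet series missing from the tail; \<open>remove_sings\<close> supplies the
  required normalisation at 1. Uniqueness then lets the definite description denote it.\<close>

lemma
  shows Riemann_zeta_analytic: "Riemann_zeta holomorphic_on - {1}"
    and Riemann_zeta_sums: "Re s > 1 \<Longrightarrow> (\<lambda>n. 1 / of_nat (Suc n) powr s) sums Riemann_zeta s"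
proof -
  obtain g where g: "g holomorphic_on UNIV" "\<And>s. Re s > 1 \<Longrightarrow> g s = (s - 1) * zeta_tail s"
    using zeta_entire_exists by blast
  define f where "f = (\<lambda>s. g s / (s - 1) + (1 + 2 powr (-s) + 3 powr (-s)))"
  have f: "f holomorphic_on - {1}" unfolding f_def
    by (intro holomorphic_intros holomorphic_on_subset[OF g(1)]) auto
  have fa: "f analytic_on - {1}" using f analytic_on_open by blast
  have g': "g meromorphic_on UNIV" using g(1) analytic_on_imp_meromorphic_on analytic_on_open by blast
  have e: "(\<lambda>s::complex. 1 + 2 powr (-s) + 3 powr (-s)) meromorphic_on UNIV"
    by (intro analytic_on_imp_meromorphic_on analytic_intros) auto
  have mero: "f meromorphic_on UNIV" unfolding f_def
    by (rule meromorphic_on_add[OF meromorphic_on_divide[OF g'] e]) (intro meromorphic_intros)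
  define r where "r = remove_sings f"
  have rf: "r s = f s" if "s \<noteq> 1" for s
    unfolding r_def by (intro remove_sings_at_analytic analytic_on_subset[OF fa]) (use that in auto)
  have r: "r nicely_meromorphic_on UNIV" unfolding r_def by (rule remove_sings_nicely_meromorphic[OF mero])
  have sums: "(\<lambda>n. 1 / of_nat (Suc n) powr s) sums r s" if "Re s > 1" for s
  proof -
    have "s \<noteq> 1" using that by auto
    then have "r s = zeta_tail s + (1 + 2 powr (-s) + 3 powr (-s))"
      using that rf[of s] g(2)[of s] by (auto simp: f_def)
    moreover have "(\<lambda>n. 1 / of_nat (Suc (n + 3)) powr s) sums zeta_tail s"
      using zeta_tail_sums[OF that] by (simp add: powr_minus field_simps eval_nat_numeral)
    then have "(\<lambda>n. 1 / of_nat (Suc n) powr s) sums (zeta_tail s + (\<Sum>n<3. 1 / of_nat (Suc n) powr s))"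
      by (subst (asm) sums_iff_shift)
    moreover have "(\<Sum>n<3. 1 / of_nat (Suc n) powr s) = 1 + 2 powr (-s) + 3 powr (-s)"
      by (simp add: eval_nat_numeral powr_minus field_simps)
    ultimately show ?thesis by simp
  qed
  have eq: "Riemann_zeta = r" unfolding Riemann_zeta_def
  proof (rule the_equality)
    show "r nicely_meromorphic_on UNIV \<and> (\<forall>s. 1 < Re s \<longrightarrow> (\<lambda>n. 1 / of_nat (Suc n) powr s) sums r s)"
      using r sums by blast
    fix h assume h: "h nicely_meromorphic_on UNIV \<and> (\<forall>s. 1 < Re s \<longrightarrow> (\<lambda>n. 1 / of_nat (Suc n) powr s) sums h s)"
    show "h = r"
      by (rule nicely_meromorphic_eqI) (use h r sums sums_unique2 in blast)+
  qed
  show "Riemann_zeta holomorphic_on - {1}" unfolding eq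
    using f by (rule holomorphic_transform) (simp add: rf)
  show "Re s > 1 \<Longrightarrow> (\<lambda>n. 1 / of_nat (Suc n) powr s) sums Riemann_zeta s"
    unfolding eq by (rule sums)
qed

section \<open>Traces of products of infinite matrices\<close>

lemma summable_on_Sigma_bound:
  fixes f :: "'a \<times> 'b \<Rightarrow> real"
  assumes f0: "\<And>x y. x \<in> A \<Longrightarrow> y \<in> B x \<Longrightarrow> f (x, y) \<ge> 0"
    and s: "\<And>x. x \<in> A \<Longrightarrow> (\<lambda>y. f (x, y)) summable_on B x"
    and le: "\<And>x. x \<in> A \<Longrightarrow> (\<Sum>\<^sub>\<infinity>y\<in>B x. f (x, y)) \<le> g x" and g: "g summable_on A"
  shows "f summable_on Sigma A B" "infsum f (Sigma A B) \<le> infsum g A"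
proof -
  have eq: "infsum (\<lambda>y. norm (f (x, y))) (B x) = infsum (\<lambda>y. f (x, y)) (B x)" if "x \<in> A" for x
    using f0 that by (intro infsum_cong) auto
  have 0: "infsum (\<lambda>y. f (x, y)) (B x) \<ge> 0" if "x \<in> A" for x using f0 that by (intro infsum_nonneg) auto
  have gs: "(\<lambda>x. infsum (\<lambda>y. f (x, y)) (B x)) summable_on A"
    by (rule summable_on_comparison_test[OF g]) (use le 0 in auto)
  have "(\<lambda>x. norm (f x)) summable_on Sigma A B"
    unfolding Infinite_Sum.abs_summable_on_Sigma_iff
  proof (intro conjI ballI)
    fix x assume "x \<in> A"
    show "(\<lambda>y. norm (f (x, y))) summable_on B x"
      using s[OF \<open>x \<in> A\<close>] by (rule summable_on_cong[THEN iffD1, rotated]) (use f0 \<open>x \<in> A\<close> in auto)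
  next
    show "(\<lambda>x. norm (infsum (\<lambda>y. norm (f (x, y))) (B x))) summable_on A"
      using gs by (rule summable_on_cong[THEN iffD1, rotated]) (use eq 0 in auto)
  qed
  then show fs: "f summable_on Sigma A B" by (rule Infinite_Sum.abs_summable_summable)
  have "infsum f (Sigma A B) = (\<Sum>\<^sub>\<infinity>x\<in>A. \<Sum>\<^sub>\<infinity>y\<in>B x. f (x, y))"
    using infsum_Sigma'_banach[of "\<lambda>x y. f (x, y)" A B] fs by (simp add: case_prod_unfold)
  also have "\<dots> \<le> infsum g A" by (rule infsum_mono[OF gs g le])
  finally show "infsum f (Sigma A B) \<le> infsum g A" .
qed

lemma abs_summable_infsum_fibre:
  fixes f :: "'a \<times> 'b \<Rightarrow> complex"
  assumes "f abs_summable_on A \<times> K"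
  shows "(\<lambda>x. \<Sum>\<^sub>\<infinity>k\<in>K. f (x, k)) abs_summable_on A"
    "(\<Sum>\<^sub>\<infinity>x\<in>A. norm (\<Sum>\<^sub>\<infinity>k\<in>K. f (x, k))) \<le> (\<Sum>\<^sub>\<infinity>p\<in>A \<times> K. norm (f p))"
proof -
  have 1: "(\<lambda>k. norm (f (x, k))) summable_on K" if "x \<in> A" for x
    using assms that by (simp add: Infinite_Sum.abs_summable_on_Sigma_iff)
  have 2: "(\<lambda>x. \<Sum>\<^sub>\<infinity>k\<in>K. norm (f (x, k))) summable_on A"
    using assms summable_on_Sigma_banach[of "\<lambda>x k. norm (f (x, k))" A "\<lambda>_. K"] by (simp add: case_prod_unfold)
  have le: "norm (\<Sum>\<^sub>\<infinity>k\<in>K. f (x, k)) \<le> (\<Sum>\<^sub>\<infinity>k\<in>K. norm (f (x, k)))" if "x \<in> A" for x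
    by (rule norm_infsum_bound[OF 1[OF that]])
  show 3: "(\<lambda>x. \<Sum>\<^sub>\<infinity>k\<in>K. f (x, k)) abs_summable_on A"
    by (rule Infinite_Sum.abs_summable_on_comparison_test'[OF 2 le])
  have "(\<Sum>\<^sub>\<infinity>x\<in>A. norm (\<Sum>\<^sub>\<infinity>k\<in>K. f (x, k))) \<le> (\<Sum>\<^sub>\<infinity>x\<in>A. \<Sum>\<^sub>\<infinity>k\<in>K. norm (f (x, k)))"
    by (rule infsum_mono[OF 3 2 le])
  also have "\<dots> = (\<Sum>\<^sub>\<infinity>p\<in>A \<times> K. norm (f p))"
    using infsum_Sigma'_banach[of "\<lambda>x k. norm (f (x, k))" A "\<lambda>_. K"] assms by (simp add: case_prod_unfold)
  finally show "(\<Sum>\<^sub>\<infinity>x\<in>A. norm (\<Sum>\<^sub>\<infinity>k\<in>K. f (x, k))) \<le> (\<Sum>\<^sub>\<infinity>p\<in>A \<times> K. norm (f p))" .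
qed

lemma infsum_times:
  fixes f :: "'a \<Rightarrow> complex" and g :: "'b \<Rightarrow> complex"
  assumes "f abs_summable_on A" "g abs_summable_on B"
  shows "(\<Sum>\<^sub>\<infinity>(x, y)\<in>A \<times> B. f x * g y) = infsum f A * infsum g B"
proof -
  have "(\<lambda>(x, y). f x * g y) summable_on A \<times> B"
    by (rule Infinite_Sum.abs_summable_summable[OF abs_summable_on_times[OF assms]])
  then have "(\<Sum>\<^sub>\<infinity>(x, y)\<in>A \<times> B. f x * g y) = (\<Sum>\<^sub>\<infinity>x\<in>A. \<Sum>\<^sub>\<infinity>y\<in>B. f x * g y)"
    by (intro infsum_Sigma'_banach[symmetric])
  then show ?thesis by (simp add: infsum_cmult_right' infsum_cmult_left')
qed

definition words_over :: "'n set \<Rightarrow> nat \<Rightarrow> 'n list set" where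
  "words_over I m = {l. set l \<subseteq> I \<and> length l = m}"

lemma words_over_0 [simp]: "words_over I 0 = {[]}"
  by (auto simp: words_over_def)

lemma bij_betw_words_over_Suc: "bij_betw (\<lambda>(n, l). n # l) (I \<times> words_over I m) (words_over I (Suc m))"
  by (rule bij_betwI[where g = "\<lambda>l. (hd l, tl l)"]) (auto simp: words_over_def length_Suc_conv)

text \<open>\<open>A n\<close> is the matrix of the operator attached to the letter
  \<open>n\<close>. Absolute summability over row, letter and column together is the entrywise
  substitute for trace class: every interchange of sums for these matrices rests on it.\<close>

locale nuclear_family =
  fixes A :: "'n \<Rightarrow> nat \<Rightarrow> nat \<Rightarrow> complex" and I :: "'n set"
  assumes summable: "(\<lambda>(i, n, k). A n i k) abs_summable_on UNIV \<times> (I \<times> UNIV)"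
begin

definition row_norm :: "nat \<Rightarrow> real" where
  "row_norm i = (\<Sum>\<^sub>\<infinity>(n, k)\<in>I \<times> UNIV. norm (A n i k))"

definition total_norm :: real where
  "total_norm = (\<Sum>\<^sub>\<infinity>i. row_norm i)"

text \<open>\<open>Mp\<close>, \<open>Lp\<close> and \<open>Lt\<close> all multiply from the left:
  the column index stays fixed in inductions, and the row norm of the first factor meets a bound for
  the remaining product that is uniform in its rows.\<close>

primrec Mp :: "'n list \<Rightarrow> nat \<Rightarrow> nat \<Rightarrow> complex" where
  "Mp [] i j = (if i = j then 1 else 0)"
| "Mp (n # l) i j = (\<Sum>\<^sub>\<infinity>k. A n i k * Mp l k j)"

definition L :: "nat \<Rightarrow> nat \<Rightarrow> complex" where
  "L i j = (\<Sum>\<^sub>\<infinity>n\<in>I. A n i j)"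

primrec Lp :: "nat \<Rightarrow> nat \<Rightarrow> nat \<Rightarrow> complex" where
  "Lp 0 i j = (if i = j then 1 else 0)"
| "Lp (Suc m) i j = (\<Sum>\<^sub>\<infinity>k. L i k * Lp m k j)"

primrec Lt :: "nat \<Rightarrow> nat \<Rightarrow> nat \<Rightarrow> nat \<Rightarrow> complex" where
  "Lt N 0 i j = (if i = j then 1 else 0)"
| "Lt N (Suc m) i j = (\<Sum>k<N. L i k * Lt N m k j)"

text \<open>Majorant for the absolute sum of row \<open>i\<close> over all products of
  \<open>m\<close> factors. Only the first factor keeps its row norm, so for \<open>m > 0\<close>
  the bound is summable in \<open>i\<close>, as traces demand; for \<open>m = 0\<close> the product
  is the identity, with row sums 1.\<close>

definition row_bound :: "nat \<Rightarrow> nat \<Rightarrow> real" where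
  "row_bound m i = (if m = 0 then 1 else row_norm i * total_norm ^ (m - 1))"

lemma row_summable: "(\<lambda>(n, k). norm (A n i k)) summable_on I \<times> UNIV"
  using summable by (auto simp: Infinite_Sum.abs_summable_on_Sigma_iff case_prod_unfold)

lemma row_norm_nonneg: "row_norm i \<ge> 0"
  unfolding row_norm_def by (rule infsum_nonneg) auto

lemma row_norm_summable: "row_norm summable_on UNIV"
  unfolding row_norm_def
  using summable_on_Sigma_banach[of "\<lambda>i p. norm (A (fst p) i (snd p))" UNIV "\<lambda>_. I \<times> UNIV"] summable
  by (simp add: case_prod_unfold)

lemma row_norm_le: "row_norm i \<le> total_norm"
  using infsum_mono_neutral[of row_norm "{i}" row_norm UNIV] row_norm_summable row_norm_nonneg
  by (simp add: total_norm_def)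

lemma total_norm_nonneg: "total_norm \<ge> 0"
  using row_norm_nonneg[of 0] row_norm_le[of 0] by linarith

lemma row_bound_le: "row_bound m i \<le> total_norm ^ m"
  using row_norm_le[of i] total_norm_nonneg
  by (cases m) (auto simp: row_bound_def intro!: mult_right_mono)

lemma row_bound_nonneg: "row_bound m i \<ge> 0"
  using row_norm_nonneg total_norm_nonneg by (auto simp: row_bound_def)

lemma row_bound_summable: "m > 0 \<Longrightarrow> row_bound m summable_on UNIV"
  unfolding row_bound_def by (auto intro: summable_on_cmult_left row_norm_summable)

lemma infsum_row_bound: "m > 0 \<Longrightarrow> (\<Sum>\<^sub>\<infinity>i. row_bound m i) = total_norm ^ m"
  unfolding row_bound_def by (cases m) (auto simp: infsum_cmult_left' total_norm_def)

lemma A_col_summable: "(\<lambda>n. norm (A n i k)) summable_on I"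
  using summable_on_reindex[of "\<lambda>n. (n, k)" I "\<lambda>(n, k). norm (A n i k)"]
    summable_on_subset_banach[OF row_summable[of i], of "(\<lambda>n. (n, k)) ` I"]
  by (auto simp: inj_on_def o_def)

lemma A_row_summable: "n \<in> I \<Longrightarrow> (\<lambda>k. norm (A n i k)) summable_on UNIV"
  using summable_on_reindex[of "\<lambda>k. (n, k)" UNIV "\<lambda>(n, k). norm (A n i k)"]
    summable_on_subset_banach[OF row_summable[of i], of "(\<lambda>k. (n, k)) ` UNIV"]
  by (auto simp: inj_on_def o_def)

text \<open>The later factors contribute at most \<open>total_norm ^ m\<close> whatever the
  intermediate index, so they are summed first and the row of the first factor last; a bijection
  regroups first letter and remainder into one word.\<close>

lemma step_summable:
  assumes IH: "\<And>k. (\<lambda>(l, j). Mp l k j) abs_summable_on words_over I m \<times> UNIV"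
    "\<And>k. (\<Sum>\<^sub>\<infinity>(l, j)\<in>words_over I m \<times> UNIV. norm (Mp l k j)) \<le> row_bound m k"
  shows "(\<lambda>((l, j), k). A (hd l) i k * Mp (tl l) k j) abs_summable_on (words_over I (Suc m) \<times> UNIV) \<times> UNIV"
    "(\<Sum>\<^sub>\<infinity>((l, j), k)\<in>(words_over I (Suc m) \<times> UNIV) \<times> UNIV. norm (A (hd l) i k * Mp (tl l) k j)) \<le> row_bound (Suc m) i"
proof -
  define f where "f = (\<lambda>((n, k), (l, j)). norm (A n i k) * norm (Mp l k j))"
  define g where "g = (\<lambda>(n, k). norm (A n i k) * total_norm ^ m)"
  have IH1: "(\<lambda>p. norm (Mp (fst p) k (snd p))) summable_on words_over I m \<times> UNIV" for k
    using IH(1)[of k] by (simp add: case_prod_unfold)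
  have IH2: "(\<Sum>\<^sub>\<infinity>p\<in>words_over I m \<times> UNIV. norm (Mp (fst p) k (snd p))) \<le> total_norm ^ m" for k
    using order_trans[OF IH(2)[of k] row_bound_le] by (simp add: case_prod_unfold)
  have g: "g summable_on I \<times> UNIV"
    using summable_on_cmult_left[OF row_summable[of i], of "total_norm ^ m"] by (simp add: g_def case_prod_unfold)
  have s: "(\<lambda>y. f (p, y)) summable_on words_over I m \<times> UNIV" for p
      unfolding f_def case_prod_unfold fst_conv snd_conv by (rule summable_on_cmult_right[OF IH1])
  have le: "(\<Sum>\<^sub>\<infinity>y\<in>words_over I m \<times> UNIV. f (p, y)) \<le> g p" for p
  proof -
    have "(\<Sum>\<^sub>\<infinity>y\<in>words_over I m \<times> UNIV. f (p, y)) = norm (A (fst p) i (snd p)) * (\<Sum>\<^sub>\<infinity>q\<in>words_over I m \<times> UNIV. norm (Mp (fst q) (snd p) (snd q)))"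
      unfolding f_def case_prod_unfold fst_conv snd_conv by (rule infsum_cmult_right')
    also have "\<dots> \<le> norm (A (fst p) i (snd p)) * total_norm ^ m"
      by (rule mult_left_mono[OF IH2]) simp
    finally show ?thesis by (simp add: g_def case_prod_unfold)
  qed
  have f0: "f (x, y) \<ge> 0" for x y by (simp add: f_def case_prod_unfold)
  note S = summable_on_Sigma_bound[of "I \<times> UNIV" "\<lambda>_. words_over I m \<times> UNIV" f g, OF f0 s le g]
  have "infsum g (I \<times> UNIV) = row_bound (Suc m) i"
    unfolding g_def row_bound_def row_norm_def case_prod_unfold by (simp add: infsum_cmult_left')
  with S have f: "f summable_on (I \<times> UNIV) \<times> (words_over I m \<times> UNIV)"
    "infsum f ((I \<times> UNIV) \<times> (words_over I m \<times> UNIV)) \<le> row_bound (Suc m) i" by auto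
  define h where "h = (\<lambda>((l, j), k). norm (A (hd l) i k * Mp (tl l) k j))"
  have bij: "bij_betw (\<lambda>((n, k), (l, j)). ((n # l, j), k)) ((I \<times> UNIV) \<times> (words_over I m \<times> (UNIV::nat set))) ((words_over I (Suc m) \<times> UNIV) \<times> (UNIV::nat set))"
    by (rule bij_betwI[where g = "\<lambda>((l, j), k). ((hd l, k), (tl l, j))"]) (auto simp: words_over_def length_Suc_conv)
  have hf: "h ((\<lambda>((n, k), (l, j)). ((n # l, j), k)) x) = f x" for x
    by (auto simp: h_def f_def norm_mult case_prod_unfold)
  have "h summable_on (words_over I (Suc m) \<times> UNIV) \<times> UNIV"
    using f(1) summable_on_reindex_bij_betw[OF bij, of h] unfolding hf by simp
  moreover have "infsum h ((words_over I (Suc m) \<times> UNIV) \<times> UNIV) \<le> row_bound (Suc m) i"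
    using f(2) infsum_reindex_bij_betw[OF bij, of h] unfolding hf by simp
  ultimately show "(\<lambda>((l, j), k). A (hd l) i k * Mp (tl l) k j) abs_summable_on (words_over I (Suc m) \<times> UNIV) \<times> UNIV"
    "(\<Sum>\<^sub>\<infinity>((l, j), k)\<in>(words_over I (Suc m) \<times> UNIV) \<times> UNIV. norm (A (hd l) i k * Mp (tl l) k j)) \<le> row_bound (Suc m) i"
    by (simp_all add: h_def case_prod_unfold)
qed

lemma Mp_words_over_Suc:
  "l \<in> words_over I (Suc m) \<Longrightarrow> Mp l i j = (\<Sum>\<^sub>\<infinity>k. A (hd l) i k * Mp (tl l) k j)"
  by (cases l) (auto simp: words_over_def)

lemma Mp_row:
  "(\<lambda>(l, j). Mp l i j) abs_summable_on words_over I m \<times> UNIV"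
  "(\<Sum>\<^sub>\<infinity>(l, j)\<in>words_over I m \<times> UNIV. norm (Mp l i j)) \<le> row_bound m i"
proof -
  have "(\<lambda>(l, j). Mp l i j) abs_summable_on words_over I m \<times> UNIV \<and>
    (\<Sum>\<^sub>\<infinity>(l, j)\<in>words_over I m \<times> UNIV. norm (Mp l i j)) \<le> row_bound m i"
  proof (induction m arbitrary: i)
    case 0
    define f where "f = (\<lambda>p::'n list \<times> nat. norm (Mp (fst p) i (snd p)))"
    have fz: "f p = 0" if "p \<in> words_over I 0 \<times> UNIV - {([], i)}" for p
      using that by (cases p) (simp add: f_def)
    have "(f has_sum f ([], i)) (words_over I 0 \<times> UNIV)"
      by (rule has_sum_cong_neutral[THEN iffD1, OF _ _ _ has_sum_finite[of "{([], i)}" f, simplified]]) (use fz in auto)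
    then have "f summable_on words_over I 0 \<times> UNIV" "infsum f (words_over I 0 \<times> UNIV) = 1"
      by (auto simp: has_sum_iff f_def)
    then show ?case by (simp add: f_def case_prod_unfold row_bound_def)
  next
    case (Suc m)
    have s: "(\<lambda>p. A (hd (fst (fst p))) i (snd p) * Mp (tl (fst (fst p))) (snd p) (snd (fst p))) abs_summable_on (words_over I (Suc m) \<times> UNIV) \<times> UNIV"
      and b: "(\<Sum>\<^sub>\<infinity>p\<in>(words_over I (Suc m) \<times> UNIV) \<times> UNIV. norm (A (hd (fst (fst p))) i (snd p) * Mp (tl (fst (fst p))) (snd p) (snd (fst p)))) \<le> row_bound (Suc m) i"
      using step_summable[of m i] Suc.IH by (simp_all add: case_prod_unfold)
    note F = abs_summable_infsum_fibre[OF s, simplified]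
    have eq: "norm (\<Sum>\<^sub>\<infinity>k. A (hd (fst p)) i k * Mp (tl (fst p)) k (snd p)) = norm (Mp (fst p) i (snd p))"
      if "p \<in> words_over I (Suc m) \<times> UNIV" for p
      using that Mp_words_over_Suc by auto
    have "(\<lambda>p. norm (Mp (fst p) i (snd p))) summable_on words_over I (Suc m) \<times> UNIV"
      using F(1) by (rule summable_on_cong[THEN iffD1, rotated]) (rule eq)
    moreover have "(\<Sum>\<^sub>\<infinity>p\<in>words_over I (Suc m) \<times> UNIV. norm (Mp (fst p) i (snd p)))
      = (\<Sum>\<^sub>\<infinity>p\<in>words_over I (Suc m) \<times> UNIV. norm (\<Sum>\<^sub>\<infinity>k. A (hd (fst p)) i k * Mp (tl (fst p)) k (snd p)))"
      by (rule infsum_cong[OF eq[symmetric]])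
    then have "(\<Sum>\<^sub>\<infinity>p\<in>words_over I (Suc m) \<times> UNIV. norm (Mp (fst p) i (snd p))) \<le> row_bound (Suc m) i"
      using order_trans[OF F(2) b] by simp
    ultimately show ?case by (simp add: case_prod_unfold)
  qed
  then show "(\<lambda>(l, j). Mp l i j) abs_summable_on words_over I m \<times> UNIV"
    "(\<Sum>\<^sub>\<infinity>(l, j)\<in>words_over I m \<times> UNIV. norm (Mp l i j)) \<le> row_bound m i" by auto
qed

lemma Mp_col_summable:
  "(\<lambda>l. norm (Mp l i j)) summable_on words_over I m"
  "(\<Sum>\<^sub>\<infinity>l\<in>words_over I m. norm (Mp l i j)) \<le> row_bound m i"
proof -
  define f where "f = (\<lambda>p. norm (Mp (fst p) i (snd p)))"
  have f: "f summable_on words_over I m \<times> UNIV" "infsum f (words_over I m \<times> UNIV) \<le> row_bound m i"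
    using Mp_row[of i m] by (simp_all add: f_def case_prod_unfold)
  have inj: "inj_on (\<lambda>l. (l, j)) (words_over I m)" by (auto simp: inj_on_def)
  have sub: "(\<lambda>l. (l, j)) ` words_over I m \<subseteq> words_over I m \<times> UNIV" by auto
  have s: "f summable_on (\<lambda>l. (l, j)) ` words_over I m" by (rule summable_on_subset_banach[OF f(1) sub])
  then show "(\<lambda>l. norm (Mp l i j)) summable_on words_over I m"
    using summable_on_reindex[OF inj, of f] by (simp add: f_def o_def)
  have "(\<Sum>\<^sub>\<infinity>l\<in>words_over I m. norm (Mp l i j)) = infsum f ((\<lambda>l. (l, j)) ` words_over I m)"
    using infsum_reindex[OF inj, of f] by (simp add: f_def o_def)
  also have "\<dots> \<le> infsum f (words_over I m \<times> UNIV)"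
    by (rule infsum_mono2[OF s f(1) sub]) (simp add: f_def)
  finally show "(\<Sum>\<^sub>\<infinity>l\<in>words_over I m. norm (Mp l i j)) \<le> row_bound m i" using f(2) by simp
qed

lemma norm_Mp_le: "l \<in> words_over I m \<Longrightarrow> norm (Mp l i j) \<le> row_bound m i"
  using finite_sum_le_infsum[OF Mp_col_summable(1)[of i j m], of "{l}"] Mp_col_summable(2)[of i j m] by auto

text \<open>Distributivity for infinitely many letters: the power of a sum is the sum over all
  words. Absolute summability allows the intermediate index to be moved outside the sum over
  words.\<close>

lemma infsum_Mp_words: "(\<Sum>\<^sub>\<infinity>l\<in>words_over I m. Mp l i j) = Lp m i j"
proof (induction m arbitrary: i)
  case (Suc m)
  define f where "f = (\<lambda>p. A (hd (fst p)) i (snd p) * Mp (tl (fst p)) (snd p) j)"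
  have s: "(\<lambda>p. A (hd (fst (fst p))) i (snd p) * Mp (tl (fst (fst p))) (snd p) (snd (fst p))) abs_summable_on (words_over I (Suc m) \<times> UNIV) \<times> UNIV"
    using step_summable[OF Mp_row[of _ m]] by (simp add: case_prod_unfold)
  have inj: "inj_on (\<lambda>(l, k). ((l, j), k)) (words_over I (Suc m) \<times> UNIV)" by (auto simp: inj_on_def)
  have "(\<lambda>p. A (hd (fst (fst p))) i (snd p) * Mp (tl (fst (fst p))) (snd p) (snd (fst p))) abs_summable_on (\<lambda>(l, k). ((l, j), k)) ` (words_over I (Suc m) \<times> UNIV)"
    by (rule summable_on_subset_banach[OF s]) auto
  then have "f abs_summable_on words_over I (Suc m) \<times> UNIV"
    unfolding summable_on_reindex[OF inj] by (simp add: f_def o_def case_prod_unfold)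
  then have fs: "(\<lambda>(l, k). f (l, k)) summable_on words_over I (Suc m) \<times> UNIV"
    using Infinite_Sum.abs_summable_summable by simp
  have "(\<Sum>\<^sub>\<infinity>l\<in>words_over I (Suc m). Mp l i j) = (\<Sum>\<^sub>\<infinity>l\<in>words_over I (Suc m). \<Sum>\<^sub>\<infinity>k. f (l, k))"
    by (intro infsum_cong) (simp add: Mp_words_over_Suc f_def)
  also have "\<dots> = (\<Sum>\<^sub>\<infinity>k. \<Sum>\<^sub>\<infinity>l\<in>words_over I (Suc m). f (l, k))"
    by (rule infsum_swap_banach[OF fs])
  also have "\<dots> = (\<Sum>\<^sub>\<infinity>k. L i k * Lp m k j)"
  proof (intro infsum_cong)
    fix k
    have "(\<Sum>\<^sub>\<infinity>l\<in>words_over I (Suc m). f (l, k)) = (\<Sum>\<^sub>\<infinity>p\<in>I \<times> words_over I m. f (fst p # snd p, k))"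
      using infsum_reindex_bij_betw[OF bij_betw_words_over_Suc, of "\<lambda>l. f (l, k)" I m] by (simp add: case_prod_unfold)
    also have "\<dots> = (\<Sum>\<^sub>\<infinity>(n, l)\<in>I \<times> words_over I m. A n i k * Mp l k j)"
      by (simp add: f_def case_prod_unfold)
    also have "\<dots> = L i k * Lp m k j"
      unfolding L_def Suc.IH[symmetric] by (rule infsum_times[OF A_col_summable Mp_col_summable(1)])
    finally show "(\<Sum>\<^sub>\<infinity>l\<in>words_over I (Suc m). f (l, k)) = L i k * Lp m k j" .
  qed
  finally show ?case by simp
qed simp

definition word_trace :: "'n list \<Rightarrow> complex" where
  "word_trace l = (\<Sum>\<^sub>\<infinity>i. Mp l i i)"

lemma diag_summable:
  assumes "m > 0"
  shows "(\<lambda>(i, l). Mp l i i) abs_summable_on UNIV \<times> words_over I m"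
    "(\<Sum>\<^sub>\<infinity>(i, l)\<in>UNIV \<times> words_over I m. norm (Mp l i i)) \<le> total_norm ^ m"
proof -
  define f where "f = (\<lambda>p. norm (Mp (snd p) (fst p) (fst p)))"
  have "f (x, y) \<ge> 0" "(\<lambda>y. f (x, y)) summable_on words_over I m"
    "(\<Sum>\<^sub>\<infinity>y\<in>words_over I m. f (x, y)) \<le> row_bound m x" for x y
    using Mp_col_summable by (simp_all add: f_def)
  note summable_on_Sigma_bound[of UNIV "\<lambda>_. words_over I m" f "row_bound m", OF this row_bound_summable[OF assms]]
  then show "(\<lambda>(i, l). Mp l i i) abs_summable_on UNIV \<times> words_over I m"
    "(\<Sum>\<^sub>\<infinity>(i, l)\<in>UNIV \<times> words_over I m. norm (Mp l i i)) \<le> total_norm ^ m"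
    unfolding infsum_row_bound[OF assms] f_def case_prod_unfold by auto
qed

lemma word_trace_summable:
  assumes "m > 0"
  shows "word_trace abs_summable_on words_over I m"
    "(\<Sum>\<^sub>\<infinity>l\<in>words_over I m. norm (word_trace l)) \<le> total_norm ^ m"
    "(\<Sum>\<^sub>\<infinity>l\<in>words_over I m. word_trace l) = (\<Sum>\<^sub>\<infinity>i. Lp m i i)"
    "(\<lambda>i. Lp m i i) summable_on UNIV"
proof -
  have bij: "bij_betw prod.swap (words_over I m \<times> (UNIV::nat set)) (UNIV \<times> words_over I m)"
    by (auto simp: bij_betw_def inj_on_def)
  define f where "f = (\<lambda>p. Mp (fst p) (snd p) (snd p))"
  have f: "f abs_summable_on words_over I m \<times> UNIV"
    using diag_summable(1)[OF assms] summable_on_reindex_bij_betw[OF bij, of "\<lambda>(i, l). norm (Mp l i i)"]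
    by (simp add: f_def case_prod_unfold)
  have fb: "(\<Sum>\<^sub>\<infinity>p\<in>words_over I m \<times> UNIV. norm (f p)) \<le> total_norm ^ m"
    using diag_summable(2)[OF assms] infsum_reindex_bij_betw[OF bij, of "\<lambda>(i, l). norm (Mp l i i)"]
    by (simp add: f_def case_prod_unfold)
  show "word_trace abs_summable_on words_over I m"
    using abs_summable_infsum_fibre(1)[OF f] by (simp add: f_def word_trace_def)
  show "(\<Sum>\<^sub>\<infinity>l\<in>words_over I m. norm (word_trace l)) \<le> total_norm ^ m"
    using order_trans[OF abs_summable_infsum_fibre(2)[OF f] fb] by (simp add: f_def word_trace_def)
  have "(\<Sum>\<^sub>\<infinity>l\<in>words_over I m. word_trace l) = (\<Sum>\<^sub>\<infinity>i. \<Sum>\<^sub>\<infinity>l\<in>words_over I m. Mp l i i)"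
    unfolding word_trace_def using Infinite_Sum.abs_summable_summable[OF f]
    by (intro infsum_swap_banach) (simp add: f_def case_prod_unfold)
  then show "(\<Sum>\<^sub>\<infinity>l\<in>words_over I m. word_trace l) = (\<Sum>\<^sub>\<infinity>i. Lp m i i)" by (simp add: infsum_Mp_words)
  have "(\<lambda>i. \<Sum>\<^sub>\<infinity>l\<in>words_over I m. Mp l i i) summable_on UNIV"
    using Infinite_Sum.abs_summable_summable[OF diag_summable(1)[OF assms]]
    by (intro summable_on_Sigma_banach) (simp add: case_prod_unfold)
  then show "(\<lambda>i. Lp m i i) summable_on UNIV" by (simp add: infsum_Mp_words)
qed

lemma norm_L_summable: "(\<lambda>k. norm (L i k)) summable_on UNIV" "(\<Sum>\<^sub>\<infinity>k. norm (L i k)) \<le> row_norm i"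
proof -
  have bij: "bij_betw prod.swap ((UNIV::nat set) \<times> I) (I \<times> UNIV)"
    by (auto simp: bij_betw_def inj_on_def)
  have f: "(\<lambda>p. A (snd p) i (fst p)) abs_summable_on UNIV \<times> I"
    using row_summable[of i] summable_on_reindex_bij_betw[OF bij, of "\<lambda>(n, k). norm (A n i k)"]
    by (simp add: case_prod_unfold)
  have b: "(\<Sum>\<^sub>\<infinity>p\<in>UNIV \<times> I. norm (A (snd p) i (fst p))) = row_norm i"
    unfolding row_norm_def using infsum_reindex_bij_betw[OF bij, of "\<lambda>(n, k). norm (A n i k)"]
    by (simp add: case_prod_unfold)
  show "(\<lambda>k. norm (L i k)) summable_on UNIV"
    using abs_summable_infsum_fibre(1)[OF f] by (simp add: L_def)
  show "(\<Sum>\<^sub>\<infinity>k. norm (L i k)) \<le> row_norm i"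
    using abs_summable_infsum_fibre(2)[OF f] unfolding b by (simp add: L_def)
qed

lemma sum_norm_L_le: "(\<Sum>k<N. norm (L i k)) \<le> row_norm i"
  using finite_sum_le_infsum[OF norm_L_summable(1)[of i], of "{..<N}"] norm_L_summable(2)[of i] by auto

text \<open>The bound does not depend on the size \<open>N\<close>; dominated convergence of the
  truncations rests on this uniformity.\<close>

lemma norm_Lt_le: "norm (Lt N m i j) \<le> row_bound m i"
proof (induction m arbitrary: i)
  case (Suc m)
  have "norm (Lt N (Suc m) i j) \<le> (\<Sum>k<N. norm (L i k) * total_norm ^ m)"
    unfolding Lt.simps
  proof (rule sum_norm_le)
    fix k
    show "norm (L i k * Lt N m k j) \<le> norm (L i k) * total_norm ^ m"
      unfolding norm_mult by (rule mult_left_mono[OF order_trans[OF Suc.IH row_bound_le]]) simp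
  qed
  also have "\<dots> = (\<Sum>k<N. norm (L i k)) * total_norm ^ m" by (simp add: sum_distrib_right)
  also have "\<dots> \<le> row_norm i * total_norm ^ m"
    using sum_norm_L_le total_norm_nonneg by (intro mult_right_mono) auto
  finally show ?case by (simp add: row_bound_def)
qed (simp add: row_bound_def)

text \<open>Range and summands both depend on \<open>N\<close>. Extending by zero beyond
  \<open>N\<close> leaves each fixed summand eventually unchanged, and Tannery's theorem applies
  with majorant \<open>M\<close>.\<close>

lemma truncated_sum_tendsto:
  fixes a :: "nat \<Rightarrow> nat \<Rightarrow> complex"
  assumes lim: "\<And>k. (\<lambda>N. a k N) \<longlonglongrightarrow> b k" and le: "\<And>k N. norm (a k N) \<le> M k"
    and M: "M summable_on UNIV" and M0: "\<And>k. M k \<ge> 0" and bs: "b summable_on UNIV"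
  shows "(\<lambda>N. \<Sum>k<N. a k N) \<longlonglongrightarrow> (\<Sum>\<^sub>\<infinity>k. b k)"
proof -
  define a' where "a' = (\<lambda>k N. if k < N then a k N else 0)"
  have "((\<lambda>N. \<Sum>k. a' k N) \<longlongrightarrow> suminf b) sequentially"
  proof (rule tannerys_theorem[THEN conjunct2, THEN conjunct2])
    fix k
    have "eventually (\<lambda>N. a k N = a' k N) sequentially"
      using eventually_gt_at_top[of k] by eventually_elim (simp add: a'_def)
    then show "(\<lambda>N. a' k N) \<longlonglongrightarrow> b k" using lim[of k] by (rule Lim_transform_eventually[rotated])
  next
    show "\<forall>\<^sub>F (k, n) in sequentially \<times>\<^sub>F sequentially. norm (a' k n) \<le> M k"
      by (rule always_eventually) (use le M0 in \<open>auto simp: a'_def\<close>)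
    show "summable M" by (rule summable_on_imp_summable[OF M])
  qed simp
  moreover have "(\<Sum>k. a' k N) = (\<Sum>k<N. a k N)" for N
    by (subst suminf_finite[of "{..<N}"]) (auto simp: a'_def)
  moreover have "suminf b = (\<Sum>\<^sub>\<infinity>k. b k)"
    using has_sum_imp_sums[OF has_sum_infsum[OF bs]] by (simp add: sums_iff)
  ultimately show ?thesis by simp
qed

lemma Lt_tendsto: "(\<lambda>N. Lt N m i j) \<longlonglongrightarrow> Lp m i j"
proof (induction m arbitrary: i)
  case (Suc m)
  have Lp_le: "norm (Lp m k j) \<le> total_norm ^ m" for k
  proof (rule tendsto_upperbound[OF tendsto_norm[OF Suc.IH[of k]]])
    show "\<forall>\<^sub>F N in sequentially. norm (Lt N m k j) \<le> total_norm ^ m"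
      by (intro always_eventually allI order_trans[OF norm_Lt_le row_bound_le])
  qed simp
  have le: "norm (L i k * z) \<le> norm (L i k) * total_norm ^ m" if "norm z \<le> total_norm ^ m" for k z
    unfolding norm_mult using that by (intro mult_left_mono) auto
  have s: "(\<lambda>k. norm (L i k) * total_norm ^ m) summable_on UNIV"
    by (rule summable_on_cmult_left[OF norm_L_summable(1)])
  have "(\<lambda>N. \<Sum>k<N. L i k * Lt N m k j) \<longlonglongrightarrow> (\<Sum>\<^sub>\<infinity>k. L i k * Lp m k j)"
  proof (rule truncated_sum_tendsto[OF _ _ s])
    show "(\<lambda>N. L i k * Lt N m k j) \<longlonglongrightarrow> L i k * Lp m k j" for k by (intro tendsto_intros Suc.IH)
    show "norm (L i k * Lt N m k j) \<le> norm (L i k) * total_norm ^ m" for k N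
      by (rule le[OF order_trans[OF norm_Lt_le row_bound_le]])
    have "(\<lambda>k. L i k * Lp m k j) abs_summable_on UNIV"
      by (rule Infinite_Sum.abs_summable_on_comparison_test'[OF s]) (rule le[OF Lp_le])
    then show "(\<lambda>k. L i k * Lp m k j) summable_on UNIV" by (rule Infinite_Sum.abs_summable_summable)
  qed (use total_norm_nonneg in auto)
  then show ?case by simp
qed simp

lemma Lt_trace_tendsto:
  assumes "m > 0"
  shows "(\<lambda>N. \<Sum>i<N. Lt N m i i) \<longlonglongrightarrow> (\<Sum>\<^sub>\<infinity>l\<in>words_over I m. word_trace l)"
  unfolding word_trace_summable(3)[OF assms]
  by (rule truncated_sum_tendsto[OF Lt_tendsto norm_Lt_le row_bound_summable[OF assms] row_bound_nonneg word_trace_summable(4)[OF assms]])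

lemma norm_Lt_trace_le:
  assumes "m > 0"
  shows "norm (\<Sum>i<N. Lt N m i i) \<le> total_norm ^ m"
proof -
  have "norm (\<Sum>i<N. Lt N m i i) \<le> (\<Sum>i<N. row_bound m i)" by (rule sum_norm_le[OF norm_Lt_le])
  also have "\<dots> \<le> infsum (row_bound m) UNIV"
    by (rule finite_sum_le_infsum[OF row_bound_summable[OF assms]]) (auto simp: row_bound_nonneg)
  finally show ?thesis by (simp add: infsum_row_bound[OF assms])
qed

end

section \<open>Determinants and entrywise norms\<close>

text \<open>The factors of one product are exchanged for those of the other one at a time; the
  summand for \<open>k\<close> pays \<open>d k\<close> for the exchanged factor and
  \<open>E i\<close> for all others.\<close>

lemma abs_prod_diff_le:
  fixes x y :: "'i \<Rightarrow> complex" and E d :: "'i \<Rightarrow> real"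
  assumes "finite I" "\<And>i. i \<in> I \<Longrightarrow> norm (x i) \<le> E i" "\<And>i. i \<in> I \<Longrightarrow> norm (y i) \<le> E i"
    "\<And>i. i \<in> I \<Longrightarrow> norm (x i - y i) \<le> d i"
  shows "norm ((\<Prod>i\<in>I. x i) - (\<Prod>i\<in>I. y i)) \<le> (\<Sum>k\<in>I. d k * (\<Prod>i\<in>I - {k}. E i))"
  using assms
proof (induction I)
  case (insert a I)
  have E0: "E i \<ge> 0" if "i \<in> insert a I" for i using insert.prems(1)[OF that] norm_ge_zero order_trans by blast
  have "(\<Prod>i\<in>insert a I. x i) - (\<Prod>i\<in>insert a I. y i)
      = (x a - y a) * (\<Prod>i\<in>I. x i) + y a * ((\<Prod>i\<in>I. x i) - (\<Prod>i\<in>I. y i))"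
    using insert.hyps by (simp add: algebra_simps)
  also have "norm \<dots> \<le> norm (x a - y a) * norm (\<Prod>i\<in>I. x i) + norm (y a) * norm ((\<Prod>i\<in>I. x i) - (\<Prod>i\<in>I. y i))"
    using norm_triangle_ineq[of "(x a - y a) * (\<Prod>i\<in>I. x i)" "y a * ((\<Prod>i\<in>I. x i) - (\<Prod>i\<in>I. y i))"] by (simp add: norm_mult)
  also have "\<dots> \<le> d a * (\<Prod>i\<in>I. E i) + E a * (\<Sum>k\<in>I. d k * (\<Prod>i\<in>I - {k}. E i))"
  proof (intro add_mono mult_mono)
    show "norm (\<Prod>i\<in>I. x i) \<le> (\<Prod>i\<in>I. E i)"
      unfolding prod_norm[symmetric] using insert.prems by (intro prod_mono) auto
    show "norm ((\<Prod>i\<in>I. x i) - (\<Prod>i\<in>I. y i)) \<le> (\<Sum>k\<in>I. d k * (\<Prod>i\<in>I - {k}. E i))"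
      using insert.prems by (intro insert.IH) auto
    show "0 \<le> d a" using insert.prems(3)[of a] norm_ge_zero order_trans by blast
  qed (use insert.prems E0 in auto)
  also have "E a * (\<Sum>k\<in>I. d k * (\<Prod>i\<in>I - {k}. E i)) = (\<Sum>k\<in>I. d k * (\<Prod>i\<in>insert a I - {k}. E i))"
    unfolding sum_distrib_left
  proof (intro sum.cong refl)
    fix k assume k: "k \<in> I"
    have "insert a I - {k} = insert a (I - {k})" using insert.hyps k by auto
    then show "E a * (d k * prod E (I - {k})) = d k * prod E (insert a I - {k})"
      using insert.hyps by simp
  qed
  also have "d a * (\<Prod>i\<in>I. E i) + (\<Sum>k\<in>I. d k * (\<Prod>i\<in>insert a I - {k}. E i)) = (\<Sum>k\<in>insert a I. d k * (\<Prod>i\<in>insert a I - {k}. E i))"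
    using insert.hyps by simp
  finally show ?case .
qed simp

text \<open>Enlarging the range to all maps only adds nonnegative terms, and a sum over all maps
  factors over the rows. Restriction reconciles permutations, which are the identity outside
  \<open>{0..<n}\<close>, with extensional functions, which are \<open>undefined\<close>
  there.\<close>

lemma sum_permutations_le_sum_functions:
  fixes f :: "(nat \<Rightarrow> nat) \<Rightarrow> real"
  assumes "\<And>g. g \<in> {0..<n} \<rightarrow>\<^sub>E {0..<n} \<Longrightarrow> f g \<ge> 0"
    "\<And>p. p permutes {0..<n} \<Longrightarrow> f p = f (restrict p {0..<n})"
  shows "(\<Sum>p | p permutes {0..<n}. f p) \<le> (\<Sum>g\<in>{0..<n} \<rightarrow>\<^sub>E {0..<n}. f g)"
proof -
  let ?r = "\<lambda>p. restrict p {0..<n}"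
  have inj: "inj_on ?r {p. p permutes {0..<n}}"
  proof (rule inj_onI)
    fix p q assume pq: "p \<in> {p. p permutes {0..<n}}" "q \<in> {p. p permutes {0..<n}}" "?r p = ?r q"
    show "p = q"
    proof
      fix i show "p i = q i"
        using pq(1,2) fun_cong[OF pq(3), of i] by (cases "i < n") (auto simp: permutes_def)
    qed
  qed
  have "(\<Sum>p | p permutes {0..<n}. f p) = (\<Sum>p | p permutes {0..<n}. f (?r p))"
    using assms(2) by (intro sum.cong) auto
  also have "\<dots> = sum f (?r ` {p. p permutes {0..<n}})"
    using inj by (simp add: sum.reindex)
  also have "\<dots> \<le> (\<Sum>g\<in>{0..<n} \<rightarrow>\<^sub>E {0..<n}. f g)"
    using assms(1) by (intro sum_mono2 finite_PiE) (auto simp: permutes_in_image)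
  finally show ?thesis .
qed

text \<open>Each difference of products in the Leibniz formula is telescoped; the sum over
  permutations, enlarged to all maps, becomes a product of row sums in which a single row
  \<open>k\<close> carries the differences.\<close>

lemma norm_det_diff_le:
  fixes X Y :: "complex mat" and E d :: "nat \<Rightarrow> nat \<Rightarrow> real"
  assumes X: "X \<in> carrier_mat n n" and Y: "Y \<in> carrier_mat n n"
    and XE: "\<And>i j. i < n \<Longrightarrow> j < n \<Longrightarrow> norm (X $$ (i, j)) \<le> E i j"
    and YE: "\<And>i j. i < n \<Longrightarrow> j < n \<Longrightarrow> norm (Y $$ (i, j)) \<le> E i j"
    and XY: "\<And>i j. i < n \<Longrightarrow> j < n \<Longrightarrow> norm (X $$ (i, j) - Y $$ (i, j)) \<le> d i j"
  shows "norm (Determinant.det X - Determinant.det Y)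
    \<le> (\<Sum>k<n. (\<Sum>j<n. d k j) * (\<Prod>i\<in>{..<n} - {k}. \<Sum>j<n. E i j))"
proof -
  have E0: "E i j \<ge> 0" if "i < n" "j < n" for i j using XE[OF that] norm_ge_zero order_trans by blast
  have d0: "d i j \<ge> 0" if "i < n" "j < n" for i j using XY[OF that] norm_ge_zero order_trans by blast
  define f where "f = (\<lambda>g. \<Sum>k\<in>{0..<n}. d k (g k) * (\<Prod>i\<in>{0..<n} - {k}. E i (g i)))"
  have "Determinant.det X - Determinant.det Y
      = (\<Sum>p | p permutes {0..<n}. signof p * ((\<Prod>i = 0..<n. X $$ (i, p i)) - (\<Prod>i = 0..<n. Y $$ (i, p i))))"
    unfolding det_def'[OF X] det_def'[OF Y] by (simp add: sum_subtractf right_diff_distrib)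
  also have "norm \<dots> \<le> (\<Sum>p | p permutes {0..<n}. f p)"
  proof (rule sum_norm_le)
    fix p assume "p \<in> {p. p permutes {0..<n}}"
    then have p: "i < n \<Longrightarrow> p i < n" for i using permutes_in_image[of p "{0..<n}" i] by auto
    have s: "norm (signof p :: complex) = 1" by (simp add: sign_def)
    show "norm (signof p * ((\<Prod>i = 0..<n. X $$ (i, p i)) - (\<Prod>i = 0..<n. Y $$ (i, p i)))) \<le> f p"
      unfolding norm_mult s f_def mult_1 using p by (intro abs_prod_diff_le) (auto intro: XE YE XY)
  qed
  also have "\<dots> \<le> (\<Sum>g\<in>{0..<n} \<rightarrow>\<^sub>E {0..<n}. f g)"
  proof (rule sum_permutations_le_sum_functions)
    fix g assume "g \<in> {0..<n} \<rightarrow>\<^sub>E {0..<n}"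
    then have "i < n \<Longrightarrow> g i < n" for i by auto
    then show "f g \<ge> 0" unfolding f_def
      by (intro sum_nonneg mult_nonneg_nonneg prod_nonneg) (auto intro: E0 d0)
  next
    fix p :: "nat \<Rightarrow> nat"
    show "f p = f (restrict p {0..<n})" unfolding f_def by (intro sum.cong arg_cong2[where f = times] prod.cong) auto
  qed
  \<comment> \<open>Writing the exceptional row \<open>k\<close> into the product by a conditional
    gives the shape in which a product of sums can be recognised.\<close>
  also have "\<dots> = (\<Sum>k\<in>{0..<n}. \<Sum>g\<in>{0..<n} \<rightarrow>\<^sub>E {0..<n}. \<Prod>i\<in>{0..<n}. if i = k then d i (g i) else E i (g i))"
    unfolding f_def
  proof (subst sum.swap, intro sum.cong refl)
    fix k g assume k: "k \<in> {0..<n}"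
    have "(\<Prod>i\<in>{0..<n}. if i = k then d i (g i) else E i (g i))
        = d k (g k) * (\<Prod>i\<in>{0..<n} - {k}. if i = k then d i (g i) else E i (g i))"
      using k by (subst prod.remove[of _ k]) auto
    also have "(\<Prod>i\<in>{0..<n} - {k}. if i = k then d i (g i) else E i (g i)) = (\<Prod>i\<in>{0..<n} - {k}. E i (g i))"
      by (intro prod.cong) auto
    finally show "d k (g k) * (\<Prod>i\<in>{0..<n} - {k}. E i (g i)) = (\<Prod>i\<in>{0..<n}. if i = k then d i (g i) else E i (g i))"
      by simp
  qed
  also have "\<dots> = (\<Sum>k\<in>{0..<n}. \<Prod>i\<in>{0..<n}. \<Sum>j\<in>{0..<n}. if i = k then d i j else E i j)"
    by (subst prod_sum_PiE) auto
  also have "\<dots> = (\<Sum>k\<in>{0..<n}. (\<Sum>j\<in>{0..<n}. d k j) * (\<Prod>i\<in>{0..<n} - {k}. \<Sum>j\<in>{0..<n}. E i j))"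
  proof (intro sum.cong refl)
    fix k assume k: "k \<in> {0..<n}"
    have "(\<Prod>i\<in>{0..<n} - {k}. \<Sum>j\<in>{0..<n}. if i = k then d i j else E i j) = (\<Prod>i\<in>{0..<n} - {k}. \<Sum>j\<in>{0..<n}. E i j)"
      by (intro prod.cong sum.cong) auto
    then show "(\<Prod>i\<in>{0..<n}. \<Sum>j\<in>{0..<n}. if i = k then d i j else E i j)
       = (\<Sum>j\<in>{0..<n}. d k j) * (\<Prod>i\<in>{0..<n} - {k}. \<Sum>j\<in>{0..<n}. E i j)"
      using k by (subst prod.remove[of _ k]) auto
  qed
  finally show ?thesis by (simp add: atLeast0LessThan)
qed

text \<open>\<open>F_N\<close> is the determinant of size \<open>M\<close> whose entries outside the leading block are those of the
  identity.\<close>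

lemma norm_det_one_minus_diff_le:
  fixes a :: "nat \<Rightarrow> nat \<Rightarrow> complex"
  assumes NM: "N \<le> M" and Q: "(\<Sum>i<M. \<Sum>j<M. norm (a i j)) \<le> Q"
    and P: "(\<Sum>i<M. \<Sum>j<M. if i < N \<and> j < N then 0 else norm (a i j)) \<le> P"
  shows "norm (Determinant.det (1\<^sub>m M - Matrix.mat M M (\<lambda>(i, j). a i j))
             - Determinant.det (1\<^sub>m N - Matrix.mat N N (\<lambda>(i, j). a i j))) \<le> P * exp Q"
proof -
  define X where "X = 1\<^sub>m M - Matrix.mat M M (\<lambda>(i, j). a i j)"
  define Y0 where "Y0 = 1\<^sub>m N - Matrix.mat N N (\<lambda>(i, j). a i j)"
  define Y where "Y = four_block_mat Y0 (0\<^sub>m N (M - N)) (0\<^sub>m (M - N) N) (1\<^sub>m (M - N))"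
  have X: "X \<in> carrier_mat M M" unfolding X_def by (rule minus_carrier_mat) simp
  have Y0: "Y0 \<in> carrier_mat N N" unfolding Y0_def by (rule minus_carrier_mat) simp
  have Y: "Y \<in> carrier_mat M M"
    unfolding Y_def using four_block_carrier_mat[OF Y0 one_carrier_mat[of "M - N"]] NM by simp
  have detY: "Determinant.det Y = Determinant.det Y0"
    unfolding Y_def using Y0 by (subst det_four_block_mat_lower_left_zero) auto
  have Yij: "Y $$ (i, j) = (if i = j then 1 else 0) - (if i < N \<and> j < N then a i j else 0)" if "i < M" "j < M" for i j
    unfolding Y_def using that NM Y0 by (auto simp: Y0_def)
  have Xij: "X $$ (i, j) = (if i = j then 1 else 0) - a i j" if "i < M" "j < M" for i j
    unfolding X_def using that by simp
  define E where "E = (\<lambda>i j. (if i = j then 1 else 0) + norm (a i j))"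
  define d where "d = (\<lambda>i j. if i < N \<and> j < N then 0 else norm (a i j))"
  have tri: "norm ((if i = j then 1 else 0) - z) \<le> (if i = j then 1 else 0) + norm z" for z :: complex and i j :: nat
    using norm_triangle_ineq4[of 1 z] by simp
  from tri[of 0 0] have tri1: "norm (1 - z) \<le> 1 + norm z" for z :: complex by simp
  have "norm (Determinant.det X - Determinant.det Y)
    \<le> (\<Sum>k<M. (\<Sum>j<M. d k j) * (\<Prod>i\<in>{..<M} - {k}. \<Sum>j<M. E i j))"
    unfolding E_def d_def
    by (intro norm_det_diff_le[OF X Y]) (auto simp: Xij Yij norm_minus_commute intro: tri1)
  also have "\<dots> \<le> (\<Sum>k<M. (\<Sum>j<M. d k j) * exp Q)"
  proof (intro sum_mono mult_left_mono)
    fix k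
    \<comment> \<open>The identity contributes 1 to each row sum, and
      \<open>1 + x \<le> exp x\<close> turns the product into the exponential of the total of all
      entries.\<close>
    have "(\<Prod>i\<in>{..<M} - {k}. \<Sum>j<M. E i j) \<le> (\<Prod>i\<in>{..<M} - {k}. exp (\<Sum>j<M. norm (a i j)))"
    proof (intro prod_mono conjI)
      fix i assume "i \<in> {..<M} - {k}"
      then have "(\<Sum>j<M. E i j) = 1 + (\<Sum>j<M. norm (a i j))"
        unfolding E_def by (simp add: sum.distrib)
      then show "(\<Sum>j<M. E i j) \<le> exp (\<Sum>j<M. norm (a i j))" by simp
    qed (auto simp: E_def intro!: sum_nonneg add_nonneg_nonneg)
    also have "\<dots> = exp (\<Sum>i\<in>{..<M} - {k}. \<Sum>j<M. norm (a i j))" by (simp add: exp_sum)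
    also have "(\<Sum>i\<in>{..<M} - {k}. \<Sum>j<M. norm (a i j)) \<le> Q"
      using sum_mono2[of "{..<M}" "{..<M} - {k}" "\<lambda>i. \<Sum>j<M. norm (a i j)"] Q by (force intro: sum_nonneg)
    finally show "(\<Prod>i\<in>{..<M} - {k}. \<Sum>j<M. E i j) \<le> exp Q" by simp
  qed (auto simp: d_def intro!: sum_nonneg)
  also have "\<dots> = (\<Sum>k<M. \<Sum>j<M. d k j) * exp Q" by (simp add: sum_distrib_right)
  also have "\<dots> \<le> P * exp Q" using P by (intro mult_right_mono) (auto simp: d_def)
  finally show ?thesis unfolding detY X_def Y0_def .
qed

section \<open>The logarithm of a determinant\<close>

text \<open>At a coordinate of largest modulus the eigenvector equation bounds the eigenvalue by the
  absolute row sum there.\<close>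

lemma norm_eigenvalue_le:
  fixes B :: "complex mat"
  assumes B: "B \<in> carrier_mat n n" and ev: "eigenvalue B e"
    and le: "(\<Sum>i<n. \<Sum>j<n. norm (B $$ (i, j))) \<le> b"
  shows "norm e \<le> b"
proof -
  obtain v where v: "v \<in> carrier_vec n" "v \<noteq> 0\<^sub>v n" "B *\<^sub>v v = e \<cdot>\<^sub>v v"
    using ev B unfolding eigenvalue_def eigenvector_def by auto
  have n: "n > 0"
  proof (rule ccontr)
    assume "\<not> n > 0"
    then show False using v by (auto simp: vec_eq_iff)
  qed
  define M where "M = Max ((\<lambda>i. norm (v $ i)) ` {..<n})"
  have "M \<in> (\<lambda>i. norm (v $ i)) ` {..<n}" unfolding M_def using n by (intro Max_in) auto
  then obtain i where i: "i < n" "M = norm (v $ i)" by auto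
  have M: "norm (v $ j) \<le> M" if "j < n" for j
    unfolding M_def using that by (intro Max_ge) auto
  have M0: "M > 0"
  proof (rule ccontr)
    assume "\<not> M > 0"
    then have "v $ j = 0" if "j < n" for j
      using M[OF that] norm_ge_zero[of "v $ j"] by (simp flip: norm_le_zero_iff)
    then show False using v by (auto simp: vec_eq_iff)
  qed
  have "e * v $ i = (B *\<^sub>v v) $ i" using v i by simp
  also have "\<dots> = (\<Sum>j<n. B $$ (i, j) * v $ j)"
    using B v(1) i(1) by (simp add: scalar_prod_def atLeast0LessThan)
  finally have "norm e * M = norm (\<Sum>j<n. B $$ (i, j) * v $ j)" using i by (metis norm_mult)
  also have "\<dots> \<le> (\<Sum>j<n. norm (B $$ (i, j)) * M)"
    by (rule sum_norm_le) (auto simp: norm_mult intro!: mult_left_mono M)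
  also have "\<dots> = (\<Sum>j<n. norm (B $$ (i, j))) * M" by (simp add: sum_distrib_right)
  finally have "norm e \<le> (\<Sum>j<n. norm (B $$ (i, j)))" using M0 by simp
  also have "\<dots> \<le> (\<Sum>i<n. \<Sum>j<n. norm (B $$ (i, j)))"
    using i by (intro member_le_sum[of i "{..<n}" "\<lambda>i. \<Sum>j<n. norm (B $$ (i, j))"]) (auto intro: sum_nonneg)
  finally show ?thesis using le by simp
qed

definition mat_trace :: "'a::comm_ring_1 mat \<Rightarrow> 'a" where
  "mat_trace B = (\<Sum>i<dim_row B. B $$ (i, i))"

lemma mat_trace_mult_commute:
  assumes "X \<in> carrier_mat n m" "Y \<in> carrier_mat m n"
  shows "mat_trace (X * Y) = mat_trace (Y * X)"
proof -
  have "mat_trace (X * Y) = (\<Sum>i<n. \<Sum>j<m. X $$ (i, j) * Y $$ (j, i))"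
    using assms by (simp add: mat_trace_def scalar_prod_def atLeast0LessThan)
  also have "\<dots> = (\<Sum>j<m. \<Sum>i<n. Y $$ (j, i) * X $$ (i, j))"
    by (subst sum.swap) (simp add: mult.commute)
  also have "\<dots> = mat_trace (Y * X)"
    using assms by (simp add: mat_trace_def scalar_prod_def atLeast0LessThan)
  finally show ?thesis .
qed

lemma upper_triangular_pow:
  fixes U :: "complex mat"
  assumes U: "U \<in> carrier_mat n n" and ut: "upper_triangular U"
  shows "upper_triangular (U ^\<^sub>m k) \<and> (\<forall>i<n. (U ^\<^sub>m k) $$ (i, i) = (U $$ (i, i)) ^ k)"
proof (induction k)
  case 0
  then show ?case using U by auto
next
  case (Suc k)
  have P: "U ^\<^sub>m k \<in> carrier_mat n n" using U by (rule pow_carrier_mat)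
  have ent: "(U ^\<^sub>m Suc k) $$ (i, j) = (\<Sum>l<n. (U ^\<^sub>m k) $$ (i, l) * U $$ (l, j))" if "i < n" "j < n" for i j
    using that P U by (simp add: scalar_prod_def atLeast0LessThan)
  have z: "(U ^\<^sub>m k) $$ (i, l) = 0" if "l < i" "i < n" for i l
    using Suc P that by (auto simp: upper_triangular_def)
  have z': "U $$ (l, j) = 0" if "j < l" "l < n" for j l
    using ut U that by (auto simp: upper_triangular_def)
  have "(U ^\<^sub>m Suc k) $$ (i, j) = 0" if "j < i" "i < n" for i j
  proof -
    have "(U ^\<^sub>m k) $$ (i, l) * U $$ (l, j) = 0" if "l < n" for l
      using z[of l i] z'[of j l] \<open>j < i\<close> \<open>i < n\<close> that by (cases "l < i") auto
    then show ?thesis using that by (subst ent) (auto intro!: sum.neutral simp del: mult_eq_0_iff)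
  qed
  moreover have "(U ^\<^sub>m Suc k) $$ (i, i) = U $$ (i, i) ^ Suc k" if "i < n" for i
  proof -
    have "(U ^\<^sub>m Suc k) $$ (i, i) = (\<Sum>l<n. if l = i then (U ^\<^sub>m k) $$ (i, i) * U $$ (i, i) else 0)"
      unfolding ent[OF that that]
    proof (intro sum.cong refl)
      fix l assume "l \<in> {..<n}"
      then show "(U ^\<^sub>m k) $$ (i, l) * U $$ (l, i) = (if l = i then (U ^\<^sub>m k) $$ (i, i) * U $$ (i, i) else 0)"
        using z[of l i] z'[of i l] that by (cases l i rule: linorder_cases) auto
    qed
    then show ?thesis using Suc that by simp
  qed
  moreover have "dim_row (U ^\<^sub>m Suc k) = n" using P U by simp
  ultimately show ?case by (auto simp: upper_triangular_def simp del: pow_mat.simps)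
qed

lemma mat_sim_one_minus:
  fixes B :: "complex mat"
  assumes "similar_mat_wit B U P Q" "B \<in> carrier_mat n n"
  shows "similar_mat (1\<^sub>m n - B) (1\<^sub>m n - U)"
proof -
  have c: "U \<in> carrier_mat n n" "P \<in> carrier_mat n n" "Q \<in> carrier_mat n n" "P * Q = 1\<^sub>m n" "Q * P = 1\<^sub>m n" "B = P * U * Q"
    using assms by (auto simp: similar_mat_wit_def Let_def)
  have "P * (1\<^sub>m n - U) * Q = (P * 1\<^sub>m n - P * U) * Q"
    using c by (subst mult_minus_distrib_mat[of P n n "1\<^sub>m n" n U]) auto
  also have "\<dots> = P * 1\<^sub>m n * Q - P * U * Q"
    using c by (subst minus_mult_distrib_mat[of _ n n _ Q n]) auto
  finally have "1\<^sub>m n - B = P * (1\<^sub>m n - U) * Q" using c by simp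
  then show ?thesis using c assms(2) unfolding similar_mat_def similar_mat_wit_def Let_def
    by (intro exI[of _ P] exI[of _ Q]) (auto simp: minus_carrier_mat)
qed

text \<open>Triangularise: both sides only depend on the diagonal of a Schur form.\<close>

lemma det_one_minus_eq_exp:
  fixes B :: "complex mat"
  assumes B: "B \<in> carrier_mat n n" and le: "(\<Sum>i<n. \<Sum>j<n. norm (B $$ (i, j))) \<le> b" and b: "b < 1"
  shows "Determinant.det (1\<^sub>m n - B) = exp (- (\<Sum>m. mat_trace (B ^\<^sub>m Suc m) / of_nat (Suc m)))"
proof -
  obtain es where es: "char_poly B = (\<Prod>e\<leftarrow>es. [:- e, 1:])"
    using char_poly_factorized[OF B] by blast
  obtain U P Q where sd: "schur_decomposition B es = (U, P, Q)" by (metis prod_cases3)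
  have sch: "similar_mat_wit B U P Q" "upper_triangular U" "diag_mat U = es"
    using schur_decomposition[OF B es sd] by auto
  have c: "U \<in> carrier_mat n n" "P \<in> carrier_mat n n" "Q \<in> carrier_mat n n" "P * Q = 1\<^sub>m n" "Q * P = 1\<^sub>m n"
    using sch(1) B by (auto simp: similar_mat_wit_def Let_def)
  define e where "e = (\<lambda>i. U $$ (i, i))"
  \<comment> \<open>This puts every diagonal entry of the triangular form inside the disc of
    convergence of the logarithmic series.\<close>
  have e1: "norm (e i) < 1" if "i < n" for i
  proof -
    have "e i \<in> set es" using that c sch(3) unfolding e_def diag_mat_def by force
    then have "poly (char_poly B) (e i) = 0" unfolding es by (force simp: poly_prod_list prod_list_zero_iff)
    then have "eigenvalue B (e i)" using eigenvalue_root_char_poly[OF B] by simp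
    then have "norm (e i) \<le> b" using norm_eigenvalue_le[OF B _ le] by simp
    then show ?thesis using b by simp
  qed
  have tr: "mat_trace (B ^\<^sub>m k) = (\<Sum>i<n. e i ^ k)" for k
  proof -
    have Uk: "U ^\<^sub>m k \<in> carrier_mat n n" using c(1) by (rule pow_carrier_mat)
    have "B ^\<^sub>m k = P * U ^\<^sub>m k * Q" by (rule similar_mat_wit_pow_id[OF sch(1)])
    also have "mat_trace (P * U ^\<^sub>m k * Q) = mat_trace (Q * (P * U ^\<^sub>m k))"
      using c Uk by (intro mat_trace_mult_commute) auto
    also have "Q * (P * U ^\<^sub>m k) = (Q * P) * U ^\<^sub>m k" using c Uk by (intro assoc_mult_mat[symmetric]) auto
    also have "\<dots> = U ^\<^sub>m k" using c Uk by simp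
    finally show ?thesis using upper_triangular_pow[OF c(1) sch(2), of k] c(1) by (simp add: mat_trace_def e_def)
  qed
  have "Determinant.det (1\<^sub>m n - B) = Determinant.det (1\<^sub>m n - U)"
    by (rule det_similar[OF mat_sim_one_minus[OF sch(1) B]])
  also have "\<dots> = prod_list (diag_mat (1\<^sub>m n - U))"
    using c(1) sch(2) by (intro det_upper_triangular[of _ n]) (auto simp: upper_triangular_def minus_carrier_mat)
  also have "\<dots> = (\<Prod>i<n. 1 - e i)"
  proof -
    have "diag_mat (1\<^sub>m n - U) = map (\<lambda>i. 1 - e i) [0..<n]"
      using c(1) unfolding diag_mat_def e_def by auto
    then show ?thesis by (simp add: prod.distinct_set_conv_list atLeast0LessThan[symmetric] flip: set_upt)
  qed
  also have "\<dots> = (\<Prod>i<n. exp (Ln (1 - e i)))"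
  proof (intro prod.cong refl)
    fix i assume "i \<in> {..<n}"
    then have "1 - e i \<noteq> 0" using e1[of i] by auto
    then show "1 - e i = exp (Ln (1 - e i))" by simp
  qed
  also have "\<dots> = exp (\<Sum>i<n. Ln (1 - e i))" by (simp add: exp_sum)
  also have "(\<Sum>i<n. Ln (1 - e i)) = - (\<Sum>m. mat_trace (B ^\<^sub>m Suc m) / of_nat (Suc m))"
  proof -
    have "(\<lambda>m. - (e i ^ Suc m / of_nat (Suc m))) sums Ln (1 - e i)" if "i < n" for i
    proof -
      have "(\<lambda>k. - ((- (- e i)) ^ k) / of_nat k) sums Ln (1 + (- e i))"
        using e1[OF that] by (intro Ln_series') simp
      then have *: "(\<lambda>k. - (e i ^ k / of_nat k)) sums Ln (1 - e i)" by simp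
      show ?thesis using * by (subst sums_Suc_iff) simp
    qed
    then have "(\<lambda>m. \<Sum>i<n. - (e i ^ Suc m / of_nat (Suc m))) sums (\<Sum>i<n. Ln (1 - e i))"
      by (intro sums_sum) auto
    moreover have "(\<Sum>i<n. - (e i ^ Suc m / of_nat (Suc m))) = - (mat_trace (B ^\<^sub>m Suc m) / of_nat (Suc m))" for m
      unfolding tr by (simp add: sum_negf sum_divide_distrib)
    ultimately have "(\<lambda>m. - (mat_trace (B ^\<^sub>m Suc m) / of_nat (Suc m))) sums (\<Sum>i<n. Ln (1 - e i))" by simp
    from sums_minus[OF this] show ?thesis by (simp add: sums_iff)
  qed
  finally show ?thesis .
qed

lemma pow_mat_Suc_left:
  assumes "B \<in> carrier_mat n n"
  shows "B ^\<^sub>m Suc m = B * B ^\<^sub>m m"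
proof (induction m)
  case (Suc m)
  have "B ^\<^sub>m m \<in> carrier_mat n n" using assms by (rule pow_carrier_mat)
  then have "B * B ^\<^sub>m m * B = B * (B ^\<^sub>m m * B)" using assms by (intro assoc_mult_mat) auto
  then show ?case using Suc by simp
qed (use assms in simp)

context nuclear_family
begin

definition L_trunc :: "nat \<Rightarrow> complex mat" where
  "L_trunc N = Matrix.mat N N (\<lambda>(i, j). L i j)"

lemma L_trunc_carrier [simp]: "L_trunc N \<in> carrier_mat N N"
  by (simp add: L_trunc_def)

lemma L_trunc_dim [simp]: "dim_row (L_trunc N) = N" "dim_col (L_trunc N) = N"
  by (simp_all add: L_trunc_def)

lemma L_trunc_pow:
  assumes "i < N" "j < N"
  shows "(L_trunc N ^\<^sub>m m) $$ (i, j) = Lt N m i j"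
  using assms
proof (induction m arbitrary: i)
  case (Suc m)
  have c: "L_trunc N ^\<^sub>m m \<in> carrier_mat N N" by (rule pow_carrier_mat) simp
  have "L_trunc N ^\<^sub>m Suc m = L_trunc N * L_trunc N ^\<^sub>m m"
    using pow_mat_Suc_left[OF L_trunc_carrier] .
  then have "(L_trunc N ^\<^sub>m Suc m) $$ (i, j) = (\<Sum>k<N. L_trunc N $$ (i, k) * (L_trunc N ^\<^sub>m m) $$ (k, j))"
    using c Suc.prems L_trunc_carrier[of N] by (simp add: scalar_prod_def atLeast0LessThan del: L_trunc_carrier)
  then show ?case using Suc by (simp add: L_trunc_def del: pow_mat.simps)
qed (simp add: L_trunc_def)

lemma mat_trace_L_trunc: "mat_trace (L_trunc N ^\<^sub>m m) = (\<Sum>i<N. Lt N m i i)"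
proof -
  have "L_trunc N ^\<^sub>m m \<in> carrier_mat N N" by (rule pow_carrier_mat) simp
  then show ?thesis by (auto simp: mat_trace_def L_trunc_pow intro!: sum.cong)
qed

text \<open>Each truncated determinant is the exponential of a series in traces of powers whose
  terms are at most \<open>total_norm ^ Suc m\<close> uniformly in \<open>N\<close>, so the limit
  passes through the series and the exponential.\<close>

theorem det_L_trunc_tendsto:
  assumes "total_norm < 1"
  shows "(\<lambda>N. Determinant.det (1\<^sub>m N - L_trunc N)) \<longlonglongrightarrow>
    exp (- (\<Sum>m. (\<Sum>\<^sub>\<infinity>l\<in>words_over I (Suc m). word_trace l) / of_nat (Suc m)))"
proof -
  have det: "Determinant.det (1\<^sub>m N - L_trunc N) = exp (- (\<Sum>m. (\<Sum>i<N. Lt N (Suc m) i i) / of_nat (Suc m)))" for N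
  proof -
    have "(\<Sum>i<N. \<Sum>j<N. norm (L_trunc N $$ (i, j))) = (\<Sum>i<N. \<Sum>j<N. norm (L i j))"
      by (simp add: L_trunc_def)
    also have "\<dots> \<le> (\<Sum>i<N. row_norm i)" by (intro sum_mono sum_norm_L_le)
    also have "\<dots> \<le> total_norm" unfolding total_norm_def
      by (rule finite_sum_le_infsum[OF row_norm_summable]) (auto simp: row_norm_nonneg)
    finally have le: "(\<Sum>i<N. \<Sum>j<N. norm (L_trunc N $$ (i, j))) \<le> total_norm" .
    show ?thesis using det_one_minus_eq_exp[OF L_trunc_carrier le assms] unfolding mat_trace_L_trunc .
  qed
  have "((\<lambda>N. \<Sum>m. (\<Sum>i<N. Lt N (Suc m) i i) / of_nat (Suc m)) \<longlongrightarrow>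
    (\<Sum>m. (\<Sum>\<^sub>\<infinity>l\<in>words_over I (Suc m). word_trace l) / of_nat (Suc m))) sequentially"
  proof (rule tannerys_theorem[THEN conjunct2, THEN conjunct2])
    show "(\<lambda>N. (\<Sum>i<N. Lt N (Suc m) i i) / of_nat (Suc m)) \<longlonglongrightarrow> (\<Sum>\<^sub>\<infinity>l\<in>words_over I (Suc m). word_trace l) / of_nat (Suc m)" for m
      by (intro tendsto_divide Lt_trace_tendsto tendsto_const) (auto simp del: of_nat_Suc)
    have "norm ((\<Sum>i<N. Lt N (Suc m) i i) / of_nat (Suc m)) \<le> total_norm ^ Suc m" for m N
    proof -
      have "norm ((\<Sum>i<N. Lt N (Suc m) i i) / of_nat (Suc m)) \<le> norm (\<Sum>i<N. Lt N (Suc m) i i) / 1"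
        unfolding norm_divide norm_of_nat by (intro divide_left_mono) auto
      also have "\<dots> \<le> total_norm ^ Suc m" using norm_Lt_trace_le[of "Suc m" N] by simp
      finally show ?thesis .
    qed
    then show "\<forall>\<^sub>F (m, N) in sequentially \<times>\<^sub>F sequentially. norm ((\<Sum>i<N. Lt N (Suc m) i i) / of_nat (Suc m)) \<le> total_norm ^ Suc m"
      by (intro always_eventually) auto
    show "summable (\<lambda>m. total_norm ^ Suc m)"
      using assms total_norm_nonneg by (intro summable_ignore_initial_segment[of _ 1, simplified] summable_geometric) auto
  qed simp
  then show ?thesis unfolding det by (intro tendsto_exp tendsto_minus)
qed

end

section \<open>Powers, roots and rotations of words\<close>

definition word_power :: "nat \<Rightarrow> 'a list \<Rightarrow> 'a list" where
  "word_power n u = concat (replicate n u)"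

definition primitive_word :: "'a list \<Rightarrow> bool" where
  "primitive_word u \<longleftrightarrow> u \<noteq> [] \<and> (\<forall>v n. u = word_power n v \<longrightarrow> n \<le> 1)"

lemma word_power_0 [simp]: "word_power 0 u = []"
  by (simp add: word_power_def)

lemma word_power_Suc [simp]: "word_power (Suc n) u = u @ word_power n u"
  by (simp add: word_power_def)

lemma word_power_add: "word_power (m + n) u = word_power m u @ word_power n u"
  by (induction m) auto

lemma word_power_commute: "word_power n u @ u = u @ word_power n u"
  by (induction n) auto

lemma word_power_mult: "word_power m (word_power n u) = word_power (m * n) u"
  by (induction m) (auto simp: word_power_add)

lemma length_word_power [simp]: "length (word_power n u) = n * length u"
  by (induction n) auto

lemma set_word_power_subset: "set (word_power n u) \<subseteq> set u"
  by (induction n) auto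

lemma set_word_power: "n > 0 \<Longrightarrow> set (word_power n u) = set u"
  by (cases n) (use set_word_power_subset in fastforce)+

lemma word_power_eq_Nil_iff: "word_power n u = [] \<longleftrightarrow> n = 0 \<or> u = []"
  by (metis length_0_conv length_word_power mult_is_0)

lemma primitive_word_power_eqD:
  assumes "primitive_word u" "u = word_power n v"
  shows "n = 1" "u = v"
proof -
  have "n \<noteq> 0" using assms by (intro notI) (simp add: primitive_word_def)
  then show n: "n = 1" using assms unfolding primitive_word_def by (metis le_antisym One_nat_def Suc_leI neq0_conv)
  then show "u = v" using assms(2) by simp
qed

text \<open>Commuting words are powers of a common word, and a primitive \<open>u\<close> can only
  be that word itself.\<close>

lemma primitive_word_commuteD:
  assumes "primitive_word u" "v @ u = u @ v"
  obtains k where "v = word_power k u"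
proof -
  obtain m n z where z: "word_power m z = u" "word_power n z = v"
    using comm_append_are_replicate[of u v] assms(2) unfolding word_power_def by metis
  then have "u = z" using primitive_word_power_eqD assms(1) by metis
  then show ?thesis using z that by metis
qed

text \<open>Both words commute with the common power \<open>x\<close> and are prefixes of it. Hence
  \<open>u @ v\<close> and \<open>v @ u\<close> are prefixes of \<open>x @ x\<close>, and they have
  the same length.\<close>

lemma word_power_eq_imp_commute:
  assumes "word_power r u = word_power t v" "r > 0" "t > 0"
  shows "u @ v = v @ u"
proof -
  define x where "x = word_power r u"
  have ux: "u @ x = x @ u" by (simp add: x_def word_power_commute)
  have vx: "v @ x = x @ v" by (simp add: x_def assms(1) word_power_commute)
  obtain y where y: "x = u @ y"
    using assms(2) unfolding x_def by (metis gr0_implies_Suc word_power_Suc)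
  obtain z where z: "x = v @ z"
    using assms(1,3) unfolding x_def by (metis gr0_implies_Suc word_power_Suc)
  have 1: "u @ v @ z @ x = x @ x @ u" using ux z by (metis append_assoc)
  have 2: "v @ u @ y @ x = x @ x @ v" using vx y by (metis append_assoc)
  have le: "length u + length v \<le> length (x @ x)" using y z by (metis add_mono length_append le_add1)
  have "u @ v = take (length u + length v) (u @ v @ z @ x)" by simp
  also have "\<dots> = take (length u + length v) (x @ x)"
    unfolding 1 using le by (metis append_assoc diff_is_0_eq' take_0 append_Nil2 take_append)
  also have "\<dots> = take (length u + length v) (v @ u @ y @ x)"
    unfolding 2 using le by (metis append_assoc diff_is_0_eq' take_0 append_Nil2 take_append)
  also have "\<dots> = v @ u" by simp
  finally show ?thesis .
qed

lemma primitive_root_unique: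
  assumes "primitive_word u" "primitive_word v" "word_power r u = word_power t v" "r > 0" "t > 0"
  shows "u = v" "r = t"
proof -
  have c: "u @ v = v @ u" using word_power_eq_imp_commute assms by blast
  then obtain k where "v = word_power k u"
    using primitive_word_commuteD[OF assms(1), of v] by metis
  then show *: "u = v" using primitive_word_power_eqD[OF assms(2)] by metis
  have "r * length u = t * length v" using assms(3) by (metis length_word_power)
  then show "r = t" using * assms(1) by (simp add: primitive_word_def)
qed

lemma primitive_root_exists:
  assumes "u \<noteq> []"
  obtains v n where "primitive_word v" "n > 0" "u = word_power n v"
proof -
  have "\<exists>v n. primitive_word v \<and> n > 0 \<and> u = word_power n v" using assms
  proof (induction u rule: length_induct)
    case (1 u)
    show ?case
    proof (cases "primitive_word u")
      case True
      then show ?thesis by (intro exI[of _ u] exI[of _ 1]) auto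
    next
      case False
      then obtain v n where v: "u = word_power n v" "n > 1"
        using "1.prems" by (auto simp: primitive_word_def not_le)
      have ne: "v \<noteq> []" using "1.prems" v by (auto simp: word_power_eq_Nil_iff)
      then have "length v < length u" using v by simp
      then obtain w m where "primitive_word w" "m > 0" "v = word_power m w"
        using "1.IH" ne by blast
      then show ?thesis using v by (intro exI[of _ w] exI[of _ "n * m"]) (auto simp: word_power_mult)
    qed
  qed
  then show ?thesis using that by blast
qed

lemma rotate1_word_power: "rotate1 (word_power n u) = word_power n (rotate1 u)"
proof (cases u)
  case (Cons a l)
  have "word_power n (a # l) @ [a] = a # word_power n (l @ [a])" for n
    by (induction n) auto
  then show ?thesis using Cons by (cases n) auto
qed (simp_all add: word_power_def)

lemma rotate_word_power: "rotate k (word_power n u) = word_power n (rotate k u)"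
  by (induction k) (auto simp: rotate1_word_power)

lemma rotate_inverse: "\<exists>j. rotate j (rotate i u) = u"
proof (cases "u = []")
  case False
  have "rotate (i * length u - i) (rotate i u) = rotate (i * length u - i + i) u"
    by (simp add: rotate_rotate)
  also have "i * length u - i + i = i * length u" using False by (cases "length u") auto
  also have "rotate (i * length u) u = u" by (simp add: rotate_id)
  finally show ?thesis by blast
qed auto

lemma primitive_word_rotate: "primitive_word u \<Longrightarrow> primitive_word (rotate i u)"
  unfolding primitive_word_def by (metis rotate_inverse rotate_is_Nil_conv rotate_word_power)

text \<open>If two rotations coincide, one of them splits into two nonempty commuting parts. These
  are powers of a common word, so that rotation would be a proper power.\<close>

lemma inj_on_rotate_primitive:
  assumes "primitive_word u"
  shows "inj_on (\<lambda>i. rotate i u) {..<length u}"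
proof (rule linorder_inj_onI)
  fix i j assume ij: "i < j" "i \<in> {..<length u}" "j \<in> {..<length u}"
  show "rotate i u \<noteq> rotate j u"
  proof
    assume "rotate i u = rotate j u"
    then have eq: "rotate i u = rotate (j - i) (rotate i u)"
      unfolding rotate_rotate using ij by simp
    define v where "v = rotate i u"
    define k where "k = j - i"
    have v: "primitive_word v" using assms primitive_word_rotate v_def by blast
    have k: "0 < k" "k < length v" using ij by (auto simp: k_def v_def)
    have "v = drop k v @ take k v"
      using eq k rotate_drop_take[of k v] unfolding v_def[symmetric] k_def[symmetric] by simp
    then have "take k v @ drop k v = drop k v @ take k v" by simp
    then obtain m n z where z: "word_power m z = take k v" "word_power n z = drop k v"
      using comm_append_are_replicate unfolding word_power_def by metis
    then have "v = word_power (m + n) z" by (simp add: word_power_add)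
    then have "m + n = 1" using primitive_word_power_eqD v by blast
    moreover have "m \<noteq> 0" "n \<noteq> 0" using z k by (auto intro: gr0I)
    ultimately show False by simp
  qed
qed auto

text \<open>Copies of \<open>v\<close> are stripped from the front of \<open>x\<close> until
  \<open>x\<close> is a prefix of \<open>v\<close>; then \<open>v = x @ y\<close> and
  \<open>u = y @ x\<close>.\<close>

lemma conjugate_words_rotate:
  assumes "v @ x = x @ u"
  shows "\<exists>i. u = rotate i v"
proof (cases "v = []")
  case False
  from assms show ?thesis
  proof (induction x rule: length_induct)
    case (1 x)
    show ?case
    proof (cases "length x \<le> length v")
      case True
      then have "x = take (length x) v"
        using "1.prems" by (metis append_eq_append_conv_if)
      then obtain y where y: "v = x @ y" by (metis append_take_drop_id)
      then have "u = y @ x" using "1.prems" by simp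
      then show ?thesis using y by (metis rotate_append)
    next
      case False
      then have "v = take (length v) x"
        using "1.prems" by (metis append_eq_append_conv_if nat_le_linear)
      then obtain y where y: "x = v @ y" by (metis append_take_drop_id)
      then have "v @ y = y @ u" using "1.prems" by simp
      then show ?thesis using "1.IH" y \<open>v \<noteq> []\<close> by (metis append_eq_conv_conj length_append
        length_greater_0_conv less_add_same_cancel2)
    qed
  qed
qed (use assms in simp)

section \<open>Conjugacy classes in the free product of the integers and a group of order two\<close>

definition nz_words :: "int list set" where
  "nz_words = {l. l \<noteq> [] \<and> 0 \<notin> set l}"

definition prim_words :: "int list set" where
  "prim_words = {l \<in> nz_words. primitive_word l}"

lemma word_power_nz_iff: "n > 0 \<Longrightarrow> word_power n u \<in> nz_words \<longleftrightarrow> u \<in> nz_words"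
  by (auto simp: nz_words_def set_word_power word_power_eq_Nil_iff)

lemma rotate_nz_iff [simp]: "rotate i u \<in> nz_words \<longleftrightarrow> u \<in> nz_words"
  by (auto simp: nz_words_def)

lemma rotate_prim_words: "u \<in> prim_words \<Longrightarrow> rotate i u \<in> prim_words"
  by (auto simp: prim_words_def primitive_word_rotate)

locale hecke_like = group G for G (structure) +
  fixes t s :: 'a
  assumes t [simp]: "t \<in> carrier G" and s [simp]: "s \<in> carrier G" and ss: "s \<otimes> s = \<one>"
    and gen: "carrier G = generate G {t, s}"
begin

primrec W :: "int list \<Rightarrow> 'a" where
  "W [] = \<one>"
| "W (n # l) = t [^] n \<otimes> s \<otimes> W l"

lemma W_closed [simp]: "W l \<in> carrier G"
  by (induction l) auto

lemma W_append: "W (l @ l') = W l \<otimes> W l'"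
  by (induction l) (auto simp: m_assoc)

lemma W_snoc: "W (l @ [n]) = W l \<otimes> t [^] n \<otimes> s"
  by (simp add: W_append m_assoc)

lemma inv_cancel:
  assumes "x \<in> carrier G" "y \<in> carrier G"
  shows "inv x \<otimes> (x \<otimes> y) = y" "x \<otimes> (inv x \<otimes> y) = y"
  using assms by (simp_all flip: m_assoc)

lemma s_s_cancel: "x \<in> carrier G \<Longrightarrow> s \<otimes> (s \<otimes> x) = x"
  by (metis m_assoc ss s l_one)

lemma inv_s: "inv s = s"
  by (rule inv_equality) (auto simp: ss)

lemma t_W_Cons: "t [^] k \<otimes> W (n # l) = W ((k + n) # l)"
  by (simp add: int_pow_mult m_assoc)

lemma t_W_Cons_cancel: "k + n = 0 \<Longrightarrow> t [^] k \<otimes> W (n # l) = s \<otimes> W l"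
  by (subst t_W_Cons) simp

lemma W_power: "W (word_power n u) = W u [^] n"
proof (induction n)
  case (Suc n)
  have "W u [^] Suc n = W u \<otimes> W u [^] n" by (rule nat_pow_Suc2) simp
  then show ?case using Suc by (simp add: W_append)
qed simp

definition flip :: "bool \<Rightarrow> 'a" where
  "flip b = (if b then s else \<one>)"

lemma flip_closed [simp]: "flip b \<in> carrier G"
  by (simp add: flip_def)

text \<open>A nonempty \<open>W l\<close> starts with a power of \<open>t\<close> and ends in
  \<open>s\<close>; an optional leading \<open>s\<close> and a trailing power of \<open>t\<close>
  account for the remaining elements.\<close>

definition normal_form :: "bool \<Rightarrow> int list \<Rightarrow> int \<Rightarrow> 'a" where
  "normal_form b l k = flip b \<otimes> W l \<otimes> t [^] k"

definition normal_forms :: "'a set" where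
  "normal_forms = {normal_form b l k | b l k. 0 \<notin> set l}"

lemma normal_formsI: "0 \<notin> set l \<Longrightarrow> normal_form b l k \<in> normal_forms"
  by (auto simp: normal_forms_def)

lemma normal_forms_closed: "g \<in> normal_forms \<Longrightarrow> g \<in> carrier G"
  by (auto simp: normal_forms_def normal_form_def)

lemma s_normal_form: "s \<otimes> normal_form b l k = normal_form (\<not> b) l k"
  by (auto simp: normal_form_def flip_def m_assoc s_s_cancel)

text \<open>A power of \<open>t\<close> either meets a leading \<open>s\<close> and becomes a new
  first letter, or merges with what stands in front; if the merged exponent of the first letter is
  0, that letter disappears and leaves its \<open>s\<close> behind.\<close>

lemma t_normal_forms:
  assumes "g \<in> normal_forms"
  shows "t [^] (j::int) \<otimes> g \<in> normal_forms"
proof (cases "j = 0")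
  case True
  then show ?thesis using assms normal_forms_closed by simp
next
  case False
  obtain b l k where g: "g = normal_form b l k" "0 \<notin> set l" using assms by (auto simp: normal_forms_def)
  show ?thesis
  proof (cases b)
    case True
    then have "t [^] j \<otimes> g = normal_form False (j # l) k"
      by (simp add: g normal_form_def flip_def m_assoc)
    then show ?thesis using g False by (auto intro!: normal_formsI)
  next
    case b: False
    show ?thesis
    proof (cases l)
      case Nil
      then have "t [^] j \<otimes> g = normal_form False [] (j + k)"
        using b by (simp add: g normal_form_def flip_def int_pow_mult)
      then show ?thesis by (auto intro!: normal_formsI)
    next
      case (Cons n l')
      have *: "t [^] j \<otimes> g = t [^] j \<otimes> W (n # l') \<otimes> t [^] k"
        using b Cons by (simp add: g normal_form_def flip_def m_assoc)
      show ?thesis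
      proof (cases "j + n = 0")
        case True
        have "t [^] j \<otimes> g = normal_form True l' k"
          unfolding * t_W_Cons_cancel[OF True] by (simp add: normal_form_def flip_def)
        then show ?thesis using g Cons by (auto intro!: normal_formsI)
      next
        case False
        have "t [^] j \<otimes> g = normal_form False ((j + n) # l') k"
          unfolding * t_W_Cons by (simp add: normal_form_def flip_def del: W.simps)
        then show ?thesis using g Cons False by (auto intro!: normal_formsI)
      qed
    qed
  qed
qed

lemma s_normal_forms: "g \<in> normal_forms \<Longrightarrow> s \<otimes> g \<in> normal_forms"
  unfolding normal_forms_def using s_normal_form by blast

text \<open>Stability under left multiplication, not membership, is what passes through products in
  the induction; applied to the identity it yields membership.\<close>

lemma generate_normal_forms:
  assumes "h \<in> generate G {t, s}"
  shows "\<forall>g\<in>normal_forms. h \<otimes> g \<in> normal_forms"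
  using assms
proof (induction h rule: generate.induct)
  case one
  then show ?case using normal_forms_closed by auto
next
  case (incl h)
  then show ?case using t_normal_forms[of _ 1] s_normal_forms by auto
next
  case (inv h)
  have "inv t = t [^] (-1::int)" by (metis int_pow_1 int_pow_neg t)
  then show ?case using inv t_normal_forms[of _ "-1"] s_normal_forms inv_s by auto
next
  case (eng h1 h2)
  then have "h1 \<in> carrier G" "h2 \<in> carrier G" using gen by auto
  then show ?case using eng normal_forms_closed by (auto simp: m_assoc)
qed

lemma normal_form_exists:
  assumes "h \<in> carrier G"
  obtains b l k where "0 \<notin> set l" "h = normal_form b l k"
proof -
  have "normal_form False [] 0 \<in> normal_forms" by (rule normal_formsI) simp
  moreover have "normal_form False [] 0 = \<one>" by (simp add: normal_form_def flip_def)
  ultimately have "h \<otimes> \<one> \<in> normal_forms" using generate_normal_forms[of h] assms gen by metis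
  then have "h \<in> normal_forms" using assms by simp
  then show ?thesis using that unfolding normal_forms_def by blast
qed

section \<open>Conjugation and cyclic reduction\<close>

definition conj :: "'a \<Rightarrow> 'a \<Rightarrow> bool" where
  "conj x y \<longleftrightarrow> (\<exists>h\<in>carrier G. x = h \<otimes> y \<otimes> inv h)"

lemma conj_refl: "x \<in> carrier G \<Longrightarrow> conj x x"
  unfolding conj_def by (rule bexI[of _ "\<one>"]) auto

lemma conj_trans: "y \<in> carrier G \<Longrightarrow> z \<in> carrier G \<Longrightarrow> conj x y \<Longrightarrow> conj y z \<Longrightarrow> conj x z"
proof -
  assume z: "z \<in> carrier G"
  assume "conj x y" "conj y z"
  then obtain h k where "h \<in> carrier G" "k \<in> carrier G" "x = h \<otimes> y \<otimes> inv h" "y = k \<otimes> z \<otimes> inv k"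
    by (auto simp: conj_def)
  then have "x = (h \<otimes> k) \<otimes> z \<otimes> inv (h \<otimes> k)" using z by (simp add: m_assoc inv_mult_group)
  then show ?thesis using \<open>h \<in> _\<close> \<open>k \<in> _\<close> unfolding conj_def by blast
qed

lemma conj_sym: "y \<in> carrier G \<Longrightarrow> conj x y \<Longrightarrow> conj y x"
proof -
  assume y: "y \<in> carrier G" and "conj x y"
  then obtain h where h: "h \<in> carrier G" "x = h \<otimes> y \<otimes> inv h" by (auto simp: conj_def)
  have "inv h \<otimes> x \<otimes> inv (inv h) = (inv h \<otimes> h) \<otimes> y \<otimes> (inv h \<otimes> h)"
    using h y by (simp add: m_assoc inv_cancel)
  then have "y = inv h \<otimes> x \<otimes> inv (inv h)" using h y by simp
  then show ?thesis unfolding conj_def using h by (auto intro: bexI[of _ "inv h"])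
qed

lemma conj_swap: "a \<in> carrier G \<Longrightarrow> b \<in> carrier G \<Longrightarrow> conj (a \<otimes> b) (b \<otimes> a)"
  unfolding conj_def by (rule bexI[of _ a]) (auto simp: m_assoc)

lemma conj_pow:
  assumes "conj x y" "y \<in> carrier G"
  shows "conj (x [^] (n::nat)) (y [^] n)"
proof -
  obtain h where h: "h \<in> carrier G" "x = h \<otimes> y \<otimes> inv h" using assms by (auto simp: conj_def)
  have "x [^] n = h \<otimes> y [^] n \<otimes> inv h"
  proof (induction n)
    case 0
    then show ?case using h by simp
  next
    case (Suc n)
    have "h \<otimes> y [^] n \<otimes> inv h \<otimes> (h \<otimes> y \<otimes> inv h) = h \<otimes> y [^] n \<otimes> (inv h \<otimes> h) \<otimes> y \<otimes> inv h"
      using h assms(2) by (simp add: m_assoc inv_cancel)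
    then show ?case using Suc h assms(2) by (simp add: m_assoc)
  qed
  then show ?thesis using h by (auto simp: conj_def)
qed

lemma conj_rotate: "conj (W u) (W (rotate i u))"
proof (induction i)
  case 0
  then show ?case by (simp add: conj_refl)
next
  case (Suc i)
  have "conj (W u) (W (rotate1 u))" for u
    using conj_swap[of "t [^] hd u \<otimes> s" "W (tl u)"] by (cases u) (auto simp: W_append conj_refl)
  then show ?case using Suc conj_trans[OF _ _ Suc] by auto
qed

text \<open>Conjugation carries the trailing power of \<open>t\<close> to the front, or the leading
  \<open>s\<close> to the end. Either this gives a word with nonzero letters, or something cancels
  and the word becomes shorter, until only a power of \<open>t\<close> or \<open>s\<close> is
  left.\<close>

lemma conj_normal_form:
  assumes "0 \<notin> set l"
  shows "(\<exists>j::int. conj (normal_form b l k) (t [^] j)) \<or> conj (normal_form b l k) s \<or>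
    (\<exists>l'\<in>nz_words. conj (normal_form b l k) (W l'))"
  using assms
proof (induction "length l" arbitrary: b l k rule: less_induct)
  case less
  have red: ?case if "conj (normal_form b l k) (normal_form b' l' k')" "length l' < length l" "0 \<notin> set l'" for b' l' k'
  proof -
    have c: "normal_form b' l' k' \<in> carrier G" by (simp add: normal_form_def)
    show ?thesis using less.hyps[OF that(2,3)] conj_trans[OF c _ that(1)] by (metis W_closed int_pow_closed s t)
  qed
  show ?case
  proof (cases b)
    case False
    have c: "conj (normal_form b l k) (t [^] k \<otimes> W l)"
      using False conj_swap[of "W l" "t [^] k"] by (simp add: normal_form_def flip_def)
    show ?thesis
    proof (cases l)
      case Nil
      then show ?thesis using c by auto
    next
      case (Cons n l')
      show ?thesis
      proof (cases "k + n = 0")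
        case True
        then have "conj (normal_form b l k) (normal_form True l' 0)"
          using c unfolding Cons t_W_Cons_cancel[OF True] by (simp add: normal_form_def flip_def)
        then show ?thesis using red less.prems Cons by auto
      next
        case False
        then have "conj (normal_form b l k) (W ((k + n) # l'))" using c unfolding Cons t_W_Cons by simp
        moreover have "(k + n) # l' \<in> nz_words" using False less.prems Cons by (auto simp: nz_words_def)
        ultimately show ?thesis by blast
      qed
    qed
  next
    case True
    have c: "conj (normal_form b l k) (W l \<otimes> t [^] k \<otimes> s)"
      using True conj_swap[of s "W l \<otimes> t [^] k"] by (simp add: normal_form_def flip_def m_assoc)
    show ?thesis
    proof (cases "k = 0")
      case False
      then have "conj (normal_form b l k) (W (l @ [k]))" "l @ [k] \<in> nz_words"
        using c less.prems by (auto simp: W_append m_assoc nz_words_def)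
      then show ?thesis by blast
    next
      case k: True
      show ?thesis
      proof (cases l rule: rev_cases)
        case Nil
        then show ?thesis using c k by auto
      next
        case (snoc l' n)
        have "conj (normal_form b l k) (normal_form False l' n)"
          using c k unfolding snoc W_snoc by (simp add: normal_form_def flip_def m_assoc ss)
        then show ?thesis using red less.prems snoc by auto
      qed
    qed
  qed
qed

lemma conj_cases:
  assumes "g \<in> carrier G"
  obtains j :: int where "conj g (t [^] j)" | "conj g s" | l where "l \<in> nz_words" "conj g (W l)"
  using normal_form_exists[OF assms] conj_normal_form by metis

text \<open>A cancellation at the junction consumes one letter on each side: two copies of
  \<open>s\<close> meet and vanish, and the last exponent of \<open>l\<close> takes over the role of
  \<open>k\<close>. As \<open>x\<close> is longer it survives, so no power of \<open>t\<close> is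
  left at the right end.\<close>

lemma absorb:
  assumes "0 \<notin> set l" "0 \<notin> set x" "length x > length l"
  shows "\<exists>b l'. 0 \<notin> set l' \<and> W l \<otimes> t [^] (k::int) \<otimes> W x = flip b \<otimes> W l'"
  using assms
proof (induction l arbitrary: k x rule: rev_induct)
  case Nil
  then obtain n x' where x: "x = n # x'" by (cases x) auto
  show ?case
  proof (cases "k + n = 0")
    case True
    have "W [] \<otimes> t [^] k \<otimes> W x = flip True \<otimes> W x'"
      unfolding x using t_W_Cons_cancel[OF True, of x'] by (simp add: flip_def)
    then show ?thesis using Nil x by auto
  next
    case False
    have "W [] \<otimes> t [^] k \<otimes> W x = flip False \<otimes> W ((k + n) # x')"
      unfolding x using t_W_Cons[of k n x'] by (simp add: flip_def)
    then show ?thesis using Nil x False by (metis set_ConsD list.set_intros(2))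
  qed
next
  case (snoc m l)
  then obtain n x' where x: "x = n # x'" by (cases x) auto
  have *: "W (l @ [m]) \<otimes> t [^] k \<otimes> W x = W (l @ [m]) \<otimes> (t [^] k \<otimes> W (n # x'))"
    unfolding x by (rule m_assoc) auto
  show ?case
  proof (cases "k + n = 0")
    case True
    have "W (l @ [m]) \<otimes> t [^] k \<otimes> W x = W l \<otimes> t [^] m \<otimes> W x'"
      unfolding * unfolding t_W_Cons_cancel[OF True] W_snoc
      by (simp add: m_assoc s_s_cancel)
    moreover have "\<exists>b l'. 0 \<notin> set l' \<and> W l \<otimes> t [^] m \<otimes> W x' = flip b \<otimes> W l'"
      using snoc.prems x by (intro snoc.IH) auto
    ultimately show ?thesis by simp
  next
    case False
    have "W (l @ [m]) \<otimes> t [^] k \<otimes> W x = flip False \<otimes> W (l @ [m] @ (k + n) # x')"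
      unfolding * t_W_Cons by (simp add: flip_def W_append m_assoc)
    moreover have "0 \<notin> set (l @ [m] @ (k + n) # x')" using snoc.prems x False by auto
    ultimately show ?thesis by blast
  qed
qed

text \<open>The inverse of \<open>t [^] n \<otimes> s\<close> is
  \<open>s \<otimes> t [^] (- n)\<close>; shifting every \<open>s\<close> by one place conjugates
  the reversed word by \<open>s\<close>.\<close>

lemma inv_W: "inv (W v) = s \<otimes> W (rev (map uminus v)) \<otimes> s"
proof (induction v)
  case (Cons n v)
  have "inv (W (n # v)) = inv (W v) \<otimes> (s \<otimes> t [^] (- n))"
    by (simp add: inv_mult_group inv_s int_pow_neg)
  also have "\<dots> = s \<otimes> (W (rev (map uminus v)) \<otimes> (t [^] (- n) \<otimes> (s \<otimes> s)))"
    unfolding Cons by (simp add: m_assoc s_s_cancel ss)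
  also have "\<dots> = s \<otimes> W (rev (map uminus (n # v))) \<otimes> s"
    by (simp add: W_append m_assoc)
  finally show ?case .
qed (simp add: ss)

end

locale hecke_inj = hecke_like +
  assumes W_inj: "0 \<notin> set l \<Longrightarrow> 0 \<notin> set l' \<Longrightarrow> W l = W l' \<Longrightarrow> l = l'"
begin

text \<open>Multiplying a conjugating element by a high power of \<open>W u\<close> turns it into a word, up to a flip
  that is impossible for reasons of length.\<close>

lemma conj_W_imp_rotate:
  assumes u: "u \<in> nz_words" and v: "v \<in> nz_words" and c: "conj (W v) (W u)"
  obtains i where "u = rotate i v"
proof -
  obtain h where h: "h \<in> carrier G" "W v = h \<otimes> W u \<otimes> inv h" using c by (auto simp: conj_def)
  have hu: "W v \<otimes> h = h \<otimes> W u" using h by (simp add: m_assoc)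
  obtain b l k where hn: "0 \<notin> set l" "h = normal_form b l k"
    using normal_form_exists[OF h(1)] .
  \<comment> \<open>Since \<open>u\<close> has length at least 1, this exponent makes
    \<open>x\<close> longer than \<open>l\<close>, as \<open>absorb\<close> demands.\<close>
  define x where "x = word_power (Suc (length l)) u"
  have "0 \<notin> set u" "length u \<ge> 1" using u by (auto simp: nz_words_def Suc_le_eq)
  moreover have "length x = Suc (length l) * length u" "set x = set u"
    unfolding x_def by (simp_all only: length_word_power set_word_power[OF zero_less_Suc])
  ultimately have x: "0 \<notin> set x" "length x > length l"
    using mult_le_mono2[of 1 "length u" "Suc (length l)"] by auto
  obtain b' y where y: "0 \<notin> set y" "W l \<otimes> t [^] k \<otimes> W x = flip b' \<otimes> W y"
    using absorb[OF hn(1) x] by blast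
  define d where "d = (b \<noteq> b')"
  have hx: "h \<otimes> W x = flip d \<otimes> W y"
  proof -
    have "h \<otimes> W x = flip b \<otimes> (W l \<otimes> t [^] k \<otimes> W x)" by (simp add: hn normal_form_def m_assoc)
    then show ?thesis unfolding y d_def by (auto simp: flip_def m_assoc s_s_cancel)
  qed
  have xu: "W x \<otimes> W u = W u \<otimes> W x" unfolding x_def W_append[symmetric] word_power_commute ..
  have "flip d \<otimes> W (y @ u) = h \<otimes> W x \<otimes> W u" unfolding hx W_append by (simp add: m_assoc)
  also have "\<dots> = W v \<otimes> (h \<otimes> W x)" using h xu hu by (simp add: m_assoc[symmetric]) (simp add: m_assoc)
  finally have eq: "flip d \<otimes> W (y @ u) = W v \<otimes> (flip d \<otimes> W y)" unfolding hx .
  show ?thesis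
  proof (cases d)
    case False
    then have "W (y @ u) = W (v @ y)" using eq by (simp add: flip_def W_append)
    then have "y @ u = v @ y" using y u v by (intro W_inj) (auto simp: nz_words_def)
    then show ?thesis using conjugate_words_rotate[of v y u] that by auto
  next
    case True
    let ?v = "rev (map uminus v)"
    have "s \<otimes> W (?v @ y @ u) = s \<otimes> W ?v \<otimes> s \<otimes> (s \<otimes> W (y @ u))"
      unfolding W_append[of ?v] by (simp add: m_assoc s_s_cancel)
    also have "\<dots> = inv (W v) \<otimes> (W v \<otimes> (s \<otimes> W y))" unfolding inv_W using eq True by (simp add: flip_def)
    also have "\<dots> = s \<otimes> W y" by (simp add: m_assoc[symmetric])
    finally have "W (?v @ y @ u) = W y" by simp
    then have "?v @ y @ u = y" using y u v by (intro W_inj) (auto simp: nz_words_def)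
    then have "length (?v @ y @ u) = length y" by simp
    then show ?thesis using u by (simp add: nz_words_def)
  qed
qed

end

text \<open>The group theory sees hyperbolicity only through these properties: it is a conjugation
  invariant that singles out the words among the three kinds of cyclically reduced elements.\<close>

locale hecke_hyp = hecke_inj +
  fixes hyp :: "'a \<Rightarrow> bool"
  assumes hyp_conj: "h \<in> carrier G \<Longrightarrow> y \<in> carrier G \<Longrightarrow> hyp (h \<otimes> y \<otimes> inv h) \<Longrightarrow> hyp y"
    and not_hyp_t: "\<not> hyp (t [^] (j::int))" and not_hyp_s: "\<not> hyp s"
    and hyp_W: "l \<in> nz_words \<Longrightarrow> hyp (W l)"
begin

lemma hyp_conj': "y \<in> carrier G \<Longrightarrow> conj x y \<Longrightarrow> hyp x \<Longrightarrow> hyp y"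
  by (auto simp: conj_def intro: hyp_conj)

lemma hyp_conj_W:
  assumes "g \<in> carrier G" "hyp g"
  obtains l where "l \<in> nz_words" "conj g (W l)"
  using assms(1)
proof (cases rule: conj_cases)
  case (1 j)
  then show ?thesis using hyp_conj'[OF _ 1 assms(2)] not_hyp_t by auto
next
  case 2
  then show ?thesis using hyp_conj'[OF _ 2 assms(2)] not_hyp_s by auto
qed (use that in blast)

lemma primitive_conj:
  assumes "conj x y" "x \<in> carrier G" "y \<in> carrier G" "primitive G x"
  shows "primitive G y"
proof -
  have "\<not> primitive G x" if "\<not> primitive G y"
  proof -
    obtain h n where h: "h \<in> carrier G" "n \<ge> (2::nat)" "y = h [^] n" using \<open>\<not> primitive G y\<close> by (auto simp: primitive_def)
    obtain k where k: "k \<in> carrier G" "x = k \<otimes> y \<otimes> inv k" using assms(1) by (auto simp: conj_def)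
    have "conj (k \<otimes> h \<otimes> inv k) h" using k by (auto simp: conj_def)
    then have "conj ((k \<otimes> h \<otimes> inv k) [^] n) (h [^] n)" using conj_pow h by blast
    obtain h' where h': "h' \<in> carrier G" "conj h' h" and hk: "h' = k \<otimes> h \<otimes> inv k"
      using k h by (auto simp: conj_def)
    have "(k \<otimes> h \<otimes> inv k) [^] m = k \<otimes> h [^] m \<otimes> inv k" for m :: nat
    proof (induction m)
      case (Suc m)
      have "k \<otimes> h [^] m \<otimes> inv k \<otimes> (k \<otimes> h \<otimes> inv k) = k \<otimes> h [^] m \<otimes> (inv k \<otimes> k) \<otimes> h \<otimes> inv k"
        using h k by (simp add: m_assoc inv_cancel)
      then show ?case using Suc h k by (simp add: m_assoc)
    qed (use k in simp)
    then have "x = h' [^] n" using h k hk by simp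
    then show ?thesis using h h' by (auto simp: primitive_def)
  qed
  then show ?thesis using assms(4) by blast
qed

text \<open>If \<open>W u\<close> is a proper power of \<open>h\<close>, cyclic reduction of
  \<open>h\<close> gives a power of \<open>t\<close>, the involution or a word. The first two
  contradict hyperbolicity of \<open>W u\<close>; in the third a rotation of \<open>u\<close> is a
  proper power.\<close>

lemma primitive_W_iff:
  assumes u: "u \<in> nz_words"
  shows "primitive G (W u) \<longleftrightarrow> primitive_word u"
proof
  assume prim: "primitive G (W u)"
  show "primitive_word u" unfolding primitive_word_def
  proof (intro conjI allI impI)
    show "u \<noteq> []" using u by (simp add: nz_words_def)
    fix v n assume "u = word_power n v"
    then have "W u = W v [^] n" using W_power by simp
    then show "n \<le> 1" using prim unfolding primitive_def by (metis W_closed not_less_eq_eq numeral_2_eq_2 One_nat_def)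
  qed
next
  assume pw: "primitive_word u"
  show "primitive G (W u)" unfolding primitive_def
  proof
    assume "\<exists>h\<in>carrier G. \<exists>n::nat. 2 \<le> n \<and> W u = h [^] n"
    then obtain h n where h: "h \<in> carrier G" "n \<ge> (2::nat)" "W u = h [^] n" by blast
    have key: "False" if "v \<in> nz_words" "conj (W u) (W v [^] n)" for v
    proof -
      have "conj (W u) (W (word_power n v))" using that by (simp add: W_power)
      moreover have "word_power n v \<in> nz_words" using that h by (simp add: word_power_nz_iff)
      ultimately obtain i where "word_power n v = rotate i u" using conj_W_imp_rotate u by metis
      then have "primitive_word (word_power n v)" using primitive_word_rotate[OF pw] by metis
      then show False using h unfolding primitive_word_def by (metis Suc_1 not_less_eq_eq)
    qed
    show False using h(1)
    proof (cases rule: conj_cases)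
      case (1 j)
      have "conj (W u) (t [^] (j * int n))"
        using conj_pow[OF 1, of n] h by (simp add: int_pow_pow flip: int_pow_int)
      then show False using hyp_conj'[OF int_pow_closed[OF t] _ hyp_W[OF u]] not_hyp_t by blast
    next
      case 2
      have c: "conj (W u) (s [^] n)" using conj_pow[OF 2, of n] h by simp
      have "s [^] n = \<one> \<or> s [^] n = s" by (induction n) (auto simp: ss)
      then show False
        using c hyp_conj'[OF _ c hyp_W[OF u]] not_hyp_s not_hyp_t[of 0] by auto
    next
      case (3 v)
      then show False using key[of v] conj_pow[OF 3(2), of n] h by simp
    qed
  qed
qed

lemma conjugacy_class_conv: "conjugacy_class G z = {a. conj a z}"
  by (auto simp: conjugacy_class_def conj_def)

lemma conjugacy_class_eqI:
  assumes "conj x y" "x \<in> carrier G" "y \<in> carrier G"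
  shows "conjugacy_class G x = conjugacy_class G y"
proof -
  have "conj a x \<longleftrightarrow> conj a y" for a
    using assms conj_trans[of x y a] conj_trans[of y x a] conj_sym[of y x] by blast
  then show ?thesis by (simp add: conjugacy_class_conv)
qed

lemma conjugacy_classes_eq:
  "conjugacy_class G ` {g \<in> carrier G. hyp g \<and> primitive G g} = (\<lambda>u. conjugacy_class G (W u)) ` prim_words"
proof (intro equalityI subsetI)
  fix K assume "K \<in> conjugacy_class G ` {g \<in> carrier G. hyp g \<and> primitive G g}"
  then obtain g where g: "g \<in> carrier G" "hyp g" "primitive G g" "K = conjugacy_class G g" by blast
  obtain u where u: "u \<in> nz_words" "conj g (W u)" using hyp_conj_W g by blast
  then have "primitive G (W u)" using primitive_conj g by simp
  then have "u \<in> prim_words" using u primitive_W_iff by (simp add: prim_words_def)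
  then show "K \<in> (\<lambda>u. conjugacy_class G (W u)) ` prim_words"
    using conjugacy_class_eqI[OF u(2)] g by auto
next
  fix K assume "K \<in> (\<lambda>u. conjugacy_class G (W u)) ` prim_words"
  then show "K \<in> conjugacy_class G ` {g \<in> carrier G. hyp g \<and> primitive G g}"
    using hyp_W primitive_W_iff by (auto simp: prim_words_def)
qed

text \<open>The rotations of a primitive word are distinct, so each class is represented by exactly
  \<open>length u\<close> words, a multiplicity that weights \<open>1 / length\<close> undo.\<close>

lemma conjugacy_class_fibre:
  assumes u: "u \<in> prim_words"
  shows "{v \<in> prim_words. conjugacy_class G (W v) = conjugacy_class G (W u)} = (\<lambda>i. rotate i u) ` {..<length u}"
proof (intro equalityI subsetI)
  fix v assume "v \<in> {v \<in> prim_words. conjugacy_class G (W v) = conjugacy_class G (W u)}"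
  then have v: "v \<in> prim_words" "conjugacy_class G (W v) = conjugacy_class G (W u)" by auto
  then have c: "conj (W u) (W v)" using conj_refl[of "W u"] by (auto simp: conjugacy_class_conv)
  have "u \<in> nz_words" "v \<in> nz_words" using u v(1) by (auto simp: prim_words_def)
  from conj_W_imp_rotate[OF this(2,1) c] obtain i where "v = rotate i u" .
  then have "v = rotate (i mod length u) u" using rotate_conv_mod by metis
  then show "v \<in> (\<lambda>i. rotate i u) ` {..<length u}" using u by (auto simp: prim_words_def nz_words_def)
next
  fix v assume "v \<in> (\<lambda>i. rotate i u) ` {..<length u}"
  then obtain i where "v = rotate i u" by blast
  then show "v \<in> {v \<in> prim_words. conjugacy_class G (W v) = conjugacy_class G (W u)}"
    using u rotate_prim_words conjugacy_class_eqI[OF conj_rotate[of u i]] by auto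
qed

lemma card_conjugacy_class_fibre:
  assumes "u \<in> prim_words"
  shows "card {v \<in> prim_words. conjugacy_class G (W v) = conjugacy_class G (W u)} = length u"
  unfolding conjugacy_class_fibre[OF assms] using inj_on_rotate_primitive assms
  by (subst card_image) (auto simp: prim_words_def)

end

section \<open>Real 2 by 2 matrices and the Hecke group\<close>

lemma mat2_carrier [simp]: "mat2 a b c d \<in> carrier_mat 2 2"
  by (intro carrier_matI) (simp_all add: mat2_def mat_of_rows_list_def)

lemma mat2_dim [simp]: "dim_row (mat2 a b c d) = 2" "dim_col (mat2 a b c d) = 2"
  using mat2_carrier by blast+

lemma mat2_index [simp]:
  "mat2 a b c d $$ (0, 0) = a" "mat2 a b c d $$ (0, Suc 0) = b"
  "mat2 a b c d $$ (Suc 0, 0) = c" "mat2 a b c d $$ (Suc 0, Suc 0) = d"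
  by (simp_all add: mat2_def mat_of_rows_list_def)

lemma mat2_eqI:
  assumes "A \<in> carrier_mat 2 2" "B \<in> carrier_mat 2 2"
    "A $$ (0, 0) = B $$ (0, 0)" "A $$ (0, Suc 0) = B $$ (0, Suc 0)"
    "A $$ (Suc 0, 0) = B $$ (Suc 0, 0)" "A $$ (Suc 0, Suc 0) = B $$ (Suc 0, Suc 0)"
  shows "A = B"
proof (rule eq_matI)
  fix i j assume "i < dim_row B" "j < dim_col B"
  then have "i = 0 \<or> i = Suc 0" "j = 0 \<or> j = Suc 0" using assms(2) by auto
  then show "A $$ (i, j) = B $$ (i, j)" using assms by auto
qed (use assms in auto)

lemma mat2_exhaust:
  assumes "A \<in> carrier_mat 2 2"
  obtains a b c d where "A = mat2 a b c d"
proof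
  show "A = mat2 (A $$ (0, 0)) (A $$ (0, Suc 0)) (A $$ (Suc 0, 0)) (A $$ (Suc 0, Suc 0))"
    using assms by (intro mat2_eqI) auto
qed

lemma mat2_eq_iff [simp]: "mat2 a b c d = mat2 a' b' c' d' \<longleftrightarrow> a = a' \<and> b = b' \<and> c = c' \<and> d = d'"
  by (metis mat2_index)

lemma mat2_mult: "mat2 a b c d * mat2 a' b' c' d' = mat2 (a*a' + b*c') (a*b' + b*d') (c*a' + d*c') (c*b' + d*d')"
  by (rule mat2_eqI) (auto simp: scalar_prod_def atLeast0_lessThan_Suc numeral_2_eq_2)

lemma mat2_uminus: "- mat2 a b c d = mat2 (-a) (-b) (-c) (-d)"
  by (rule mat2_eqI) auto

lemma mat2_one: "1\<^sub>m 2 = mat2 1 0 0 1"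
  by (rule mat2_eqI) auto

lemma det_mat2: "Determinant.det (mat2 a b c d) = a * d - b * c"
proof -
  have "Determinant.det (mat2 a b c d) = (\<Sum>i<2. mat2 a b c d $$ (i, 0) * cofactor (mat2 a b c d) i 0)"
    by (rule laplace_expansion_column) auto
  also have "\<dots> = a * d - b * c"
    by (simp add: numeral_2_eq_2 cofactor_def det_single mat_delete_def)
  finally show ?thesis .
qed

lemma mat2_SL2R_iff [simp]: "mat2 a b c d \<in> carrier SL2R \<longleftrightarrow> a * d - b * c = 1"
  by (simp add: SL2R_def det_mat2)

lemma SL2R_exhaust:
  assumes "A \<in> carrier SL2R"
  obtains a b c d where "A = mat2 a b c d" "a * d - b * c = 1"
proof -
  have "A \<in> carrier_mat 2 2" using assms by (simp add: SL2R_def)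
  from mat2_exhaust[OF this] obtain a b c d where A: "A = mat2 a b c d" .
  then have "a * d - b * c = 1" using assms by simp
  then show ?thesis using that A by blast
qed

lemma SL2R_mult [simp]: "A \<otimes>\<^bsub>SL2R\<^esub> B = A * B"
  by (simp add: SL2R_def)

lemma SL2R_one [simp]: "\<one>\<^bsub>SL2R\<^esub> = 1\<^sub>m 2"
  by (simp add: SL2R_def)

lemma group_SL2R: "group SL2R"
proof (rule groupI)
  show "x \<otimes>\<^bsub>SL2R\<^esub> y \<in> carrier SL2R" if "x \<in> carrier SL2R" "y \<in> carrier SL2R" for x y
    using that by (auto simp: SL2R_def det_mult)
  show "\<one>\<^bsub>SL2R\<^esub> \<in> carrier SL2R" by (simp add: mat2_one)
  show "x \<otimes>\<^bsub>SL2R\<^esub> y \<otimes>\<^bsub>SL2R\<^esub> z = x \<otimes>\<^bsub>SL2R\<^esub> (y \<otimes>\<^bsub>SL2R\<^esub> z)"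
    if "x \<in> carrier SL2R" "y \<in> carrier SL2R" "z \<in> carrier SL2R" for x y z
    using that by (auto simp: SL2R_def)
  show "\<one>\<^bsub>SL2R\<^esub> \<otimes>\<^bsub>SL2R\<^esub> x = x" if "x \<in> carrier SL2R" for x
    using that by (auto simp: SL2R_def)
  show "\<exists>y\<in>carrier SL2R. y \<otimes>\<^bsub>SL2R\<^esub> x = \<one>\<^bsub>SL2R\<^esub>" if x: "x \<in> carrier SL2R" for x
  proof -
    obtain a b c d where "x = mat2 a b c d" "a * d - b * c = 1" using SL2R_exhaust x by blast
    then show ?thesis
      by (intro bexI[of _ "mat2 d (-b) (-c) a"]) (auto simp: mat2_mult mat2_one algebra_simps)
  qed
qed

lemma SL2R_inv: "a * d - b * c = 1 \<Longrightarrow> inv\<^bsub>SL2R\<^esub> (mat2 a b c d) = mat2 d (-b) (-c) a"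
  by (rule group.inv_equality[OF group_SL2R]) (auto simp: mat2_mult mat2_one algebra_simps)

lemma normal_pm1: "{1\<^sub>m 2, - 1\<^sub>m 2} \<lhd> SL2R"
proof (rule group.normal_invI[OF group_SL2R])
  show "subgroup {1\<^sub>m 2, - 1\<^sub>m 2} SL2R"
    by (rule group.subgroupI[OF group_SL2R]) (auto simp: mat2_one mat2_uminus mat2_mult SL2R_inv)
  fix x h assume "x \<in> carrier SL2R" and h: "h \<in> {1\<^sub>m 2, - 1\<^sub>m 2 :: real mat}"
  then obtain a b c d where "x = mat2 a b c d" "a * d - b * c = 1" using SL2R_exhaust by blast
  then show "x \<otimes>\<^bsub>SL2R\<^esub> h \<otimes>\<^bsub>SL2R\<^esub> inv\<^bsub>SL2R\<^esub> x \<in> {1\<^sub>m 2, - 1\<^sub>m 2}"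
    using h by (auto simp: mat2_one mat2_uminus mat2_mult SL2R_inv algebra_simps)
qed

lemma group_PSL2R: "group PSL2R"
  unfolding PSL2R_def by (rule normal.factorgroup_is_group[OF normal_pm1])

lemma psl_conv: "A \<in> carrier_mat 2 2 \<Longrightarrow> psl A = {A, - A}"
  by (elim mat2_exhaust) (auto simp: psl_def r_coset_def mat2_one mat2_uminus mat2_mult)

lemma psl_mat2: "psl (mat2 a b c d) = {mat2 a b c d, mat2 (-a) (-b) (-c) (-d)}"
  by (simp add: psl_conv mat2_uminus)

lemma psl_mult:
  assumes "A \<in> carrier SL2R" "B \<in> carrier SL2R"
  shows "psl A \<otimes>\<^bsub>PSL2R\<^esub> psl B = psl (A * B)"
  using normal.rcos_sum[OF normal_pm1 assms] by (simp add: psl_def PSL2R_def)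

lemma psl_closed: "A \<in> carrier SL2R \<Longrightarrow> psl A \<in> carrier PSL2R"
  by (auto simp: PSL2R_def psl_def carrier_FactGroup)

lemma PSL2R_exhaust:
  assumes "g \<in> carrier PSL2R"
  obtains a b c d where "g = psl (mat2 a b c d)" "a * d - b * c = 1"
proof -
  obtain A where A: "A \<in> carrier SL2R" "g = psl A"
    using assms by (auto simp: PSL2R_def psl_def carrier_FactGroup)
  obtain a b c d where "A = mat2 a b c d" "a * d - b * c = 1" using SL2R_exhaust[OF A(1)] .
  then show ?thesis using that A by blast
qed

lemma psl_one: "\<one>\<^bsub>PSL2R\<^esub> = psl (mat2 1 0 0 1)"
  by (simp add: PSL2R_def psl_mat2 mat2_one mat2_uminus)

lemma psl_inv:
  assumes "a * d - b * c = 1"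
  shows "inv\<^bsub>PSL2R\<^esub> (psl (mat2 a b c d)) = psl (mat2 d (-b) (-c) a)"
proof (rule group.inv_equality[OF group_PSL2R])
  have "d * a - (-b) * (-c) = 1" using assms by (simp add: algebra_simps)
  then show "psl (mat2 d (- b) (- c) a) \<otimes>\<^bsub>PSL2R\<^esub> psl (mat2 a b c d) = \<one>\<^bsub>PSL2R\<^esub>"
    using assms by (subst psl_mult) (auto simp: mat2_mult psl_one algebra_simps)
qed (use assms in \<open>auto intro!: psl_closed simp: algebra_simps\<close>)

lemma psl_eq_iff:
  "psl (mat2 a b c d) = psl (mat2 a' b' c' d') \<longleftrightarrow>
    mat2 a b c d = mat2 a' b' c' d' \<or> mat2 a b c d = mat2 (-a') (-b') (-c') (-d')"
  unfolding psl_mat2 by (auto simp: doubleton_eq_iff)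

lemma hyperbolic_psl: "hyperbolic (psl (mat2 a b c d)) \<longleftrightarrow> \<bar>a + d\<bar> > 2"
  unfolding hyperbolic_def psl_mat2 by auto

text \<open>In the quotient the trace is defined up to sign; exhibiting one representative with
  exactly the old trace removes the ambiguity.\<close>

lemma psl_conj_trace:
  assumes "h \<in> carrier PSL2R" and det_y: "p * u - q * r = 1"
  shows "\<exists>a b c d. h \<otimes>\<^bsub>PSL2R\<^esub> psl (mat2 p q r u) \<otimes>\<^bsub>PSL2R\<^esub> inv\<^bsub>PSL2R\<^esub> h = psl (mat2 a b c d)
    \<and> a * d - b * c = 1 \<and> a + d = p + u"
proof -
  obtain a b c d where h: "h = psl (mat2 a b c d)" "a * d - b * c = 1" using PSL2R_exhaust[OF assms(1)] .
  define A B C D where "A = a*p + b*r" and "B = a*q + b*u" and "C = c*p + d*r" and "D = c*q + d*u"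
  have 1: "h \<otimes>\<^bsub>PSL2R\<^esub> psl (mat2 p q r u) = psl (mat2 A B C D)"
    unfolding h(1) A_def B_def C_def D_def using h(2) det_y by (subst psl_mult) (auto simp: mat2_mult)
  have "A * D - B * C = (a * d - b * c) * (p * u - q * r)"
    by (simp add: A_def B_def C_def D_def algebra_simps)
  then have det: "A * D - B * C = 1" using h(2) det_y by simp
  have 2: "h \<otimes>\<^bsub>PSL2R\<^esub> psl (mat2 p q r u) \<otimes>\<^bsub>PSL2R\<^esub> inv\<^bsub>PSL2R\<^esub> h
     = psl (mat2 (A*d - B*c) (B*a - A*b) (C*d - D*c) (D*a - C*b))"
    unfolding 1 unfolding h(1) psl_inv[OF h(2)] using det h(2) by (subst psl_mult) (auto simp: mat2_mult algebra_simps)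
  have "(A*d - B*c) * (D*a - C*b) - (B*a - A*b) * (C*d - D*c) = (A * D - B * C) * (a * d - b * c)"
    by (simp add: algebra_simps)
  then have 3: "(A*d - B*c) * (D*a - C*b) - (B*a - A*b) * (C*d - D*c) = 1" using det h(2) by simp
  have "(A*d - B*c) + (D*a - C*b) = (p + u) * (a * d - b * c)"
    by (simp add: A_def B_def C_def D_def algebra_simps)
  then show ?thesis using 2 3 h(2) by fastforce
qed

lemma hyperbolic_conj:
  assumes "h \<in> carrier PSL2R" "y \<in> carrier PSL2R" "hyperbolic (h \<otimes>\<^bsub>PSL2R\<^esub> y \<otimes>\<^bsub>PSL2R\<^esub> inv\<^bsub>PSL2R\<^esub> h)"
  shows "hyperbolic y"
proof -
  obtain p q r u where y: "y = psl (mat2 p q r u)" "p * u - q * r = 1" using PSL2R_exhaust[OF assms(2)] .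
  obtain a b c d where "h \<otimes>\<^bsub>PSL2R\<^esub> y \<otimes>\<^bsub>PSL2R\<^esub> inv\<^bsub>PSL2R\<^esub> h = psl (mat2 a b c d)" "a + d = p + u"
    using psl_conj_trace[OF assms(1) y(2)] unfolding y(1) by metis
  then show ?thesis using assms(3) unfolding y(1) by (simp add: hyperbolic_psl)
qed

text \<open>The entries of \<open>T\<^sup>n\<^sup>1 S\<^sup>-\<^sup>1 T\<^sup>n\<^sup>2 S\<^sup>-\<^sup>1 \<dots>\<close>\<close>

fun word_mat :: "real \<Rightarrow> int list \<Rightarrow> real \<times> real \<times> real \<times> real" where
  "word_mat w [] = (1, 0, 0, 1)"
| "word_mat w (n # l) = (case word_mat w l of (a, b, c, d) \<Rightarrow> (n * w * a - c, n * w * b - d, a, b))"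

lemma word_mat_det: "word_mat w l = (a, b, c, d) \<Longrightarrow> a * d - b * c = 1"
proof (induction l arbitrary: a b c d)
  case (Cons n l)
  obtain a' b' c' d' where l: "word_mat w l = (a', b', c', d')" by (metis prod_cases4)
  have eq: "a = n * w * a' - c'" "b = n * w * b' - d'" "c = a'" "d = b'" using Cons.prems l by auto
  have "a * d - b * c = a' * d' - b' * c'" unfolding eq by (simp add: algebra_simps)
  then show ?case using Cons.IH[OF l] by simp
qed auto

locale hecke_parameter =
  fixes w :: real assumes w: "w > 2"
begin

lemma abs_letter: "n \<noteq> 0 \<Longrightarrow> \<bar>of_int n * w\<bar> \<ge> w"
proof -
  assume "n \<noteq> 0"
  then have "\<bar>real_of_int n\<bar> \<ge> 1" by linarith
  then have "w * 1 \<le> w * \<bar>real_of_int n\<bar>" using w by (intro mult_left_mono) auto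
  then show ?thesis using w by (simp add: abs_mult mult.commute)
qed

text \<open>A new letter turns the left column into \<open>n * w * a - c\<close> over
  \<open>a\<close>, and \<open>\<bar>n * w\<bar> \<ge> w > 2\<close> keeps the top entry dominant.
  The gap \<open>w - 1\<close> is \<open>(w - 2) + 1\<close>, from
  \<open>\<bar>a\<bar> \<ge> 1\<close> and the previous gap.\<close>

lemma word_mat_dominant:
  assumes "word_mat w l = (a, b, c, d)" "0 \<notin> set l"
  shows "w / 2 * \<bar>c\<bar> \<le> \<bar>a\<bar>" "\<bar>a\<bar> - \<bar>c\<bar> \<ge> 1" "l \<noteq> [] \<Longrightarrow> \<bar>a\<bar> - \<bar>c\<bar> \<ge> w - 1"
proof -
  have "w / 2 * \<bar>c\<bar> \<le> \<bar>a\<bar> \<and> \<bar>a\<bar> - \<bar>c\<bar> \<ge> 1 \<and> (l \<noteq> [] \<longrightarrow> \<bar>a\<bar> - \<bar>c\<bar> \<ge> w - 1)" using assms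
  proof (induction l arbitrary: a b c d)
    case (Cons n l)
    obtain a' b' c' d' where l: "word_mat w l = (a', b', c', d')" by (metis prod_cases4)
    then have eq: "a = n * w * a' - c'" "c = a'" using Cons.prems by auto
    have IH: "w / 2 * \<bar>c'\<bar> \<le> \<bar>a'\<bar>" "\<bar>a'\<bar> - \<bar>c'\<bar> \<ge> 1" using Cons.IH[OF l] Cons.prems by auto
    have "\<bar>n * w * a'\<bar> \<ge> w * \<bar>a'\<bar>"
      unfolding abs_mult[of "n * w"] using abs_letter Cons.prems by (intro mult_right_mono) auto
    then have a: "\<bar>a\<bar> \<ge> w * \<bar>a'\<bar> - \<bar>c'\<bar>" unfolding eq by linarith
    have "\<bar>c'\<bar> \<le> w / 2 * \<bar>c'\<bar>" using w mult_right_mono[of 1 "w / 2" "\<bar>c'\<bar>"] by simp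
    then have c': "\<bar>c'\<bar> \<le> \<bar>a'\<bar>" using IH by linarith
    have "w / 2 * \<bar>a'\<bar> \<ge> \<bar>a'\<bar>" using w mult_right_mono[of 1 "w / 2" "\<bar>a'\<bar>"] by simp
    then have 1: "w / 2 * \<bar>c\<bar> \<le> \<bar>a\<bar>" using a c' unfolding eq(2) by (simp add: field_simps)
    have "w * \<bar>a'\<bar> - \<bar>c'\<bar> - \<bar>a'\<bar> = (w - 2) * \<bar>a'\<bar> + (\<bar>a'\<bar> - \<bar>c'\<bar>)" by (simp add: algebra_simps)
    moreover have "(w - 2) * \<bar>a'\<bar> \<ge> w - 2" using w IH mult_left_mono[of 1 "\<bar>a'\<bar>" "w - 2"] by simp
    ultimately have "w * \<bar>a'\<bar> - \<bar>c'\<bar> - \<bar>a'\<bar> \<ge> w - 1" using IH by linarith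
    then show ?case using 1 a w eq by auto
  qed auto
  then show "w / 2 * \<bar>c\<bar> \<le> \<bar>a\<bar>" "\<bar>a\<bar> - \<bar>c\<bar> \<ge> 1" "l \<noteq> [] \<Longrightarrow> \<bar>a\<bar> - \<bar>c\<bar> \<ge> w - 1" by auto
qed

text \<open>\<open>e\<close> is the sign lost in the quotient. Different first letters would give
  \<open>w * \<bar>a1\<bar> \<le> \<bar>c1\<bar> + \<bar>c2\<bar>\<close>, while both lower entries
  are at most \<open>2 / w * \<bar>a1\<bar>\<close> in absolute value; this forces
  \<open>w \<le> 2\<close>.\<close>

lemma word_mat_inj:
  assumes "0 \<notin> set l" "0 \<notin> set l'"
    "word_mat w l = (a, b, c, d)" "word_mat w l' = (e * a, e * b, e * c, e * d)" "\<bar>e\<bar> = 1"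
  shows "l = l'"
  using assms
proof (induction l arbitrary: l' a b c d)
  case Nil
  show ?case
  proof (cases l')
    case (Cons m k)
    obtain a' b' c' d' where k: "word_mat w k = (a', b', c', d')" by (metis prod_cases4)
    then have "\<bar>a'\<bar> \<ge> 1" using word_mat_dominant(2)[OF k] Nil Cons by auto
    then show ?thesis using Nil Cons k by auto
  qed simp
next
  case (Cons n l)
  obtain a1 b1 c1 d1 where l: "word_mat w l = (a1, b1, c1, d1)" by (metis prod_cases4)
  have a1: "\<bar>a1\<bar> - \<bar>c1\<bar> \<ge> 1" using word_mat_dominant(2)[OF l] Cons by auto
  show ?case
  proof (cases l')
    case Nil
    then show ?thesis using Cons.prems l a1 by auto
  next
    case (Cons m k)
    obtain a2 b2 c2 d2 where k: "word_mat w k = (a2, b2, c2, d2)" by (metis prod_cases4)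
    have eq: "a2 = e * a1" "b2 = e * b1" "m * w * a2 - c2 = e * (n * w * a1 - c1)" "m * w * b2 - d2 = e * (n * w * b1 - d1)"
      using Cons.prems l k Cons by auto
    have c1: "w / 2 * \<bar>c1\<bar> \<le> \<bar>a1\<bar>" using word_mat_dominant(1)[OF l] Cons.prems by auto
    have "\<bar>a2\<bar> = \<bar>a1\<bar>" using eq Cons.prems by (simp add: abs_mult)
    then have c2: "w / 2 * \<bar>c2\<bar> \<le> \<bar>a1\<bar>" using word_mat_dominant(1)[OF k] Cons.prems Cons by auto
    have nm: "n = m"
    proof (rule ccontr)
      assume "n \<noteq> m"
      have "(m - n) * w * (e * a1) = c2 - e * c1" using eq by (simp add: algebra_simps)
      then have "\<bar>(m - n) * w\<bar> * \<bar>a1\<bar> = \<bar>c2 - e * c1\<bar>" using Cons.prems by (metis abs_mult mult_1)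
      also have "\<dots> \<le> \<bar>c2\<bar> + \<bar>c1\<bar>" using abs_triangle_ineq4[of c2 "e * c1"] Cons.prems by (simp add: abs_mult)
      finally have "\<bar>(m - n) * w\<bar> * \<bar>a1\<bar> \<le> \<bar>c2\<bar> + \<bar>c1\<bar>" .
      moreover have "\<bar>(m - n) * w\<bar> * \<bar>a1\<bar> \<ge> w * \<bar>a1\<bar>"
        using abs_letter[of "m - n"] \<open>n \<noteq> m\<close> by (intro mult_right_mono) auto
      ultimately have "w / 2 * (w * \<bar>a1\<bar>) \<le> w / 2 * (\<bar>c2\<bar> + \<bar>c1\<bar>)" using w by (intro mult_left_mono) auto
      also have "\<dots> \<le> 2 * \<bar>a1\<bar>" using c1 c2 by (simp add: algebra_simps)
      finally have "(w * w / 2) * \<bar>a1\<bar> \<le> 2 * \<bar>a1\<bar>" by (simp add: algebra_simps)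
      then have "w * w / 2 \<le> 2" using a1 by (subst (asm) mult_le_cancel_right) auto
      moreover have "w * w > 2 * 2" using w by (intro mult_strict_mono) auto
      ultimately show False by simp
    qed
    have "c2 = e * c1" "d2 = e * d1" using eq unfolding nm by (auto simp: algebra_simps)
    then have "l = k" using Cons.IH[of k a1 b1 c1 d1] Cons.prems l k eq Cons by auto
    then show ?thesis using nm Cons by simp
  qed
qed

section \<open>The Hecke group as a group of words\<close>

abbreviation "Hecke \<equiv> Hecke_group w"
abbreviation "gen_T \<equiv> psl (mat2 1 w 0 1)"
abbreviation "gen_S \<equiv> psl (mat2 0 1 (-1) 0)"

lemma subgroup_Hecke: "subgroup (generate PSL2R {gen_T, gen_S}) PSL2R"
  by (rule group.generate_is_subgroup[OF group_PSL2R]) (auto intro!: psl_closed)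

lemma carrier_Hecke: "carrier Hecke = generate PSL2R {gen_T, gen_S}"
  by (simp add: Hecke_group_def)

lemma carrier_Hecke_PSL2R: "g \<in> carrier Hecke \<Longrightarrow> g \<in> carrier PSL2R"
  using subgroup.subset[OF subgroup_Hecke] by (auto simp: carrier_Hecke)

lemma mult_Hecke [simp]: "x \<otimes>\<^bsub>Hecke\<^esub> y = x \<otimes>\<^bsub>PSL2R\<^esub> y"
  by (simp add: Hecke_group_def)

lemma one_Hecke [simp]: "\<one>\<^bsub>Hecke\<^esub> = \<one>\<^bsub>PSL2R\<^esub>"
  by (simp add: Hecke_group_def)

lemma inv_Hecke: "g \<in> carrier Hecke \<Longrightarrow> inv\<^bsub>Hecke\<^esub> g = inv\<^bsub>PSL2R\<^esub> g"
  using group.m_inv_consistent[OF group_PSL2R subgroup_Hecke] by (simp add: Hecke_group_def)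

sublocale H: hecke_like Hecke gen_T gen_S
proof (intro hecke_like.intro hecke_like_axioms.intro)
  show "group Hecke" unfolding Hecke_group_def
    by (rule subgroup.subgroup_is_group[OF subgroup_Hecke group_PSL2R])
  show "gen_T \<in> carrier Hecke" "gen_S \<in> carrier Hecke"
    by (auto simp: carrier_Hecke intro: generate.incl)
  show "gen_S \<otimes>\<^bsub>Hecke\<^esub> gen_S = \<one>\<^bsub>Hecke\<^esub>"
    unfolding mult_Hecke one_Hecke by (subst psl_mult) (auto simp: mat2_mult psl_one psl_eq_iff)
  show "carrier Hecke = generate Hecke {gen_T, gen_S}"
    unfolding carrier_Hecke unfolding Hecke_group_def
    by (rule group.generate_consistent[OF group_PSL2R _ subgroup_Hecke, symmetric]) (auto intro: generate.incl)
qed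

lemma gen_T_pow: "gen_T [^]\<^bsub>Hecke\<^esub> (n::int) = psl (mat2 1 (n * w) 0 1)"
proof -
  have nat: "gen_T [^]\<^bsub>Hecke\<^esub> (n::nat) = psl (mat2 1 (n * w) 0 1)" for n
  proof (induction n)
    case (Suc n)
    then show ?case by (simp, subst psl_mult) (auto simp: mat2_mult algebra_simps)
  qed (simp add: psl_one)
  show ?thesis
  proof (cases n rule: int_cases2)
    case (nonneg m)
    then show ?thesis using nat[of m] by (simp add: int_pow_int)
  next
    case (nonpos m)
    have "gen_T [^]\<^bsub>Hecke\<^esub> n = inv\<^bsub>Hecke\<^esub> (gen_T [^]\<^bsub>Hecke\<^esub> m)"
      unfolding nonpos using H.int_pow_neg_int[OF H.t, of m] by simp
    also have "\<dots> = inv\<^bsub>PSL2R\<^esub> (psl (mat2 1 (m * w) 0 1))"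
      unfolding nat[symmetric] by (rule inv_Hecke) simp
    also have "\<dots> = psl (mat2 1 (n * w) 0 1)" using nonpos by (subst psl_inv) auto
    finally show ?thesis .
  qed
qed

text \<open>\<open>word_mat\<close> is built with the inverse of the generator \<open>S\<close>; the
  two matrices differ by a sign and agree in the quotient.\<close>

lemma W_conv:
  assumes "word_mat w l = (a, b, c, d)"
  shows "H.W l = psl (mat2 a b c d)"
  using assms
proof (induction l arbitrary: a b c d)
  case Nil
  then show ?case by (auto simp: psl_one)
next
  case (Cons n l)
  obtain a' b' c' d' where l: "word_mat w l = (a', b', c', d')" by (metis prod_cases4)
  have "H.W (n # l) = psl (mat2 1 (n * w) 0 1) \<otimes>\<^bsub>PSL2R\<^esub> gen_S \<otimes>\<^bsub>PSL2R\<^esub> psl (mat2 a' b' c' d')"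
    using Cons.IH[OF l] by (simp add: gen_T_pow)
  also have "psl (mat2 1 (n * w) 0 1) \<otimes>\<^bsub>PSL2R\<^esub> gen_S = psl (mat2 (- n * w) 1 (- 1) 0)"
    by (subst psl_mult) (auto simp: mat2_mult)
  also have "\<dots> = psl (mat2 (n * w) (- 1) 1 0)" by (auto simp: psl_eq_iff)
  also have "\<dots> \<otimes>\<^bsub>PSL2R\<^esub> psl (mat2 a' b' c' d') = psl (mat2 a b c d)"
    using word_mat_det[OF l] Cons.prems l by (subst psl_mult) (auto simp: mat2_mult)
  finally show ?case .
qed

sublocale H: hecke_inj Hecke gen_T gen_S
proof (intro hecke_inj.intro hecke_inj_axioms.intro H.hecke_like_axioms)
  fix l l' assume l: "0 \<notin> set l" "0 \<notin> set l'" "H.W l = H.W l'"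
  obtain a b c d where m: "word_mat w l = (a, b, c, d)" by (metis prod_cases4)
  obtain a' b' c' d' where m': "word_mat w l' = (a', b', c', d')" by (metis prod_cases4)
  have "psl (mat2 a b c d) = psl (mat2 a' b' c' d')" using l(3) W_conv m m' by simp
  then have "word_mat w l' = (1 * a, 1 * b, 1 * c, 1 * d) \<or> word_mat w l' = (-1 * a, -1 * b, -1 * c, -1 * d)"
    unfolding psl_eq_iff m' by auto
  then show "l = l'" using word_mat_inj[OF l(1,2) m, of 1] word_mat_inj[OF l(1,2) m, of "-1"] by auto
qed

text \<open>The inverse word sends \<open>z\<close> to \<open>(d * z - b) / (a - c * z)\<close>, and
  the claim is that it maps the disc of radius \<open>w / 2\<close> into that of radius
  \<open>2 / w\<close>. Clearing denominators suits the induction: the first letter moves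
  \<open>z\<close> to \<open>1 / (n * w - z)\<close>, again a point of the larger disc.\<close>

lemma word_mat_contracts:
  fixes z :: complex
  assumes "word_mat w l = (a, b, c, d)" "l \<in> nz_words" "norm z \<le> w / 2"
  shows "w / 2 * norm (d * z - b) \<le> norm (a - c * z)"
  using assms
proof (induction l arbitrary: a b c d z)
  case Nil
  then show ?case by (simp add: nz_words_def)
next
  case (Cons n l)
  obtain a' b' c' d' where l: "word_mat w l = (a', b', c', d')" by (metis prod_cases4)
  have eq: "a = n * w * a' - c'" "b = n * w * b' - d'" "c = a'" "d = b'" using Cons.prems l by auto
  have n: "n \<noteq> 0" using Cons.prems by (auto simp: nz_words_def)
  define p where "p = complex_of_real (n * w) - z"
  have "w / 2 \<le> norm (complex_of_real (n * w)) - norm z"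
    unfolding norm_of_real using abs_letter[OF n] Cons.prems(3) by linarith
  also have "\<dots> \<le> norm p" unfolding p_def by (rule norm_triangle_ineq2)
  finally have p: "norm p \<ge> w / 2" .
  then have p0: "p \<noteq> 0" using w by auto
  define y where "y = 1 / p"
  have "norm y \<le> 1 / (w / 2)" unfolding y_def norm_divide norm_one
    using p p0 w by (intro divide_left_mono) auto
  then have y: "norm y \<le> 2 / w" by simp
  have "2 / w < 1" using w by simp
  have py: "p * y = 1" using p0 by (simp add: y_def)
  have "p * (a' - c' * y) = a' * p - c' * (p * y)" by (simp add: algebra_simps)
  also have "\<dots> = a - c * z" unfolding py unfolding eq p_def by (simp add: algebra_simps)
  finally have 1: "a - c * z = p * (a' - c' * y)" by (rule sym)
  have "p * (d' * y - b') = d' * (p * y) - b' * p" by (simp add: algebra_simps)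
  also have "\<dots> = d * z - b" unfolding py unfolding eq p_def by (simp add: algebra_simps)
  finally have 2: "d * z - b = p * (d' * y - b')" by (rule sym)
  have "w / 2 * norm (d' * y - b') \<le> norm (a' - c' * y)"
  proof (cases "l = []")
    case True
    then show ?thesis using l y w by (auto simp: field_simps)
  next
    case False
    then have "l \<in> nz_words" using Cons.prems by (auto simp: nz_words_def)
    moreover have "norm y \<le> w / 2" using y w \<open>2 / w < 1\<close> by linarith
    ultimately show ?thesis by (rule Cons.IH[OF l])
  qed
  then have "norm p * (w / 2 * norm (d' * y - b')) \<le> norm p * norm (a' - c' * y)"
    by (intro mult_left_mono) auto
  then show ?case unfolding 1 2 norm_mult by (simp add: mult_ac)
qed

lemma word_mat_denom:
  fixes z :: complex
  assumes "word_mat w l = (a, b, c, d)" "0 \<notin> set l" "norm z \<le> 1"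
  shows "norm (a - c * z) \<ge> \<bar>a\<bar> - \<bar>c\<bar>"
proof -
  have "norm (complex_of_real c * z) \<le> \<bar>c\<bar>" using assms(3) by (simp add: norm_mult mult_left_le)
  then show ?thesis using norm_triangle_ineq2[of "complex_of_real a" "c * z"] by simp
qed

text \<open>The inverse of the word maps the interval \<open>[-1, 1]\<close> into itself; \<open>x\<close> is its fixed point there.\<close>

lemma word_fixed_point:
  assumes l: "word_mat w l = (a, b, c, d)" "l \<in> nz_words"
  obtains x where "\<bar>x\<bar> < 1" "c * x\<^sup>2 + (d - a) * x - b = 0"
    "\<bar>a - c * x\<bar> \<ge> w - 1" "(a - c * x) * (d + c * x) = 1" "a + d = (a - c * x) + 1 / (a - c * x)"
proof -
  have dom: "0 \<notin> set l" "l \<noteq> []" using l by (auto simp: nz_words_def)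
  note D = word_mat_dominant[OF l(1) dom(1)]
  have ac: "\<bar>a\<bar> - \<bar>c\<bar> \<ge> w - 1" using D dom by simp
  have den: "\<bar>a - c * x\<bar> \<ge> w - 1" if "\<bar>x\<bar> \<le> 1" for x
  proof -
    have "\<bar>c * x\<bar> \<le> \<bar>c\<bar>" using that by (simp add: abs_mult mult_left_le)
    then show ?thesis using ac by linarith
  qed
  have con: "\<bar>d * x - b\<bar> < \<bar>a - c * x\<bar>" if "\<bar>x\<bar> \<le> 1" for x
  proof -
    have "w / 2 * norm (complex_of_real d * of_real x - b) \<le> norm (complex_of_real a - complex_of_real c * of_real x)"
      using word_mat_contracts[OF l, of "of_real x"] that w by simp
    then have *: "w / 2 * \<bar>d * x - b\<bar> \<le> \<bar>a - c * x\<bar>"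
      by (simp only: of_real_mult[symmetric] of_real_diff[symmetric] norm_of_real)
    show ?thesis
    proof (cases "d * x - b = 0")
      case True
      then show ?thesis using den[OF that] w by simp
    next
      case False
      then have "1 * \<bar>d * x - b\<bar> < w / 2 * \<bar>d * x - b\<bar>" using w by (intro mult_strict_right_mono) auto
      then show ?thesis using * by simp
    qed
  qed
  have psi: "\<bar>(d * x - b) / (a - c * x)\<bar> < 1" if "\<bar>x\<bar> \<le> 1" for x
    using con[OF that] by (simp add: abs_divide)
  define f where "f = (\<lambda>x. x - (d * x - b) / (a - c * x))"
  \<comment> \<open>The inverse word maps \<open>[-1, 1]\<close> into its interior, so
    \<open>f\<close> changes sign between the end points.\<close>
  have "\<exists>x\<ge>-1. x \<le> 1 \<and> f x = 0"
  proof (rule IVT')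
    show "f (-1) \<le> 0" "0 \<le> f 1" using psi[of "-1"] psi[of 1] unfolding f_def by linarith+
    have "a - c * x \<noteq> 0" if "x \<in> {-1..1}" for x
    proof -
      have "\<bar>x\<bar> \<le> 1" using that by auto
      then show ?thesis using den[of x] w by linarith
    qed
    then show "continuous_on {-1..1} f" unfolding f_def by (intro continuous_intros) auto
  qed simp
  then obtain x where x: "\<bar>x\<bar> \<le> 1" "f x = 0" by (auto simp: abs_le_iff)
  then have fx: "(d * x - b) / (a - c * x) = x" by (simp add: f_def)
  have x1: "\<bar>x\<bar> < 1" using psi[OF x(1)] fx by simp
  have mu: "\<bar>a - c * x\<bar> \<ge> w - 1" using den x by simp
  then have mu0: "a - c * x \<noteq> 0" using w by auto
  have eq: "d * x - b = x * (a - c * x)" using fx mu0 by (simp add: field_simps)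
  then have q: "c * x\<^sup>2 + (d - a) * x - b = 0" by (simp add: algebra_simps power2_eq_square)
  \<comment> \<open>These two factors are the eigenvalues: the vector with entries \<open>x\<close>
    and 1 is an eigenvector of the inverse matrix for \<open>a - c * x\<close>.\<close>
  have "(a - c * x) * (d + c * x) = a * d - c * (x * (c * x + d - a))" by (simp add: algebra_simps)
  also have "x * (c * x + d - a) = b" using eq by (simp add: algebra_simps)
  finally have det: "(a - c * x) * (d + c * x) = 1" using word_mat_det[OF l(1)] by (simp add: mult.commute)
  then have "d + c * x = 1 / (a - c * x)" using mu0 by (simp add: field_simps)
  then have "a + d = (a - c * x) + 1 / (a - c * x)" by linarith
  then show ?thesis using that x1 q mu det by blast
qed

lemma hyperbolic_trace: "\<bar>\<mu>\<bar> > 1 \<Longrightarrow> \<bar>\<mu> + 1 / \<mu>\<bar> > (2::real)"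
proof -
  assume m: "\<bar>\<mu>\<bar> > 1"
  then have "(\<bar>\<mu>\<bar> - 1) * (\<bar>\<mu>\<bar> - 1) > 0" by (intro mult_pos_pos) auto
  then have "\<bar>\<mu>\<bar> * 2 < \<mu> * \<mu> + 1" by (simp add: algebra_simps)
  also have "\<mu> * \<mu> + 1 \<le> \<bar>\<mu> + 1 / \<mu>\<bar> * \<bar>\<mu>\<bar>"
    using m by (simp flip: abs_mult add: distrib_right)
  finally have "\<bar>\<mu>\<bar> * 2 < \<bar>\<mu>\<bar> * \<bar>\<mu> + 1 / \<mu>\<bar>" by (simp add: mult.commute)
  then show ?thesis using m by (subst (asm) mult_less_cancel_left_pos) auto
qed

sublocale H: hecke_hyp Hecke gen_T gen_S hyperbolic
proof (intro hecke_hyp.intro hecke_hyp_axioms.intro H.hecke_inj_axioms)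
  show "hyperbolic y" if "h \<in> carrier Hecke" "y \<in> carrier Hecke"
    "hyperbolic (h \<otimes>\<^bsub>Hecke\<^esub> y \<otimes>\<^bsub>Hecke\<^esub> inv\<^bsub>Hecke\<^esub> h)" for h y
    using that hyperbolic_conj[of h y] by (simp add: inv_Hecke carrier_Hecke_PSL2R)
  show "\<not> hyperbolic (gen_T [^]\<^bsub>Hecke\<^esub> (j::int))" for j
    unfolding gen_T_pow hyperbolic_psl by simp
  show "\<not> hyperbolic gen_S" unfolding hyperbolic_psl by simp
  show "hyperbolic (H.W l)" if l: "l \<in> nz_words" for l
  proof -
    obtain a b c d where m: "word_mat w l = (a, b, c, d)" by (metis prod_cases4)
    obtain x where "\<bar>a - c * x\<bar> \<ge> w - 1" "a + d = (a - c * x) + 1 / (a - c * x)"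
      by (rule word_fixed_point[OF m l]) blast
    then have "\<bar>a + d\<bar> > 2" using hyperbolic_trace[of "a - c * x"] w by simp
    then show ?thesis unfolding W_conv[OF m] hyperbolic_psl .
  qed
qed

end

section \<open>Lengths of closed geodesics\<close>

lemma moebius_mat2: "moebius (mat2 a b c d) z = (a * z + b) / (c * z + d)"
  by (simp add: moebius_def)

lemma moebius_uminus: "moebius (mat2 (-a) (-b) (-c) (-d)) z = moebius (mat2 a b c d) z"
proof -
  have "complex_of_real (-a) * z + complex_of_real (-b) = - (a * z + b)"
    "complex_of_real (-c) * z + complex_of_real (-d) = - (c * z + d)" by (simp_all add: algebra_simps)
  then show ?thesis unfolding moebius_mat2 by (simp only: minus_divide_divide)
qed

lemma moebius_psl:
  "(\<forall>A\<in>psl (mat2 a b c d). \<forall>t. moebius A (f t) = g t) \<longleftrightarrow> (\<forall>t. moebius (mat2 a b c d) (f t) = g t)"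
  by (simp add: psl_mat2 moebius_uminus)

lemma moebius_denom_nonzero:
  assumes "a * d - b * c = (1::real)" "Im z > 0"
  shows "complex_of_real c * z + d \<noteq> 0"
proof
  assume 0: "complex_of_real c * z + d = 0"
  have "c * Im z = Im (complex_of_real c * z + d)" by simp
  also have "\<dots> = 0" unfolding 0 by simp
  finally have "c * Im z = 0" .
  then have "c = 0" using assms by simp
  then show False using 0 assms by auto
qed

lemma Im_moebius:
  assumes "a * d - b * c = (1::real)" "Im z > 0"
  shows "Im (moebius (mat2 a b c d) z) = Im z / (cmod (c * z + d))\<^sup>2"
proof -
  define D where "D = complex_of_real c * z + d"
  have "Im ((a * z + b) * cnj D) = (a * d - b * c) * Im z"
    by (simp add: D_def algebra_simps)
  moreover have "(a * z + b) / D = (a * z + b) * cnj D / (cmod D)\<^sup>2"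
    by (metis complex_div_cnj)
  ultimately show ?thesis using assms(1) unfolding moebius_mat2 D_def[symmetric]
    by (metis Im_divide_of_real mult_1)
qed

lemma Im_moebius_pos:
  assumes "a * d - b * c = (1::real)" "Im z > 0"
  shows "Im (moebius (mat2 a b c d) z) > 0"
  using assms moebius_denom_nonzero[OF assms] by (simp add: Im_moebius)

lemma hyp_dist_moebius:
  assumes "a * d - b * c = (1::real)" "Im z > 0" "Im z' > 0"
  shows "hyp_dist (moebius (mat2 a b c d) z) (moebius (mat2 a b c d) z') = hyp_dist z z'"
proof -
  define D where "D = complex_of_real c * z + d"
  define D' where "D' = complex_of_real c * z' + d"
  have D: "D \<noteq> 0" "D' \<noteq> 0" unfolding D_def D'_def using assms moebius_denom_nonzero by blast+
  have "(a * z + b) * D' - (a * z' + b) * D = complex_of_real (a * d - b * c) * (z - z')"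
    by (simp add: D_def D'_def algebra_simps)
  then have "(a * z + b) * D' - (a * z' + b) * D = z - z'" using assms(1) by simp
  then have "moebius (mat2 a b c d) z - moebius (mat2 a b c d) z' = (z - z') / (D * D')"
    unfolding moebius_mat2 D_def[symmetric] D'_def[symmetric] using D by (simp add: diff_frac_eq)
  then have "(cmod (moebius (mat2 a b c d) z - moebius (mat2 a b c d) z'))\<^sup>2 = (cmod (z - z'))\<^sup>2 / ((cmod D)\<^sup>2 * (cmod D')\<^sup>2)"
    by (simp add: norm_divide norm_mult power_divide power_mult_distrib)
  then show ?thesis unfolding hyp_dist_def Im_moebius[OF assms(1,2)] Im_moebius[OF assms(1,3)] D_def[symmetric] D'_def[symmetric]
    using D by simp
qed

text \<open>The quadratic polynomial in \<open>z\<close> is the fixed point polynomial of the map.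
  It is multiplied by the trace when the map is squared, which is what determines translation
  lengths.\<close>

lemma moebius_displacement:
  assumes "a * d - b * c = (1::real)" "Im z > 0"
  shows "hyp_dist z (moebius (mat2 a b c d) z) = arcosh (1 + (cmod (c * z\<^sup>2 + complex_of_real (d - a) * z - b))\<^sup>2 / (2 * (Im z)\<^sup>2))"
proof -
  define D where "D = complex_of_real c * z + d"
  have D: "D \<noteq> 0" unfolding D_def using assms moebius_denom_nonzero by blast
  have "z - moebius (mat2 a b c d) z = (c * z\<^sup>2 + complex_of_real (d - a) * z - b) / D"
    unfolding moebius_mat2 D_def[symmetric] using D by (simp add: D_def field_simps power2_eq_square)
  then have "(cmod (z - moebius (mat2 a b c d) z))\<^sup>2 = (cmod (c * z\<^sup>2 + complex_of_real (d - a) * z - b))\<^sup>2 / (cmod D)\<^sup>2"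
    by (simp add: norm_divide power_divide)
  then show ?thesis unfolding hyp_dist_def Im_moebius[OF assms] D_def[symmetric]
    using D by (simp add: power2_eq_square mult.assoc)
qed

lemma moebius_compose:
  assumes "a * d - b * c = (1::real)" "a' * d' - b' * c' = (1::real)" "Im z > 0"
  shows "moebius (mat2 a b c d) (moebius (mat2 a' b' c' d') z) = moebius (mat2 a b c d * mat2 a' b' c' d') z"
proof -
  define D where "D = complex_of_real c' * z + d'"
  have D: "D \<noteq> 0" unfolding D_def using assms moebius_denom_nonzero by blast
  have "moebius (mat2 a b c d) (moebius (mat2 a' b' c' d') z) = (a * ((a' * z + b') / D) + b) / (c * ((a' * z + b') / D) + d)"
    unfolding moebius_mat2 D_def ..
  also have "\<dots> = ((a * ((a' * z + b') / D) + b) * D) / ((c * ((a' * z + b') / D) + d) * D)"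
    using D by simp
  also have "(a * ((a' * z + b') / D) + b) * D = a * (a' * z + b') + b * D" using D by (simp add: field_simps)
  also have "(c * ((a' * z + b') / D) + d) * D = c * (a' * z + b') + d * D" using D by (simp add: field_simps)
  also have "(a * (a' * z + b') + b * D) / (c * (a' * z + b') + d * D) = moebius (mat2 a b c d * mat2 a' b' c' d') z"
    unfolding mat2_mult moebius_mat2 D_def by (simp add: algebra_simps)
  finally show ?thesis .
qed

text \<open>A unit vector moves by \<open>cosh l - 1 = u\<close> under \<open>A\<close> and by \<open>t\<^sup>2 u\<close> under \<open>A\<^sup>2 = t A - 1\<close>, where \<open>t\<close>
  is the trace; comparing with the duplication formula for cosh determines \<open>l\<close>.\<close>

lemma translation_length_unique:
  assumes det: "a * d - b * c = (1::real)" and l: "l > 0" and c: "geodesic_line f"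
    and tr: "\<And>t. moebius (mat2 a b c d) (f t) = f (t + l)"
  shows "cosh l = (a + d)\<^sup>2 / 2 - 1"
proof -
  define z where "z = f 0"
  have z: "Im z > 0" using c by (auto simp: geodesic_line_def upper_half_plane_def z_def)
  have d1: "hyp_dist z (f l) = l" and d2: "hyp_dist z (f (2 * l)) = 2 * l"
    using c l by (auto simp: geodesic_line_def z_def)
  have f1: "f l = moebius (mat2 a b c d) z" using tr[of 0] by (simp add: z_def)
  have f2: "f (2 * l) = moebius (mat2 a b c d) (f l)" using tr[of l] by simp
  have f2': "f (2 * l) = moebius (mat2 (a*a + b*c) (a*b + b*d) (c*a + d*c) (c*b + d*d)) z"
    unfolding f2 f1 moebius_compose[OF det det z] mat2_mult ..
  have det2: "(a*a + b*c) * (c*b + d*d) - (a*b + b*d) * (c*a + d*c) = (1::real)"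
  proof -
    have "(a*a + b*c) * (c*b + d*d) - (a*b + b*d) * (c*a + d*c) = (a * d - b * c) * (a * d - b * c)"
      by (simp add: algebra_simps)
    then show ?thesis using det by simp
  qed
  define N where "N = complex_of_real c * z\<^sup>2 + complex_of_real (d - a) * z - b"
  define u where "u = (cmod N)\<^sup>2 / (2 * (Im z)\<^sup>2)"
  have u0: "u \<ge> 0" by (simp add: u_def)
  have "arcosh (1 + u) = l" using d1 unfolding f1 moebius_displacement[OF det z] u_def N_def .
  then have 1: "cosh l = 1 + u" using cosh_arcosh_real[of "1 + u"] u0 by simp
  have "complex_of_real (c*a + d*c) * z\<^sup>2 + complex_of_real ((c*b + d*d) - (a*a + b*c)) * z - complex_of_real (a*b + b*d) = complex_of_real (a + d) * N"
    by (simp add: N_def algebra_simps power2_eq_square)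
  then have "arcosh (1 + (cmod (complex_of_real (a + d) * N))\<^sup>2 / (2 * (Im z)\<^sup>2)) = 2 * l"
    using d2 unfolding f2' moebius_displacement[OF det2 z] by simp
  moreover have "(cmod (complex_of_real (a + d) * N))\<^sup>2 / (2 * (Im z)\<^sup>2) = (a + d)\<^sup>2 * u"
    unfolding u_def norm_mult norm_of_real by (simp add: power_mult_distrib)
  ultimately have "arcosh (1 + (a + d)\<^sup>2 * u) = 2 * l" by simp
  then have 2: "cosh (2 * l) = 1 + (a + d)\<^sup>2 * u" using cosh_arcosh_real[of "1 + (a + d)\<^sup>2 * u"] u0 by simp
  have "2 * (1 + u)\<^sup>2 - 1 = 1 + (a + d)\<^sup>2 * u" using 1 2 by (simp add: cosh_double_cosh)
  then have "u * (2 * u + 4 - (a + d)\<^sup>2) = 0" by (simp add: algebra_simps power2_eq_square)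
  moreover have "u \<noteq> 0"
  proof
    assume "u = 0"
    then have "cosh l = cosh 0" using 1 by simp
    then show False using l cosh_real_strict_mono[of 0 l] by simp
  qed
  ultimately have "2 * u + 4 = (a + d)\<^sup>2" by simp
  then show ?thesis using 1 by simp
qed

text \<open>The columns \<open>(p, r)\<close> and \<open>(q, v)\<close> are eigenvectors for
  \<open>\<mu>\<close> and \<open>1 / \<mu>\<close>, scaled to determinant 1. For
  \<open>c \<noteq> 0\<close> they are proportional to \<open>(x - d, c)\<close> with
  \<open>x\<close> the eigenvalue; for \<open>c = 0\<close> the eigenvalues stand on the
  diagonal.\<close>

lemma hyperbolic_diagonalise:
  fixes a b c d \<mu> :: real
  assumes det: "a * d - b * c = 1" and mu: "\<bar>\<mu>\<bar> > 1" and tr: "a + d = \<mu> + 1 / \<mu>"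
  obtains p q r v where "p * v - q * r = 1" "a * p + b * r = \<mu> * p" "c * p + d * r = \<mu> * r"
    "a * q + b * v = q / \<mu>" "c * q + d * v = v / \<mu>"
proof (cases "c = 0")
  case False
  have mu0: "\<mu> \<noteq> 0" using mu by auto
  have ne: "\<mu> - 1 / \<mu> \<noteq> 0"
  proof
    assume "\<mu> - 1 / \<mu> = 0"
    then have "\<mu> * \<mu> = 1" using mu0 by (simp add: field_simps)
    then have "\<bar>\<mu>\<bar> * \<bar>\<mu>\<bar> = 1" by (simp flip: abs_mult)
    moreover have "1 * 1 < \<bar>\<mu>\<bar> * \<bar>\<mu>\<bar>" using mu by (intro mult_strict_mono) auto
    ultimately show False by simp
  qed
  define k where "k = 1 / (c * (\<mu> - 1 / \<mu>))"
  have k: "k * (c * (\<mu> - 1 / \<mu>)) = 1" using False ne by (simp add: k_def)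
  have r: "x * x - (a + d) * x + 1 = 0" if "x = \<mu> \<or> x = 1 / \<mu>" for x
    using that mu0 unfolding tr by (auto simp: field_simps)
  have e: "a * (x - d) + b * c = x * (x - d)" if "x = \<mu> \<or> x = 1 / \<mu>" for x
    using r[OF that] det by (simp add: algebra_simps)
  show ?thesis
  \<comment> \<open>The instantiation follows the order of occurrence \<open>p\<close>,
    \<open>v\<close>, \<open>q\<close>, \<open>r\<close>; \<open>k\<close> scales the first
    eigenvector so that the determinant is 1.\<close>
  proof (rule that[of "k * (\<mu> - d)" c "1 / \<mu> - d" "k * c"])
    show "k * (\<mu> - d) * c - (1 / \<mu> - d) * (k * c) = 1" using k by (simp add: algebra_simps)
    show "a * (k * (\<mu> - d)) + b * (k * c) = \<mu> * (k * (\<mu> - d))"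
      using arg_cong[OF e[of \<mu>], of "\<lambda>x. k * x"] by (simp add: algebra_simps)
    show "c * (k * (\<mu> - d)) + d * (k * c) = \<mu> * (k * c)" by (simp add: algebra_simps)
    show "a * (1 / \<mu> - d) + b * c = (1 / \<mu> - d) / \<mu>" using e[of "1 / \<mu>"] by simp
    show "c * (1 / \<mu> - d) + d * c = c / \<mu>" by (simp add: algebra_simps)
  qed
next
  case True
  have mu0: "\<mu> \<noteq> 0" using mu by auto
  have ad: "a * d = 1" using det True by simp
  have "(a - \<mu>) * (a - 1 / \<mu>) = a * a - a * (\<mu> + 1 / \<mu>) + 1" using mu0 by (simp add: field_simps)
  also have "\<dots> = 0" unfolding tr[symmetric] using ad by (simp add: algebra_simps)
  finally have cases: "a = \<mu> \<or> a = 1 / \<mu>" by simp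
  have ne: "\<mu> - 1 / \<mu> \<noteq> 0"
  proof
    assume "\<mu> - 1 / \<mu> = 0"
    then have "\<mu> * \<mu> = 1" using mu0 by (simp add: field_simps)
    then have "\<bar>\<mu>\<bar> * \<bar>\<mu>\<bar> = 1" by (simp flip: abs_mult)
    moreover have "1 * 1 < \<bar>\<mu>\<bar> * \<bar>\<mu>\<bar>" using mu by (intro mult_strict_mono) auto
    ultimately show False by simp
  qed
  show ?thesis
  proof (cases "a = \<mu>")
    case a: True
    then have d: "d = 1 / \<mu>" using tr by simp
    have "d - a \<noteq> 0" using a d ne by simp
    then show ?thesis using a d True mu0
      by (intro that[of "1 / (d - a)" "d - a" b 0]) (auto simp: field_simps)
  next
    case False
    then have a: "a = 1 / \<mu>" "d = \<mu>" using cases tr by auto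
    define e where "e = b / (d - a)"
    have "d - a \<noteq> 0" using a ne by simp
    then have "b = (d - a) * e" by (simp add: e_def)
    then show ?thesis using a True mu0
      by (intro that[of "- e" 0 1 "-1"]) (auto simp: algebra_simps)
  qed
qed

text \<open>The axis is the image of the imaginary half-line, parametrised by
  \<open>\<i> * exp t\<close>, under the diagonalising matrix. In these coordinates the map
  multiplies by the square of \<open>\<mu>\<close>, which shifts \<open>t\<close> by
  \<open>2 * ln \<bar>\<mu>\<bar>\<close>.\<close>

lemma translation_axis_exists:
  assumes det: "a * d - b * c = (1::real)" and mu: "\<bar>\<mu>\<bar> > 1" and tr: "a + d = \<mu> + 1 / \<mu>"
  shows "\<exists>f. geodesic_line f \<and> (\<forall>t. moebius (mat2 a b c d) (f t) = f (t + 2 * ln \<bar>\<mu>\<bar>))"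
proof -
  obtain p q r v where P: "p * v - q * r = 1" "a * p + b * r = \<mu> * p" "c * p + d * r = \<mu> * r"
    "a * q + b * v = q / \<mu>" "c * q + d * v = v / \<mu>" using hyperbolic_diagonalise[OF assms] by metis
  have mu0: "\<mu> \<noteq> 0" using mu by auto
  define f where "f = (\<lambda>t::real. moebius (mat2 p q r v) (\<i> * complex_of_real (exp t)))"
  have Im: "Im (\<i> * complex_of_real (exp t)) > 0" for t :: real by (simp add: exp_of_real)
  have "geodesic_line f" unfolding geodesic_line_def
  proof (intro conjI allI)
    show "range f \<subseteq> upper_half_plane"
      using Im_moebius_pos[OF P(1) Im] by (auto simp: f_def upper_half_plane_def)
    fix t u :: real
    have "hyp_dist (f t) (f u) = hyp_dist (\<i> * complex_of_real (exp t)) (\<i> * complex_of_real (exp u))"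
      unfolding f_def by (rule hyp_dist_moebius[OF P(1) Im Im])
    also have "\<dots> = arcosh (cosh (t - u))"
    proof -
      have "\<i> * complex_of_real (exp t) - \<i> * complex_of_real (exp u) = \<i> * of_real (exp t - exp u)" by (simp add: algebra_simps exp_of_real)
      then have "(cmod (\<i> * complex_of_real (exp t) - \<i> * complex_of_real (exp u)))\<^sup>2 = (exp t - exp u)\<^sup>2"
        by (simp only: norm_mult norm_ii norm_of_real mult_1 power2_abs)
      moreover have "Im (\<i> * complex_of_real (exp t)) = exp t" "Im (\<i> * complex_of_real (exp u)) = exp u" by (simp_all add: exp_of_real)
      moreover have "1 + (exp t - exp u)\<^sup>2 / (2 * exp t * exp u) = cosh (t - u)"
        by (simp add: cosh_def exp_diff exp_minus field_simps power2_eq_square)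
      ultimately show ?thesis unfolding hyp_dist_def by simp
    qed
    also have "\<dots> = \<bar>t - u\<bar>"
      by (metis abs_ge_zero arcosh_cosh_real cosh_real_abs)
    finally show "hyp_dist (f t) (f u) = \<bar>t - u\<bar>" .
  qed
  moreover have "moebius (mat2 a b c d) (f t) = f (t + 2 * ln \<bar>\<mu>\<bar>)" for t
  proof -
    define z where "z = \<i> * complex_of_real (exp t)"
    have z: "Im z > 0" by (simp add: z_def)
    have "moebius (mat2 a b c d) (moebius (mat2 p q r v) z) = (\<mu> * p * z + q / \<mu>) / (\<mu> * r * z + v / \<mu>)"
      unfolding moebius_compose[OF det P(1) z] unfolding mat2_mult moebius_mat2 P by simp
    also have "\<dots> = ((\<mu> * p * z + q / \<mu>) * \<mu>) / ((\<mu> * r * z + v / \<mu>) * \<mu>)" using mu0 by simp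
    also have "\<dots> = (p * (\<mu>\<^sup>2 * z) + q) / (r * (\<mu>\<^sup>2 * z) + v)"
      using mu0 by (simp add: algebra_simps power2_eq_square)
    also have "\<dots> = moebius (mat2 p q r v) (\<mu>\<^sup>2 * z)" unfolding moebius_mat2 by simp
    also have "complex_of_real (\<mu>\<^sup>2) * z = \<i> * complex_of_real (exp (t + 2 * ln \<bar>\<mu>\<bar>))"
    proof -
      have "exp (2 * ln \<bar>\<mu>\<bar>) = \<mu>\<^sup>2" using mu0 by (simp add: exp_double flip: exp_of_nat_mult)
      then show ?thesis by (simp add: z_def exp_add mult_ac)
    qed
    finally show ?thesis by (simp add: f_def z_def exp_of_real)
  qed
  ultimately show ?thesis by blast
qed

text \<open>Existence comes from the axis, uniqueness from the trace formula for
  \<open>cosh l\<close> and injectivity of \<open>cosh\<close> on positive numbers; together they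
  evaluate the definite description.\<close>

lemma closed_geodesic_length_psl:
  assumes det: "a * d - b * c = (1::real)" and mu: "\<bar>\<mu>\<bar> > 1" and tr: "a + d = \<mu> + 1 / \<mu>"
  shows "closed_geodesic_length (psl (mat2 a b c d)) = 2 * ln \<bar>\<mu>\<bar>"
  unfolding closed_geodesic_length_def moebius_psl
proof (rule the_equality)
  have l0: "2 * ln \<bar>\<mu>\<bar> > 0" using mu by simp
  show *: "2 * ln \<bar>\<mu>\<bar> > 0 \<and> (\<exists>f. geodesic_line f \<and> (\<forall>t. moebius (mat2 a b c d) (f t) = f (t + 2 * ln \<bar>\<mu>\<bar>)))"
    using translation_axis_exists[OF assms] l0 by blast
  fix l assume l: "l > 0 \<and> (\<exists>f. geodesic_line f \<and> (\<forall>t. moebius (mat2 a b c d) (f t) = f (t + l)))"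
  have "cosh l = cosh (2 * ln \<bar>\<mu>\<bar>)"
    using translation_length_unique[OF det] l * by metis
  then show "l = 2 * ln \<bar>\<mu>\<bar>" using l l0 by (metis arcosh_cosh_real less_imp_le)
qed

text \<open>By Cayley-Hamilton every power is \<open>\<alpha>\<close> times the matrix plus
  \<open>\<beta>\<close> times the identity. Comparing with \<open>\<mu> ^ n\<close> and
  \<open>1 / \<mu> ^ n\<close> at the two eigenvalues gives its trace.\<close>

lemma psl_power_trace:
  assumes det: "a * d - b * c = (1::real)" and mu: "\<mu> \<noteq> 0" and tr: "a + d = \<mu> + 1 / \<mu>"
  shows "\<exists>a' b' c' d'. psl (mat2 a b c d) [^]\<^bsub>PSL2R\<^esub> (n::nat) = psl (mat2 a' b' c' d') \<and>
    a' * d' - b' * c' = 1 \<and> a' + d' = \<mu> ^ n + 1 / \<mu> ^ n"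
proof -
  have A: "mat2 a b c d \<in> carrier SL2R" using det by simp
  have "\<exists>\<alpha> \<beta>. let M = mat2 (\<alpha> * a + \<beta>) (\<alpha> * b) (\<alpha> * c) (\<alpha> * d + \<beta>) in
    psl (mat2 a b c d) [^]\<^bsub>PSL2R\<^esub> n = psl M \<and> M \<in> carrier SL2R \<and> \<alpha> * \<mu> + \<beta> = \<mu> ^ n \<and> \<alpha> / \<mu> + \<beta> = 1 / \<mu> ^ n"
  proof (induction n)
    case 0
    show ?case
      by (rule exI[of _ 0], rule exI[of _ 1]) (simp add: psl_one[symmetric])
  next
    case (Suc n)
    then obtain \<alpha> \<beta> where IH: "psl (mat2 a b c d) [^]\<^bsub>PSL2R\<^esub> n = psl (mat2 (\<alpha> * a + \<beta>) (\<alpha> * b) (\<alpha> * c) (\<alpha> * d + \<beta>))"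
      "mat2 (\<alpha> * a + \<beta>) (\<alpha> * b) (\<alpha> * c) (\<alpha> * d + \<beta>) \<in> carrier SL2R" "\<alpha> * \<mu> + \<beta> = \<mu> ^ n" "\<alpha> / \<mu> + \<beta> = 1 / \<mu> ^ n"
      by (auto simp: Let_def)
    define \<alpha>' where "\<alpha>' = \<alpha> * (a + d) + \<beta>"
    have bc: "b * c = a * d - 1" using det by simp
    have M: "mat2 (\<alpha> * a + \<beta>) (\<alpha> * b) (\<alpha> * c) (\<alpha> * d + \<beta>) * mat2 a b c d
       = mat2 (\<alpha>' * a + - \<alpha>) (\<alpha>' * b) (\<alpha>' * c) (\<alpha>' * d + - \<alpha>)"
      unfolding mat2_mult mat2_eq_iff \<alpha>'_def using arg_cong[OF bc, of "\<lambda>x. \<alpha> * x"] by (simp add: algebra_simps)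
    have cl: "mat2 (\<alpha> * a + \<beta>) (\<alpha> * b) (\<alpha> * c) (\<alpha> * d + \<beta>) * mat2 a b c d \<in> carrier SL2R"
      using monoid.m_closed[OF group.is_monoid[OF group_SL2R] IH(2) A] by simp
    have "psl (mat2 a b c d) [^]\<^bsub>PSL2R\<^esub> Suc n = psl (mat2 (\<alpha> * a + \<beta>) (\<alpha> * b) (\<alpha> * c) (\<alpha> * d + \<beta>) * mat2 a b c d)"
      using psl_mult[OF IH(2) A] IH(1) by simp
    moreover have "\<alpha>' * \<mu> + - \<alpha> = \<mu> ^ Suc n"
      unfolding \<alpha>'_def tr using arg_cong[OF IH(3), of "\<lambda>x. \<mu> * x"] mu by (simp add: field_simps)
    moreover have "\<alpha>' / \<mu> + - \<alpha> = 1 / \<mu> ^ Suc n"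
    proof -
      have "\<alpha>' / \<mu> + - \<alpha> = (\<alpha> / \<mu> + \<beta>) / \<mu>" unfolding \<alpha>'_def tr using mu by (simp add: field_simps)
      then show ?thesis using IH(4) by simp
    qed
    ultimately show ?case using cl unfolding M Let_def
      by (intro exI[of _ \<alpha>'] exI[of _ "- \<alpha>"]) simp
  qed
  then obtain \<alpha> \<beta> where *: "psl (mat2 a b c d) [^]\<^bsub>PSL2R\<^esub> n = psl (mat2 (\<alpha> * a + \<beta>) (\<alpha> * b) (\<alpha> * c) (\<alpha> * d + \<beta>))"
      "mat2 (\<alpha> * a + \<beta>) (\<alpha> * b) (\<alpha> * c) (\<alpha> * d + \<beta>) \<in> carrier SL2R" "\<alpha> * \<mu> + \<beta> = \<mu> ^ n" "\<alpha> / \<mu> + \<beta> = 1 / \<mu> ^ n"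
    by (auto simp: Let_def)
  have "\<alpha> * a + \<beta> + (\<alpha> * d + \<beta>) = \<alpha> * (a + d) + 2 * \<beta>" by (simp add: algebra_simps)
  also have "\<dots> = (\<alpha> * \<mu> + \<beta>) + (\<alpha> / \<mu> + \<beta>)" unfolding tr by (simp add: algebra_simps)
  also have "\<dots> = \<mu> ^ n + 1 / \<mu> ^ n" unfolding * ..
  finally have "\<alpha> * a + \<beta> + (\<alpha> * d + \<beta>) = \<mu> ^ n + 1 / \<mu> ^ n" .
  moreover have "(\<alpha> * a + \<beta>) * (\<alpha> * d + \<beta>) - (\<alpha> * b) * (\<alpha> * c) = 1" using *(2) by simp
  ultimately show ?thesis using *(1) by blast
qed

context hecke_parameter
begin

section \<open>Lengths attached to words and to conjugacy classes\<close>

definition word_length :: "int list \<Rightarrow> real" where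
  "word_length l = closed_geodesic_length (H.W l)"

lemma word_length_fixed_point:
  assumes l: "word_mat w l = (a, b, c, d)" "l \<in> nz_words"
  obtains x where "\<bar>x\<bar> < 1" "c * x\<^sup>2 + (d - a) * x - b = 0" "\<bar>a - c * x\<bar> \<ge> w - 1"
    "(a - c * x) * (d + c * x) = 1" "a + d = (a - c * x) + 1 / (a - c * x)"
    "word_length l = 2 * ln \<bar>a - c * x\<bar>"
proof -
  obtain x where x: "\<bar>x\<bar> < 1" "c * x\<^sup>2 + (d - a) * x - b = 0"
    "\<bar>a - c * x\<bar> \<ge> w - 1" "(a - c * x) * (d + c * x) = 1" "a + d = (a - c * x) + 1 / (a - c * x)"
    using word_fixed_point[OF l] by metis
  moreover have "word_length l = 2 * ln \<bar>a - c * x\<bar>"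
    unfolding word_length_def W_conv[OF l(1)]
    by (rule closed_geodesic_length_psl) (use word_mat_det[OF l(1)] x w in auto)
  ultimately show ?thesis using that by blast
qed

lemma word_length_ge:
  assumes "l \<in> nz_words"
  shows "word_length l \<ge> 2 * ln (w - 1)"
proof -
  obtain a b c d where m: "word_mat w l = (a, b, c, d)" by (metis prod_cases4)
  obtain x where "\<bar>a - c * x\<bar> \<ge> w - 1" "word_length l = 2 * ln \<bar>a - c * x\<bar>"
    by (rule word_length_fixed_point[OF m assms]) blast
  then show ?thesis using w by simp
qed

lemma word_length_pos: "l \<in> nz_words \<Longrightarrow> word_length l > 0"
  using word_length_ge[of l] w ln_gt_zero[of "w - 1"] by linarith

lemma word_length_power:
  assumes u: "u \<in> nz_words" and n: "n > 0"
  shows "word_length (word_power n u) = n * word_length u"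
proof -
  obtain a b c d where m: "word_mat w u = (a, b, c, d)" by (metis prod_cases4)
  obtain x where x: "\<bar>a - c * x\<bar> \<ge> w - 1" "a + d = (a - c * x) + 1 / (a - c * x)" "word_length u = 2 * ln \<bar>a - c * x\<bar>"
    by (rule word_length_fixed_point[OF m u]) blast
  define \<mu> where "\<mu> = a - c * x"
  have mu: "\<bar>\<mu>\<bar> > 1" using x w by (simp add: \<mu>_def)
  have "\<mu> \<noteq> 0" using mu by auto
  have "H.W u [^]\<^bsub>Hecke\<^esub> k = H.W u [^]\<^bsub>PSL2R\<^esub> k" for k :: nat
    by (simp add: nat_pow_def)
  then have W: "H.W (word_power n u) = psl (mat2 a b c d) [^]\<^bsub>PSL2R\<^esub> n"
    unfolding H.W_power W_conv[OF m] by simp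
  obtain a' b' c' d' where p: "psl (mat2 a b c d) [^]\<^bsub>PSL2R\<^esub> n = psl (mat2 a' b' c' d')"
    "a' * d' - b' * c' = 1" "a' + d' = \<mu> ^ n + 1 / \<mu> ^ n"
    using psl_power_trace[OF word_mat_det[OF m] \<open>\<mu> \<noteq> 0\<close>, of n] x unfolding \<mu>_def by metis
  have "\<bar>\<mu> ^ n\<bar> > 1" unfolding power_abs using mu n by (intro one_less_power) auto
  then have "word_length (word_power n u) = 2 * ln \<bar>\<mu> ^ n\<bar>"
    unfolding word_length_def W p(1) using p by (intro closed_geodesic_length_psl) auto
  also have "\<dots> = n * (2 * ln \<bar>\<mu>\<bar>)" using mu by (simp add: power_abs ln_realpow)
  finally show ?thesis using x by (simp add: \<mu>_def)
qed

text \<open>The representative picked by \<open>SOME\<close> is conjugate to \<open>H.W u\<close>,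
  and the length is determined by the trace.\<close>

lemma class_length_eq:
  assumes u: "u \<in> nz_words"
  shows "class_length (conjugacy_class Hecke (H.W u)) = word_length u"
proof -
  define g where "g = (SOME g. g \<in> conjugacy_class Hecke (H.W u))"
  have "H.W u \<in> conjugacy_class Hecke (H.W u)"
    unfolding H.conjugacy_class_conv using H.conj_refl[of "H.W u"] by simp
  then have "g \<in> conjugacy_class Hecke (H.W u)" unfolding g_def by (rule someI)
  then obtain h where h: "h \<in> carrier Hecke" "g = h \<otimes>\<^bsub>PSL2R\<^esub> H.W u \<otimes>\<^bsub>PSL2R\<^esub> inv\<^bsub>PSL2R\<^esub> h"
    by (auto simp: conjugacy_class_def inv_Hecke)
  obtain a b c d where m: "word_mat w u = (a, b, c, d)" by (metis prod_cases4)
  obtain x where x: "\<bar>a - c * x\<bar> \<ge> w - 1" "a + d = (a - c * x) + 1 / (a - c * x)" "word_length u = 2 * ln \<bar>a - c * x\<bar>"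
    by (rule word_length_fixed_point[OF m u]) blast
  obtain a' b' c' d' where g: "g = psl (mat2 a' b' c' d')" "a' * d' - b' * c' = 1" "a' + d' = a + d"
    using psl_conj_trace[OF carrier_Hecke_PSL2R[OF h(1)] word_mat_det[OF m]] h(2) unfolding W_conv[OF m] by metis
  have "closed_geodesic_length g = 2 * ln \<bar>a - c * x\<bar>"
    unfolding g(1) using g x w by (intro closed_geodesic_length_psl) auto
  then show ?thesis unfolding class_length_def g_def[symmetric] x(3) .
qed

end

section \<open>Estimates for the matrix entries\<close>

text \<open>The coefficient of \<open>y ^ i\<close> in \<open>(1 - y) powr (- x)\<close>. In this
  parametrisation all factors are nonnegative for \<open>x \<ge> 0\<close>, so the coefficients are
  monotone in \<open>x\<close> and absolute values pass inside.\<close>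

definition rising_binomial :: "'a::field_char_0 \<Rightarrow> nat \<Rightarrow> 'a" where
  "rising_binomial x i = pochhammer x i / fact i"

lemma gbinomial_conv_rising: "(x + of_nat i - 1) gchoose i = rising_binomial x i"
  by (simp add: rising_binomial_def gbinomial_pochhammer')

lemma rising_binomial_nonneg: "(x::real) \<ge> 0 \<Longrightarrow> rising_binomial x i \<ge> 0"
  unfolding rising_binomial_def pochhammer_prod by (auto intro!: divide_nonneg_nonneg prod_nonneg)

lemma rising_binomial_mono: "0 \<le> (x::real) \<Longrightarrow> x \<le> y \<Longrightarrow> rising_binomial x i \<le> rising_binomial y i"
  unfolding rising_binomial_def pochhammer_prod by (auto intro!: divide_right_mono prod_mono)

lemma norm_rising_binomial_le: "norm (z::complex) \<le> x \<Longrightarrow> norm (rising_binomial z i) \<le> rising_binomial x i"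
  unfolding rising_binomial_def pochhammer_prod norm_divide
  by (auto simp: prod_norm[symmetric] norm_fact intro!: divide_right_mono prod_mono norm_triangle_le)

text \<open>The exponent \<open>p + i - 1\<close> rather than \<open>p + i\<close> matters: the
  saved factor 2 compensates the factor 2 in \<open>L_entry\<close>.\<close>

lemma rising_binomial_le_power2:
  assumes "p + i \<ge> 1"
  shows "rising_binomial (real p) i \<le> 2 ^ (p + i - 1)"
proof -
  have "rising_binomial (real p) i = real (p + i - 1) gchoose i"
    using assms gbinomial_conv_rising[of "real p" i] by (simp add: of_nat_diff)
  also have "\<dots> = real ((p + i - 1) choose i)" by (simp add: binomial_gbinomial)
  also have "\<dots> \<le> real (2 ^ (p + i - 1))" using binomial_le_pow2 of_nat_le_iff by blast
  finally show ?thesis by simp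
qed

lemma rising_binomial_sums:
  fixes a y :: real
  assumes "\<bar>y\<bar> < 1"
  shows "(\<lambda>i. rising_binomial a i * y ^ i) sums (1 - y) powr (- a)"
proof -
  have "(\<lambda>i. ((- a) gchoose i) * (- y) ^ i) sums (1 + (- y)) powr (- a)"
    using assms by (intro gen_binomial_real) auto
  moreover have "((- a) gchoose i) * (- y) ^ i = rising_binomial a i * y ^ i" for i
    unfolding gbinomial_minus gbinomial_conv_rising by (simp add: power_minus')
  ultimately show ?thesis by simp
qed

text \<open>The majorant is twice the series of \<open>(1 - x) powr (- 3)\<close>: its coefficients
  \<open>(k + 1) * (k + 2) / 2\<close>, doubled, dominate the square of \<open>k + 1\<close>, which
  covers all orders down to \<open>- 2\<close>.\<close>

lemma polylog_summable:
  fixes x :: real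
  assumes x: "0 \<le> x" "x < 1" and \<nu>: "- 2 \<le> \<nu>"
  shows "summable (\<lambda>k. x ^ Suc k / real (Suc k) powr \<nu>)"
proof (rule summable_comparison_test')
  have "summable (\<lambda>i. rising_binomial 3 i * x ^ i)"
    using rising_binomial_sums[of x 3] x by (auto simp: sums_iff)
  then show "summable (\<lambda>i. 2 * x * (rising_binomial 3 i * x ^ i))" by (rule summable_mult)
  fix k
  have "rising_binomial (3::real) k = real (k + 2) gchoose k"
    using gbinomial_conv_rising[of "3::real" k] by (simp add: algebra_simps)
  also have "\<dots> = real ((k + 2) choose 2)"
    using binomial_symmetric[of 2 "k + 2"] by (simp add: binomial_gbinomial)
  also have "\<dots> = real (k + 2) * real (k + 1) / 2"
    by (induction k) (simp_all add: numeral_2_eq_2 field_simps)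
  finally have r: "rising_binomial (3::real) k = real (k + 2) * real (k + 1) / 2" .
  have "real (Suc k) powr (- \<nu>) \<le> real (Suc k) powr 2" using \<nu> by (intro powr_mono) auto
  also have "\<dots> = real (Suc k) ^ 2" by (simp flip: powr_numeral)
  also have "\<dots> \<le> 2 * rising_binomial 3 k" unfolding r power2_eq_square by (simp add: algebra_simps)
  finally have "x ^ Suc k * real (Suc k) powr (- \<nu>) \<le> x ^ Suc k * (2 * rising_binomial 3 k)"
    using x by (intro mult_left_mono) auto
  moreover have "norm (x ^ Suc k / real (Suc k) powr \<nu>) = x ^ Suc k * real (Suc k) powr (- \<nu>)"
    using x by (simp add: powr_minus field_simps abs_mult)
  ultimately show "norm (x ^ Suc k / real (Suc k) powr \<nu>) \<le> 2 * x * (rising_binomial 3 k * x ^ k)"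
    by (simp add: mult_ac)
qed

lemma polylog_half_sums:
  fixes x :: real
  assumes "0 \<le> x" "x < 1"
  shows "(\<lambda>k. sqrt (real (Suc k)) * x ^ Suc k) sums polylog (- 1 / 2) x"
proof -
  have "x ^ Suc k / real (Suc k) powr (- 1 / 2) = sqrt (real (Suc k)) * x ^ Suc k" for k
    using powr_minus_divide[of "real (Suc k)" "1 / 2"] by (simp add: powr_half_sqrt)
  then show ?thesis using summable_sums[OF polylog_summable[of x "- 1 / 2"]] assms by (simp add: polylog_def)
qed

lemma polylog_mono:
  fixes x :: real
  assumes "0 \<le> x" "x < 1" "- 2 \<le> \<mu>" "\<mu> \<le> \<nu>"
  shows "polylog \<nu> x \<le> polylog \<mu> x"
  unfolding polylog_def using assms
  by (intro suminf_le polylog_summable) (auto intro!: divide_left_mono powr_mono)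

lemma polylog_nonneg: "0 \<le> x \<Longrightarrow> x < 1 \<Longrightarrow> - 2 \<le> \<nu> \<Longrightarrow> polylog \<nu> x \<ge> 0"
  unfolding polylog_def by (intro suminf_nonneg polylog_summable) auto

context hecke_parameter
begin

lemma powr_neg_nat_add: "w powr (- (real i + real j)) = (1 / w) ^ i * (1 / w) ^ j"
proof -
  have "w powr (- (real i + real j)) = w powr (- real i) * w powr (- real j)" by (simp flip: powr_add)
  moreover have "w powr (- real k) = (1 / w) ^ k" for k
    using w by (simp add: powr_minus powr_realpow power_one_over inverse_eq_divide)
  ultimately show ?thesis by simp
qed

text \<open>What is left of an entry without the factor 2, the zeta value and
  \<open>w powr (- 2 * s)\<close>. It is a majorant for complex \<open>s\<close>, with
  \<open>x = 2 * norm s\<close>, and exact for real \<open>s \<ge> 1\<close>, with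
  \<open>x = 2 * s\<close>.\<close>

definition entry_bound :: "real \<Rightarrow> nat \<Rightarrow> nat \<Rightarrow> real" where
  "entry_bound x i j = sqrt ((real j + 1) / (real i + 1)) * w powr (- (real i + real j)) * rising_binomial (x + real j) i"

lemma entry_bound_nonneg: "x \<ge> 0 \<Longrightarrow> entry_bound x i j \<ge> 0"
  unfolding entry_bound_def by (auto intro!: mult_nonneg_nonneg rising_binomial_nonneg)

definition entry_bound_total :: "real \<Rightarrow> real" where
  "entry_bound_total x = (w / (w - 1)) powr x * ((w - 1) * polylog (- 1 / 2) (1 / (w - 1)))"

text \<open>For fixed \<open>j\<close>, with \<open>i + j\<close> split and
  \<open>1 / (i + 1)\<close> bounded by 1, the sum over \<open>i\<close> is a binomial series at
  \<open>1 / w\<close> with value \<open>(w / (w - 1)) powr (x + j)\<close>. It changes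
  \<open>w ^ (- j)\<close> into \<open>(w - 1) ^ (- j)\<close>, and the sum over \<open>j\<close> is
  a polylogarithm.\<close>

lemma entry_bound_summable:
  assumes x: "x \<ge> 0"
  shows "(\<lambda>(i, j). entry_bound x i j) summable_on UNIV \<times> UNIV"
    "(\<Sum>\<^sub>\<infinity>(i, j)\<in>UNIV \<times> UNIV. entry_bound x i j) \<le> entry_bound_total x"
proof -
  define f where "f = (\<lambda>(j, i). entry_bound x i j)"
  define g where "g = (\<lambda>j. (w / (w - 1)) powr x * (sqrt (real (Suc j)) * (1 / (w - 1)) ^ j))"
  have "(\<lambda>j. (w / (w - 1)) powr x * (w - 1) * (sqrt (real (Suc j)) * (1 / (w - 1)) ^ Suc j)) sums
    ((w / (w - 1)) powr x * (w - 1) * polylog (- 1 / 2) (1 / (w - 1)))"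
    using w by (intro sums_mult polylog_half_sums) auto
  moreover have "(w / (w - 1)) powr x * (w - 1) * (sqrt (real (Suc j)) * (1 / (w - 1)) ^ Suc j) = g j" for j
    unfolding g_def using w by (simp add: field_simps)
  ultimately have "g sums entry_bound_total x" by (simp add: entry_bound_total_def mult_ac)
  then have gs: "(g has_sum entry_bound_total x) UNIV"
    using w by (intro sums_nonneg_imp_has_sum) (auto simp: g_def)
  have inner: "(\<lambda>i. f (j, i)) summable_on UNIV \<and> (\<Sum>\<^sub>\<infinity>i. f (j, i)) \<le> g j" for j
  proof -
    define c where "c = sqrt (real (Suc j)) * w powr (- real j)"
    define h where "h = (\<lambda>i. c * (rising_binomial (x + real j) i * (1 / w) ^ i))"
    have "(\<lambda>i. rising_binomial (x + real j) i * (1 / w) ^ i) sums (1 - 1 / w) powr (- (x + real j))"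
      using w by (intro rising_binomial_sums) auto
    then have "h sums (c * (1 - 1 / w) powr (- (x + real j)))" unfolding h_def by (rule sums_mult)
    moreover have "c * (1 - 1 / w) powr (- (x + real j)) = g j"
    proof -
      have eq: "1 - 1 / w = (w / (w - 1)) powr (- 1)" using w by (simp add: powr_minus field_simps)
      have "(1 - 1 / w) powr (- (x + real j)) = (w / (w - 1)) powr (x + real j)"
        unfolding eq powr_powr by (simp add: add.commute)
      also have "\<dots> = (w / (w - 1)) powr x * (w ^ j / (w - 1) ^ j)"
        using w by (simp add: powr_add powr_realpow power_divide)
      finally show ?thesis unfolding c_def g_def using w
        by (simp add: powr_minus powr_realpow power_divide field_simps)
    qed
    ultimately have hs: "(h has_sum g j) UNIV"
      using x w by (intro sums_nonneg_imp_has_sum) (auto simp: h_def c_def intro!: mult_nonneg_nonneg rising_binomial_nonneg)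
    have le: "f (j, i) \<le> h i" for i
    proof -
      have "sqrt ((real j + 1) / (real i + 1)) \<le> sqrt (real (Suc j))"
        by (intro real_sqrt_le_mono) (simp add: field_simps)
      then have "f (j, i) \<le> sqrt (real (Suc j)) * w powr (- (real i + real j)) * rising_binomial (x + real j) i"
        unfolding f_def entry_bound_def case_prod_conv using x by (intro mult_right_mono rising_binomial_nonneg) auto
      also have "w powr (- (real i + real j)) = w powr (- real j) * (1 / w) ^ i"
        using powr_neg_nat_add[of i j] powr_neg_nat_add[of 0 j] by simp
      finally show ?thesis by (simp add: h_def c_def mult_ac)
    qed
    have f0: "f (j, i) \<ge> 0" for i using x by (simp add: f_def entry_bound_nonneg)
    have fs: "(\<lambda>i. f (j, i)) summable_on UNIV"
      by (rule summable_on_comparison_test[OF has_sum_imp_summable[OF hs]]) (use le f0 in auto)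
    have "(\<Sum>\<^sub>\<infinity>i. f (j, i)) \<le> infsum h UNIV"
      by (rule infsum_mono[OF fs has_sum_imp_summable[OF hs] le])
    then show ?thesis using fs hs by (simp add: infsumI)
  qed
  have f0: "f (j, i) \<ge> 0" for j i using x by (simp add: f_def entry_bound_nonneg)
  note S = summable_on_Sigma_bound[of UNIV "\<lambda>_. UNIV" f g, OF f0 inner[THEN conjunct1] inner[THEN conjunct2] has_sum_imp_summable[OF gs]]
  have bij: "bij_betw prod.swap ((UNIV::nat set) \<times> (UNIV::nat set)) (UNIV \<times> UNIV)"
    by (auto simp: bij_betw_def inj_on_def)
  show "(\<lambda>(i, j). entry_bound x i j) summable_on UNIV \<times> UNIV"
    using S(1) summable_on_reindex_bij_betw[OF bij, of "\<lambda>(i, j). entry_bound x i j"] by (simp add: f_def case_prod_unfold)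
  show "(\<Sum>\<^sub>\<infinity>(i, j)\<in>UNIV \<times> UNIV. entry_bound x i j) \<le> entry_bound_total x"
    using S(2) infsum_reindex_bij_betw[OF bij, of "\<lambda>(i, j). entry_bound x i j"] infsumI[OF gs]
    by (simp add: f_def case_prod_unfold)
qed

lemma sum_entry_bound_le:
  assumes "x \<ge> 0"
  shows "(\<Sum>i<M. \<Sum>j<M'. entry_bound x i j) \<le> entry_bound_total x"
proof -
  have "(\<Sum>i<M. \<Sum>j<M'. entry_bound x i j) = (\<Sum>(i, j)\<in>{..<M} \<times> {..<M'}. entry_bound x i j)"
    by (rule sum.cartesian_product)
  also have "\<dots> \<le> (\<Sum>\<^sub>\<infinity>(i, j)\<in>UNIV \<times> UNIV. entry_bound x i j)"
    using entry_bound_summable(1)[OF assms] entry_bound_nonneg[OF assms] by (intro finite_sum_le_infsum) auto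
  finally show ?thesis using entry_bound_summable(2)[OF assms] by simp
qed

end

section \<open>The supremum of the zeta values\<close>

text \<open>The excluded points are exactly those where some \<open>2 * s + n\<close> with even
  \<open>n\<close> hits the pole of zeta; for odd \<open>n\<close> the corresponding entries vanish
  by definition.\<close>

lemma zeta_domain_even: "s \<in> zeta_domain \<Longrightarrow> even n \<Longrightarrow> 2 * s + of_nat n \<noteq> 1"
proof
  assume s: "s \<in> zeta_domain" "even n" "2 * s + of_nat n = 1"
  then obtain k where "n = 2 * k" by blast
  then have "s = (1 - 2 * of_nat k) / 2" using s(3) by (simp add: field_simps)
  then show False using s(1) by (auto simp: zeta_domain_def)
qed

text \<open>The excluded set is the preimage of the natural numbers under the affine involution
  taking \<open>z\<close> to \<open>(1 - 2 * z) / 2\<close>.\<close>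

lemma open_zeta_domain: "open zeta_domain"
proof -
  have "{(1 - 2 * of_nat n) / 2 | n :: nat. True} = (\<lambda>z. (1 - 2 * z) / 2) -` (\<nat> :: complex set)"
  proof (intro equalityI subsetI)
    fix z assume "z \<in> (\<lambda>z. (1 - 2 * z) / 2) -` (\<nat> :: complex set)"
    then obtain n where "(1 - 2 * z) / 2 = of_nat n" by (auto simp: Nats_def)
    then have "z = (1 - 2 * of_nat n) / 2" by (simp add: field_simps)
    then show "z \<in> {(1 - 2 * of_nat n) / 2 | n :: nat. True}" by blast
  qed (auto simp: Nats_def field_simps)
  moreover have "closed (\<nat> :: complex set)" by (rule closed_subset_Ints) (auto simp: Nats_subset_Ints)
  then have "closed ((\<lambda>z. (1 - 2 * z) / 2) -` (\<nat> :: complex set))"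
    by (intro continuous_closed_vimage continuous_intros) auto
  ultimately show ?thesis by (simp add: zeta_domain_def open_closed)
qed

lemma Re_gt_half_zeta_domain: "Re s > 1 / 2 \<Longrightarrow> s \<in> zeta_domain"
proof (rule ccontr)
  assume "Re s > 1 / 2" "s \<notin> zeta_domain"
  then obtain n :: nat where "s = (1 - 2 * of_nat n) / 2" by (auto simp: zeta_domain_def)
  then have "Re s = Re ((1 - 2 * complex_of_nat n) / 2)" by (rule arg_cong)
  also have "\<dots> = (1 - 2 * real n) / 2" by simp
  finally show False using \<open>Re s > 1 / 2\<close> by simp
qed

lemma norm_zeta_le:
  assumes "Re z \<ge> 2"
  shows "norm (Riemann_zeta z) \<le> (\<Sum>n. 1 / real (Suc n) ^ 2)"
proof -
  have s2: "summable (\<lambda>n. 1 / real (Suc n) ^ 2)"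
    using inverse_power_summable[of 2, where ?'a = real] by (subst summable_Suc_iff[of "\<lambda>n. 1 / real n ^ 2"]) (simp add: field_simps)
  have le: "norm (1 / of_nat (Suc n) powr z) \<le> 1 / real (Suc n) ^ 2" for n
  proof -
    have "real (Suc n) ^ 2 = real (Suc n) powr 2" by (simp flip: powr_numeral)
    also have "\<dots> \<le> real (Suc n) powr Re z" using assms by (intro powr_mono) auto
    also have "\<dots> = norm (of_nat (Suc n) powr z :: complex)" by (rule norm_of_nat_powr[symmetric]) simp
    finally have "real (Suc n) ^ 2 \<le> norm (of_nat (Suc n) powr z :: complex)" .
    then show ?thesis unfolding norm_divide norm_one by (intro divide_left_mono) (auto simp: zero_less_norm_iff intro!: mult_pos_pos)
  qed
  have "Riemann_zeta z = (\<Sum>n. 1 / of_nat (Suc n) powr z)"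
    using Riemann_zeta_sums[of z] assms by (simp add: sums_iff)
  then show ?thesis using norm_suminf_le[OF le s2] by simp
qed

text \<open>For \<open>n \<ge> 2 + 2 * r\<close> the arguments lie in \<open>Re z \<ge> 2\<close>,
  where zeta is bounded; the finitely many smaller \<open>n\<close> are handled by
  compactness.\<close>

lemma zeta_shift_bounded:
  assumes K: "compact K" "K \<subseteq> zeta_domain"
  obtains B where "\<And>s n. s \<in> K \<Longrightarrow> even n \<Longrightarrow> norm (Riemann_zeta (2 * s + of_nat n)) \<le> B"
proof -
  obtain r where r: "\<And>s. s \<in> K \<Longrightarrow> norm s \<le> r" using compact_imp_bounded[OF K(1)] by (auto simp: bounded_iff)
  define n0 where "n0 = nat \<lceil>2 + 2 * r\<rceil>"
  have "\<exists>b. \<forall>s\<in>K. even n \<longrightarrow> norm (Riemann_zeta (2 * s + of_nat n)) \<le> b" for n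
  proof (cases "even n")
    case True
    have "continuous_on K (\<lambda>s. Riemann_zeta (2 * s + of_nat n))"
    proof (rule continuous_on_compose2[OF holomorphic_on_imp_continuous_on[OF Riemann_zeta_analytic]])
      show "(\<lambda>s. 2 * s + of_nat n) ` K \<subseteq> - {1}" using zeta_domain_even True K by auto
    qed (intro continuous_intros)
    then have "compact ((\<lambda>s. Riemann_zeta (2 * s + of_nat n)) ` K)" using K compact_continuous_image by blast
    then show ?thesis using compact_imp_bounded by (fastforce simp: bounded_iff)
  qed auto
  then obtain b where b: "\<And>n s. s \<in> K \<Longrightarrow> even n \<Longrightarrow> norm (Riemann_zeta (2 * s + of_nat n)) \<le> b n" by metis
  define B where "B = (\<Sum>n<n0. \<bar>b n\<bar>) + (\<Sum>n. 1 / real (Suc n) ^ 2)"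
  have z0: "(\<Sum>n. 1 / real (Suc n) ^ 2) \<ge> 0"
    using norm_zeta_le[of 2] norm_ge_zero order_trans by (metis Re_complex_of_real of_real_numeral order_refl)
  show ?thesis
  proof (rule that[of B])
    fix s and n :: nat assume s: "s \<in> K" "even n"
    show "norm (Riemann_zeta (2 * s + of_nat n)) \<le> B"
    proof (cases "n < n0")
      case True
      have "norm (Riemann_zeta (2 * s + of_nat n)) \<le> \<bar>b n\<bar>" using b[OF s] by linarith
      also have "\<bar>b n\<bar> \<le> (\<Sum>n<n0. \<bar>b n\<bar>)" using True by (intro member_le_sum) auto
      finally show ?thesis using z0 by (simp add: B_def)
    next
      case False
      then have "real n \<ge> 2 + 2 * r" unfolding n0_def by linarith
      then have "Re (2 * s + of_nat n) \<ge> 2" using r[OF s(1)] abs_Re_le_cmod[of s] by simp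
      from norm_zeta_le[OF this] show ?thesis unfolding B_def using sum_nonneg[of "{..<n0}" "\<lambda>n. \<bar>b n\<bar>"] by linarith
    qed
  qed
qed

text \<open>A real supremum is an upper bound only for a set that is bounded above, which the bound
  on compact sets supplies for \<open>{s}\<close>.\<close>

lemma C_sup_upper:
  assumes "s \<in> zeta_domain" "even n"
  shows "norm (Riemann_zeta (2 * s + of_nat n)) \<le> C_sup s"
proof -
  obtain B where "\<And>n. even n \<Longrightarrow> norm (Riemann_zeta (2 * s + of_nat n)) \<le> B"
    using zeta_shift_bounded[of "{s}"] assms(1) by (metis compact_sing empty_subsetI insert_subset singletonI)
  then show ?thesis unfolding C_sup_def using assms(2) by (intro cSUP_upper bdd_aboveI2[where M = B]) auto
qed

lemma C_sup_nonneg: "s \<in> zeta_domain \<Longrightarrow> C_sup s \<ge> 0"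
  using C_sup_upper[of s 0] norm_ge_zero order_trans by blast

lemma C_sup_least: "(\<And>n. even n \<Longrightarrow> norm (Riemann_zeta (2 * s + of_nat n)) \<le> B) \<Longrightarrow> C_sup s \<le> B"
  unfolding C_sup_def by (rule cSUP_least) (auto intro: exI[of _ 0])

section \<open>The approximating determinants\<close>

context hecke_parameter
begin

lemma norm_L_entry_le:
  assumes s: "s \<in> zeta_domain"
  shows "norm (L_entry w s i j) \<le> 2 * C_sup s * w powr (- 2 * Re s) * entry_bound (2 * norm s) i j"
proof (cases "even (i + j)")
  case True
  have z: "norm (Riemann_zeta (2 * s + of_nat i + of_nat j)) \<le> C_sup s"
    using C_sup_upper[OF s True] by (simp add: add.assoc)
  have p: "norm (complex_of_real w powr (2 * s + of_nat i + of_nat j)) = w powr (2 * Re s + real i + real j)"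
    using w by (subst norm_powr_real_powr) auto
  have "(2 * s + of_nat i + of_nat j - 1) gchoose i = rising_binomial (2 * s + of_nat j) i"
    using gbinomial_conv_rising[of "2 * s + of_nat j" i] by (simp add: add_ac)
  moreover have "norm (rising_binomial (2 * s + of_nat j) i) \<le> rising_binomial (2 * norm s + real j) i"
    by (rule norm_rising_binomial_le) (use norm_triangle_ineq[of "2 * s" "of_nat j"] in \<open>simp add: norm_mult\<close>)
  ultimately have b: "norm ((2 * s + of_nat i + of_nat j - 1) gchoose i) \<le> rising_binomial (2 * norm s + real j) i" by simp
  have "norm (L_entry w s i j) = 2 * sqrt ((real j + 1) / (real i + 1)) *
      (norm (Riemann_zeta (2 * s + of_nat i + of_nat j)) / w powr (2 * Re s + real i + real j)) *
      norm ((2 * s + of_nat i + of_nat j - 1) gchoose i)"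
    unfolding L_entry_def if_P[OF True] norm_mult norm_divide p by simp
  also have "\<dots> \<le> 2 * sqrt ((real j + 1) / (real i + 1)) *
      (C_sup s / w powr (2 * Re s + real i + real j)) * rising_binomial (2 * norm s + real j) i"
    using z b C_sup_nonneg[OF s] by (intro mult_mono divide_right_mono) (auto intro!: mult_nonneg_nonneg)
  also have "\<dots> = 2 * C_sup s * w powr (- 2 * Re s) * entry_bound (2 * norm s) i j"
  proof -
    have "w powr (- 2 * Re s) * w powr (- (real i + real j)) = w powr (- (2 * Re s + real i + real j))"
      by (simp add: algebra_simps flip: powr_add)
    also have "\<dots> = 1 / w powr (2 * Re s + real i + real j)" by (rule powr_minus_divide)
    finally have "C_sup s / w powr (2 * Re s + real i + real j) = C_sup s * (w powr (- 2 * Re s) * w powr (- (real i + real j)))"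
      by simp
    then show ?thesis unfolding entry_bound_def by (simp only: mult_ac)
  qed
  finally show ?thesis .
next
  case False
  then show ?thesis using C_sup_nonneg[OF s] by (auto simp: L_entry_def intro!: mult_nonneg_nonneg entry_bound_nonneg)
qed

lemma sum_norm_L_entry_le:
  assumes s: "s \<in> zeta_domain"
  shows "(\<Sum>i<M. \<Sum>j<M. norm (L_entry w s i j)) \<le> Q_bound w s"
proof -
  define c where "c = 2 * C_sup s * w powr (- 2 * Re s)"
  have c: "c \<ge> 0" using C_sup_nonneg[OF s] by (simp add: c_def)
  have "(\<Sum>i<M. \<Sum>j<M. norm (L_entry w s i j)) \<le> (\<Sum>i<M. \<Sum>j<M. c * entry_bound (2 * norm s) i j)"
    unfolding c_def by (intro sum_mono norm_L_entry_le s)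
  also have "\<dots> = c * (\<Sum>i<M. \<Sum>j<M. entry_bound (2 * norm s) i j)" by (simp add: sum_distrib_left)
  also have "\<dots> \<le> c * entry_bound_total (2 * norm s)" using c by (intro mult_left_mono sum_entry_bound_le) auto
  \<comment> \<open>The summation produces order \<open>- 1 / 2\<close>; it is enlarged to
    \<open>- 3 / 2\<close>, the order in \<open>Q_bound\<close>.\<close>
  also have "entry_bound_total (2 * norm s) \<le> (w / (w - 1)) powr (2 * norm s) * ((w - 1) * polylog (- 3 / 2) (1 / (w - 1)))"
    unfolding entry_bound_total_def using w by (intro mult_left_mono polylog_mono) auto
  finally have "(\<Sum>i<M. \<Sum>j<M. norm (L_entry w s i j)) \<le> c * ((w / (w - 1)) powr (2 * norm s) * ((w - 1) * polylog (- 3 / 2) (1 / (w - 1))))"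
    using c by (simp add: mult_left_mono)
  also have "\<dots> = Q_bound w s"
  proof -
    have e1: "w powr (2 * norm s - 2 * Re s) = w powr (2 * norm s) * w powr (- 2 * Re s)" by (simp flip: powr_add)
    have e2: "(w - 1) powr (2 * norm s - 1) = (w - 1) powr (2 * norm s) / (w - 1)" using w by (simp add: powr_diff)
    have e3: "(w / (w - 1)) powr (2 * norm s) = w powr (2 * norm s) / (w - 1) powr (2 * norm s)"
      using w by (simp add: powr_divide)
    show ?thesis unfolding Q_bound_def c_def e1 e2 e3 using w by (simp add: field_simps)
  qed
  finally show ?thesis .
qed

lemma norm_L_entry_le_power:
  assumes s: "s \<in> zeta_domain" and ij: "i + j \<ge> 1"
  shows "norm (L_entry w s i j) \<le> C_sup s * (2 ^ nat \<lceil>2 * norm s\<rceil> / w powr (2 * Re s)) *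
    (sqrt (real (Suc j)) * (2 / w) ^ j * ((2 / w) ^ i / sqrt (real (Suc i))))"
proof -
  define m where "m = nat \<lceil>2 * norm s\<rceil>"
  have m: "2 * norm s \<le> real m" unfolding m_def by linarith
  have "rising_binomial (2 * norm s + real j) i \<le> rising_binomial (real (m + j)) i"
    using m by (intro rising_binomial_mono) auto
  also have "\<dots> \<le> 2 ^ (m + j + i - 1)" using ij by (intro rising_binomial_le_power2) auto
  finally have r: "rising_binomial (2 * norm s + real j) i \<le> 2 ^ (m + j + i - 1)" .
  have "norm (L_entry w s i j) \<le> 2 * C_sup s * w powr (- 2 * Re s) * entry_bound (2 * norm s) i j"
    by (rule norm_L_entry_le[OF s])
  also have "\<dots> \<le> 2 * C_sup s * w powr (- 2 * Re s) *
      (sqrt ((real j + 1) / (real i + 1)) * w powr (- (real i + real j)) * 2 ^ (m + j + i - 1))"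
    unfolding entry_bound_def using r C_sup_nonneg[OF s] by (intro mult_left_mono) auto
  also have "2 * C_sup s * w powr (- 2 * Re s) *
      (sqrt ((real j + 1) / (real i + 1)) * w powr (- (real i + real j)) * 2 ^ (m + j + i - 1))
    = C_sup s * w powr (- 2 * Re s) * (2 * 2 ^ (m + j + i - 1)) * sqrt ((real j + 1) / (real i + 1)) * w powr (- (real i + real j))"
    by (simp add: mult_ac)
  \<comment> \<open>The factor 2 of \<open>L_entry\<close> restores the missing power;
    \<open>i + j \<ge> 1\<close> makes the subtraction exact.\<close>
  also have "2 * 2 ^ (m + j + i - 1) = (2::real) ^ (m + j + i)"
  proof -
    have "m + j + i = Suc (m + j + i - 1)" using ij by simp
    then show ?thesis by (metis power_Suc)
  qed
  also have "w powr (- (real i + real j)) = 1 / (w ^ i * w ^ j)"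
    using powr_neg_nat_add[of i j] by (simp add: power_one_over)
  also have "w powr (- 2 * Re s) = 1 / w powr (2 * Re s)" by (simp add: powr_minus field_simps)
  also have "C_sup s * (1 / w powr (2 * Re s)) * 2 ^ (m + j + i) * sqrt ((real j + 1) / (real i + 1)) * (1 / (w ^ i * w ^ j))
    = C_sup s * (2 ^ m / w powr (2 * Re s)) * (sqrt (real (Suc j)) * (2 / w) ^ j * ((2 / w) ^ i / sqrt (real (Suc i))))"
    by (simp add: power_add power_divide real_sqrt_divide add.commute mult_ac)
  finally show ?thesis unfolding m_def .
qed

text \<open>Outside the leading block one index is at least \<open>N\<close>, and the majorant is a
  product of a row part \<open>g\<close> and a column part \<open>h\<close>. Each tail costs the
  factor \<open>r = x ^ N * sqrt (N + 1)\<close> over a bound for the full sum, because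
  \<open>N + k + 1 \<le> (N + 1) * (k + 1)\<close>.\<close>

lemma sum_norm_L_entry_tail_le:
  assumes s: "s \<in> zeta_domain" and N: "N \<ge> 1"
  shows "(\<Sum>i<M. \<Sum>j<M. if i < N \<and> j < N then 0 else norm (L_entry w s i j)) \<le> P_bound w N s"
proof -
  define x where "x = 2 / w"
  have x: "0 < x" "x < 1" using w by (auto simp: x_def)
  define K where "K = C_sup s * (2 ^ nat \<lceil>2 * norm s\<rceil> / w powr (2 * Re s))"
  have K: "K \<ge> 0" unfolding K_def using C_sup_nonneg[OF s] by auto
  define lam where "lam = polylog (- 1 / 2) x"
  have lam: "(\<lambda>k. sqrt (real (Suc k)) * x ^ Suc k) sums lam" unfolding lam_def using x by (intro polylog_half_sums) auto
  have lam0: "lam \<ge> 0" unfolding lam_def using x by (intro polylog_nonneg) auto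
  define g where "g = (\<lambda>i. x ^ i / sqrt (real (Suc i)))"
  define h where "h = (\<lambda>j. sqrt (real (Suc j)) * x ^ j)"
  have g0: "g i \<ge> 0" and h0: "h i \<ge> 0" for i using x by (auto simp: g_def h_def)
  have lam_fin: "(\<Sum>k<n. sqrt (real (Suc k)) * x ^ Suc k) \<le> lam" for n
    using sum_le_suminf[OF sums_summable[OF lam], of "{..<n}"] x sums_unique[OF lam] by auto
  have hsum: "(\<Sum>j<n. h j) \<le> lam / x" for n
  proof -
    have "(\<Sum>j<n. h j) * x = (\<Sum>k<n. sqrt (real (Suc k)) * x ^ Suc k)"
      unfolding h_def sum_distrib_right by (intro sum.cong) (simp_all add: mult_ac)
    then show ?thesis using lam_fin[of n] x by (simp add: field_simps)
  qed
  have gsum: "(\<Sum>i<n. g i) \<le> 1 + lam" for n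
  proof (cases n)
    case (Suc k)
    have "g (Suc i) \<le> sqrt (real (Suc i)) * x ^ Suc i" for i
    proof -
      have "1 / sqrt (real (Suc (Suc i))) \<le> 1" by simp
      also have "1 \<le> sqrt (real (Suc i))" by simp
      finally have "x ^ Suc i * (1 / sqrt (real (Suc (Suc i)))) \<le> x ^ Suc i * sqrt (real (Suc i))"
        using x by (intro mult_left_mono) auto
      then show ?thesis by (simp add: g_def mult_ac)
    qed
    then have "(\<Sum>i<k. g (Suc i)) \<le> lam" using order_trans[OF sum_mono lam_fin[of k]] by simp
    then show ?thesis unfolding Suc sum.lessThan_Suc_shift by (simp add: g_def)
  qed (use lam0 in simp)
  define r where "r = x ^ N * sqrt (real N + 1)"
  have r0: "r \<ge> 0" using x by (simp add: r_def)
  have shift: "(\<Sum>j<M. if j < N then 0 else f j) = (\<Sum>k<M - N. f (N + k))" for f :: "nat \<Rightarrow> real"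
  proof -
    have "(\<Sum>j<M. if j < N then 0 else f j) = (\<Sum>j\<in>{N..<M}. f j)"
      by (intro sum.mono_neutral_cong_right) auto
    also have "\<dots> = (\<Sum>k<M - N. f (N + k))"
      by (rule sum.reindex_bij_witness[of _ "\<lambda>k. N + k" "\<lambda>j. j - N"]) auto
    finally show ?thesis .
  qed
  have htail: "(\<Sum>j<M. if j < N then 0 else h j) \<le> r * (lam / x)"
  proof -
    have "h (N + k) \<le> r * h k" for k
    proof -
      have "real (Suc (N + k)) \<le> (real N + 1) * real (Suc k)" by (simp add: algebra_simps)
      then have "sqrt (real (Suc (N + k))) \<le> sqrt (real N + 1) * sqrt (real (Suc k))"
        by (metis real_sqrt_le_mono real_sqrt_mult)
      then have "sqrt (real (Suc (N + k))) * x ^ (N + k) \<le> sqrt (real N + 1) * sqrt (real (Suc k)) * x ^ (N + k)"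
        using x by (intro mult_right_mono) auto
      then show ?thesis by (simp add: h_def r_def power_add mult_ac)
    qed
    then have "(\<Sum>k<M - N. h (N + k)) \<le> r * (\<Sum>k<M - N. h k)" by (simp add: sum_distrib_left sum_mono)
    also have "\<dots> \<le> r * (lam / x)" using r0 by (intro mult_left_mono hsum)
    finally show ?thesis unfolding shift .
  qed
  have gtail: "(\<Sum>i<M. if i < N then 0 else g i) \<le> r * (1 + lam)"
  proof -
    have "g (N + k) \<le> r * g k" for k
    proof -
      have "1 / sqrt (real (Suc (N + k))) \<le> 1 / sqrt (real (Suc k))" by (intro divide_left_mono) auto
      also have "\<dots> \<le> sqrt (real N + 1) * (1 / sqrt (real (Suc k)))"
        using mult_right_mono[of 1 "sqrt (real N + 1)" "1 / sqrt (real (Suc k))"] by simp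
      finally have "x ^ (N + k) * (1 / sqrt (real (Suc (N + k)))) \<le> x ^ (N + k) * (sqrt (real N + 1) * (1 / sqrt (real (Suc k))))"
        using x by (intro mult_left_mono) auto
      then show ?thesis by (simp add: g_def r_def power_add mult_ac)
    qed
    then have "(\<Sum>k<M - N. g (N + k)) \<le> r * (\<Sum>k<M - N. g k)" by (simp add: sum_distrib_left sum_mono)
    also have "\<dots> \<le> r * (1 + lam)" using r0 by (intro mult_left_mono gsum)
    finally show ?thesis unfolding shift .
  qed
  have "(\<Sum>i<M. \<Sum>j<M. if i < N \<and> j < N then 0 else norm (L_entry w s i j))
    \<le> (\<Sum>i<M. \<Sum>j<M. K * (g i * (if j < N then 0 else h j) + (if i < N then 0 else g i) * h j))"
  proof (intro sum_mono)
    fix i j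
    have "norm (L_entry w s i j) \<le> K * (h j * g i)" if "\<not> (i < N \<and> j < N)"
      using norm_L_entry_le_power[OF s, of i j] that N unfolding K_def h_def g_def x_def by auto
    moreover have "K * (h j * g i) \<ge> 0" using K g0 h0 by auto
    ultimately show "(if i < N \<and> j < N then 0 else norm (L_entry w s i j))
      \<le> K * (g i * (if j < N then 0 else h j) + (if i < N then 0 else g i) * h j)"
      by (auto simp: mult_ac distrib_left)
  qed
  also have "\<dots> = K * ((\<Sum>i<M. g i) * (\<Sum>j<M. if j < N then 0 else h j) + (\<Sum>i<M. if i < N then 0 else g i) * (\<Sum>j<M. h j))"
    unfolding sum_product by (simp only: sum.distrib sum_distrib_left distrib_left)
  also have "\<dots> \<le> K * ((1 + lam) * (r * (lam / x)) + (r * (1 + lam)) * (lam / x))"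
    using K gsum hsum gtail htail lam0 r0 x g0 h0
    by (intro mult_left_mono add_mono mult_mono) (auto intro!: sum_nonneg)
  \<comment> \<open>Row tail and column tail have the same bound, and \<open>2 / x = w\<close> is
    the origin of the factor \<open>w\<close> in \<open>P_bound\<close>.\<close>
  also have "\<dots> = K * (r * (2 / x) * lam * (1 + lam))" using x by (simp add: field_simps)
  \<comment> \<open>A coefficient 1 is enlarged to \<open>sqrt 2\<close> to reach the constant in
    \<open>P_bound\<close>.\<close>
  also have "\<dots> \<le> K * (r * (2 / x) * lam * (1 + sqrt 2 * lam))"
  proof -
    have "1 * lam \<le> sqrt 2 * lam" using lam0 by (intro mult_right_mono) auto
    then show ?thesis using K r0 x lam0 by (intro mult_left_mono) auto
  qed
  also have "\<dots> = P_bound w N s"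
  proof -
    have "2 / x = w" using w by (simp add: x_def)
    then show ?thesis unfolding P_bound_def K_def r_def lam_def x_def
      by (simp add: powr_half_sqrt mult_ac)
  qed
  finally show ?thesis .
qed

lemma F_det_diff_le:
  assumes s: "s \<in> zeta_domain" and N: "1 \<le> N" "N \<le> M"
  shows "norm (F_det w M s - F_det w N s) \<le> P_bound w N s * exp (Q_bound w s)"
  using norm_det_one_minus_diff_le[OF N(2) sum_norm_L_entry_le[OF s] sum_norm_L_entry_tail_le[OF s N(1)]]
  by (simp add: F_det_def L_mat_def)

text \<open>By the Leibniz formula the determinant is a polynomial in the entries; nonzero entries
  have even \<open>i + j\<close>, which keeps the argument of zeta away from 1.\<close>

lemma F_det_holomorphic: "F_det w N holomorphic_on zeta_domain"
proof -
  have ent: "(\<lambda>s. L_entry w s i j) holomorphic_on zeta_domain" for i j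
  proof (cases "even (i + j)")
    case True
    have "Riemann_zeta \<circ> (\<lambda>s. 2 * s + of_nat i + of_nat j) holomorphic_on zeta_domain"
    proof (rule holomorphic_on_compose_gen[OF _ Riemann_zeta_analytic])
      show "(\<lambda>s. 2 * s + of_nat i + of_nat j) holomorphic_on zeta_domain" by (intro holomorphic_intros)
      show "(\<lambda>s. 2 * s + of_nat i + of_nat j) ` zeta_domain \<subseteq> - {1}"
        using zeta_domain_even[OF _ True] by (auto simp: add.assoc)
    qed
    then have z: "(\<lambda>s. Riemann_zeta (2 * s + of_nat i + of_nat j)) holomorphic_on zeta_domain" by (simp add: o_def)
    show ?thesis using True w unfolding L_entry_def gbinomial_prod_rev
      by (auto intro!: holomorphic_intros z)
  qed (simp add: L_entry_def)
  have "F_det w N = (\<lambda>s. \<Sum>p | p permutes {0..<N}. signof p * (\<Prod>i = 0..<N. (if i = p i then 1 else 0) - L_entry w s i (p i)))"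
  proof
    fix s
    have c: "1\<^sub>m N - L_mat w N s \<in> carrier_mat N N" by (rule minus_carrier_mat) (simp add: L_mat_def)
    show "F_det w N s = (\<Sum>p | p permutes {0..<N}. signof p * (\<Prod>i = 0..<N. (if i = p i then 1 else 0) - L_entry w s i (p i)))"
      unfolding F_det_def det_def'[OF c]
    proof (intro sum.cong refl arg_cong2[where f = times] prod.cong)
      fix p i assume "p \<in> {p. p permutes {0..<N}}" "i \<in> {0..<N}"
      then have "i < N" "p i < N" using permutes_in_image[of p "{0..<N}" i] by auto
      then show "(1\<^sub>m N - L_mat w N s) $$ (i, p i) = (if i = p i then 1 else 0) - L_entry w s i (p i)"
        by (simp add: L_mat_def)
    qed
  qed
  then show ?thesis by (simp only:) (intro holomorphic_intros ent)
qed

section \<open>The limit of the determinants\<close>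

definition Z_limit :: "complex \<Rightarrow> complex" where
  "Z_limit s = lim (\<lambda>N. F_det w N s)"

text \<open>Up to a constant factor these are the terms of the convergent series for the
  polylogarithm of order \<open>- 1 / 2\<close> at \<open>2 / w\<close>.\<close>

lemma decay_tendsto_0: "(\<lambda>N. (2 / w) ^ N * (real N + 1) powr (1 / 2)) \<longlonglongrightarrow> 0"
proof -
  define x where "x = 2 / w"
  have x: "0 < x" "x < 1" using w by (auto simp: x_def)
  have "(\<lambda>k. x ^ Suc k / real (Suc k) powr (- 1 / 2)) \<longlonglongrightarrow> 0"
    using x by (intro summable_LIMSEQ_zero polylog_summable) auto
  then have "(\<lambda>k. 1 / x * (x ^ Suc k / real (Suc k) powr (- 1 / 2))) \<longlonglongrightarrow> 1 / x * 0" by (intro tendsto_intros)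
  moreover have "1 / x * (x ^ Suc k / real (Suc k) powr (- 1 / 2)) = x ^ k * (real k + 1) powr (1 / 2)" for k
    using powr_minus_divide[of "real (Suc k)" "1 / 2"] x by (simp add: add.commute)
  ultimately show ?thesis by (simp add: x_def)
qed

definition P_factor :: "complex \<Rightarrow> real" where
  "P_factor s = w * C_sup s * (2 ^ nat \<lceil>2 * cmod s\<rceil> / w powr (2 * Re s))
       * polylog (-1/2) (2 / w) * (1 + sqrt 2 * polylog (-1/2) (2 / w))"

lemma P_bound_conv: "P_bound w N s = (2 / w) ^ N * (real N + 1) powr (1 / 2) * P_factor s"
  by (simp add: P_bound_def P_factor_def mult_ac)

lemma P_factor_nonneg: "s \<in> zeta_domain \<Longrightarrow> P_factor s \<ge> 0"
  unfolding P_factor_def using w C_sup_nonneg polylog_nonneg[of "2 / w" "-1/2"] by auto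

lemma P_bound_tendsto_0: "(\<lambda>N. P_bound w N s * c) \<longlonglongrightarrow> 0"
  using tendsto_mult_right[OF tendsto_mult_right[OF decay_tendsto_0, of "P_factor s"], of c] by (simp add: P_bound_conv)

lemma F_det_tendsto:
  assumes s: "s \<in> zeta_domain"
  shows "(\<lambda>N. F_det w N s) \<longlonglongrightarrow> Z_limit s"
proof -
  have "Cauchy (\<lambda>N. F_det w N s)"
  proof (rule metric_CauchyI)
    fix e :: real assume "e > 0"
    then have "\<forall>\<^sub>F N in sequentially. P_bound w N s * exp (Q_bound w s) < e / 2"
      using order_tendstoD(2)[OF P_bound_tendsto_0, of "e / 2"] by simp
    then have "\<forall>\<^sub>F N in sequentially. P_bound w N s * exp (Q_bound w s) < e / 2 \<and> N \<ge> 1"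
      using eventually_ge_at_top[of 1] by eventually_elim simp
    then obtain N where N: "P_bound w N s * exp (Q_bound w s) < e / 2" "N \<ge> 1"
      by (auto simp: eventually_sequentially)
    have d: "dist (F_det w m s) (F_det w N s) < e / 2" if "m \<ge> N" for m
      using F_det_diff_le[OF s N(2) that] N(1) by (simp add: dist_norm)
    show "\<exists>M. \<forall>m\<ge>M. \<forall>n\<ge>M. dist (F_det w m s) (F_det w n s) < e"
      using d dist_triangle_half_l[of "F_det w m s" "F_det w N s" e for m] by (metis dist_commute)
  qed
  then show ?thesis unfolding Z_limit_def by (simp add: Cauchy_convergent_iff convergent_LIMSEQ_iff)
qed

lemma Z_limit_diff_le:
  assumes s: "s \<in> zeta_domain" and N: "N \<ge> 1"
  shows "norm (Z_limit s - F_det w N s) \<le> P_bound w N s * exp (Q_bound w s)"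
proof (rule tendsto_upperbound)
  show "(\<lambda>M. norm (F_det w M s - F_det w N s)) \<longlonglongrightarrow> norm (Z_limit s - F_det w N s)"
    by (intro tendsto_intros F_det_tendsto s)
  show "\<forall>\<^sub>F M in sequentially. norm (F_det w M s - F_det w N s) \<le> P_bound w N s * exp (Q_bound w s)"
    using eventually_ge_at_top[of N] by eventually_elim (rule F_det_diff_le[OF s N])
qed simp

text \<open>On a closed ball \<open>C_sup\<close> is replaced by a common bound \<open>B\<close> of
  all zeta values that occur, and each power by a bound valid on the ball; the rate in
  \<open>N\<close> is then the same at all points.\<close>

lemma Z_limit_holomorphic: "Z_limit holomorphic_on zeta_domain"
proof (rule holomorphic_uniform_sequence[OF open_zeta_domain F_det_holomorphic])
  fix z assume "z \<in> zeta_domain"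
  then obtain d where d: "d > 0" "cball z d \<subseteq> zeta_domain" using open_zeta_domain open_contains_cball by blast
  obtain B where B: "\<And>s n. s \<in> cball z d \<Longrightarrow> even n \<Longrightarrow> norm (Riemann_zeta (2 * s + of_nat n)) \<le> B"
    using zeta_shift_bounded[OF compact_cball d(2)] by metis
  have C: "0 \<le> C_sup s" "C_sup s \<le> B" if "s \<in> cball z d" for s
    using C_sup_nonneg C_sup_least B that d by blast+
  have B0: "B \<ge> 0" using C[of z] d by force
  define R where "R = norm z + d"
  have R: "norm s \<le> R" if "s \<in> cball z d" for s
    using that norm_triangle_ineq2[of s z] by (simp add: R_def dist_norm norm_minus_commute)
  have Re: "\<bar>Re s\<bar> \<le> R" if "s \<in> cball z d" for s using R[OF that] abs_Re_le_cmod[of s] by linarith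
  define l1 where "l1 = polylog (-1/2) (2 / w)"
  define l2 where "l2 = polylog (-3/2) (1 / (w - 1))"
  have l: "l1 \<ge> 0" "l2 \<ge> 0" unfolding l1_def l2_def using w by (auto intro!: polylog_nonneg)
  define K where "K = w * B * (2 ^ nat \<lceil>2 * R\<rceil> * w powr (2 * R)) * l1 * (1 + sqrt 2 * l1)"
  define Q where "Q = 2 * B * (w powr (4 * R) * (w - 1)) * l2"
  have P: "P_factor s \<le> K" if s: "s \<in> cball z d" for s
  proof -
    have "(2::real) ^ nat \<lceil>2 * norm s\<rceil> \<le> 2 ^ nat \<lceil>2 * R\<rceil>"
      using R[OF s] by (intro power_increasing nat_mono ceiling_mono) auto
    moreover have "1 / w powr (2 * Re s) \<le> w powr (2 * R)"
      using powr_minus_divide[of w "2 * Re s"] powr_mono[of "- (2 * Re s)" "2 * R" w] Re[OF s] w by simp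
    ultimately have "2 ^ nat \<lceil>2 * norm s\<rceil> * (1 / w powr (2 * Re s)) \<le> 2 ^ nat \<lceil>2 * R\<rceil> * w powr (2 * R)"
      by (intro mult_mono) auto
    then show ?thesis unfolding P_factor_def K_def l1_def[symmetric] using C[OF s] w l B0
      by (intro mult_mono mult_nonneg_nonneg) auto
  qed
  have Qb: "Q_bound w s \<le> Q" if s: "s \<in> cball z d" for s
  proof -
    have "w powr (2 * norm s - 2 * Re s) \<le> w powr (4 * R)"
      using R[OF s] Re[OF s] w by (intro powr_mono) auto
    \<comment> \<open>The exponent \<open>2 * norm s - 1\<close> can be negative but never below
      \<open>- 1\<close>, which leaves at most a factor \<open>w - 1\<close>.\<close>
    moreover have "1 / (w - 1) powr (2 * norm s - 1) \<le> w - 1"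
      using powr_minus_divide[of "w - 1" "2 * norm s - 1"] powr_mono[of "- (2 * norm s - 1)" 1 "w - 1"] w by simp
    ultimately have "w powr (2 * norm s - 2 * Re s) * (1 / (w - 1) powr (2 * norm s - 1)) \<le> w powr (4 * R) * (w - 1)"
      using w by (intro mult_mono) auto
    then show ?thesis unfolding Q_bound_def Q_def l2_def[symmetric] using C[OF s] l B0
      by (intro mult_mono mult_nonneg_nonneg) (use w in auto)
  qed
  have "uniform_limit (cball z d) (F_det w) Z_limit sequentially"
  proof (rule uniform_limitI)
    fix e :: real assume "e > 0"
    have "(\<lambda>N. (2 / w) ^ N * (real N + 1) powr (1 / 2) * (K * exp Q)) \<longlonglongrightarrow> 0"
      using tendsto_mult_right[OF decay_tendsto_0, of "K * exp Q"] by simp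
    then have "\<forall>\<^sub>F N in sequentially. (2 / w) ^ N * (real N + 1) powr (1 / 2) * (K * exp Q) < e"
      using \<open>e > 0\<close> by (rule order_tendstoD)
    then show "\<forall>\<^sub>F N in sequentially. \<forall>s\<in>cball z d. dist (F_det w N s) (Z_limit s) < e"
      using eventually_ge_at_top[of 1]
    proof eventually_elim
      case (elim N)
      show ?case
      proof
        fix s assume s: "s \<in> cball z d"
        have "dist (F_det w N s) (Z_limit s) \<le> P_bound w N s * exp (Q_bound w s)"
          using Z_limit_diff_le[OF subsetD[OF d(2) s] elim(2)] by (simp add: dist_norm norm_minus_commute)
        also have "\<dots> = (2 / w) ^ N * (real N + 1) powr (1 / 2) * (P_factor s * exp (Q_bound w s))"
          by (simp add: P_bound_conv)
        also have "\<dots> \<le> (2 / w) ^ N * (real N + 1) powr (1 / 2) * (K * exp Q)"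
        proof (intro mult_left_mono mult_mono P s)
          show "0 \<le> K" using order_trans[OF P_factor_nonneg P[OF s]] s d by blast
        qed (use Qb[OF s] w in auto)
        finally show "dist (F_det w N s) (Z_limit s) < e" using elim by simp
      qed
    qed
  qed
  then show "\<exists>d. 0 < d \<and> cball z d \<subseteq> zeta_domain \<and> uniform_limit (cball z d) (F_det w) Z_limit sequentially"
    using d by blast
qed

lemma Z_limit_bound:
  assumes s: "s \<in> zeta_domain" and N: "N \<ge> 1"
  shows "norm (Z_limit s - F_det w N s) \<le> P_bound w N s * exp (P_bound w N s + Q_bound w s + 1)"
proof -
  have P0: "P_bound w N s \<ge> 0" unfolding P_bound_conv using P_factor_nonneg[OF s] w by auto
  have "norm (Z_limit s - F_det w N s) \<le> P_bound w N s * exp (Q_bound w s)" by (rule Z_limit_diff_le[OF s N])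
  also have "\<dots> \<le> P_bound w N s * exp (P_bound w N s + Q_bound w s + 1)"
    using P0 by (intro mult_left_mono) auto
  finally show ?thesis .
qed

end

section \<open>Traces of weighted composition operators\<close>

text \<open>Both arguments lie strictly between \<open>- pi / 2\<close> and \<open>pi / 2\<close>,
  so the principal logarithms add without a jump.\<close>

lemma powr_mult_right_half_plane:
  fixes x y a :: complex
  assumes "Re x > 0" "Re y > 0"
  shows "(x * y) powr a = x powr a * y powr a"
proof -
  have ne: "x \<noteq> 0" "y \<noteq> 0" using assms by auto
  have "\<bar>Im (Ln x)\<bar> < pi / 2" "\<bar>Im (Ln y)\<bar> < pi / 2" using assms Re_Ln_pos_lt_imp by blast+
  then have "Ln (x * y) = Ln x + Ln y" using ne by (subst Ln_times) auto
  then show ?thesis using ne by (simp add: powr_def algebra_simps exp_add)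
qed

definition taylor :: "(complex \<Rightarrow> complex) \<Rightarrow> nat \<Rightarrow> complex" where
  "taylor f i = (deriv ^^ i) f 0 / fact i"

lemma taylor_eqI:
  assumes "r > 0" "\<And>z. norm z < r \<Longrightarrow> (\<lambda>i. a i * z ^ i) sums f z"
  shows "taylor f i = a i"
proof -
  have "\<forall>\<^sub>F u in nhds 0. u \<in> ball 0 r" using assms(1) by (intro eventually_nhds_in_open) auto
  then have "\<forall>\<^sub>F u in nhds 0. (\<lambda>n. fps_nth (Abs_fps a) n * u ^ n) sums f u"
    by eventually_elim (use assms(2) in auto)
  then have "f has_fps_expansion Abs_fps a" by (rule has_fps_expansionI)
  from fps_nth_fps_expansion[OF this, of i] show ?thesis by (simp add: taylor_def)
qed

lemma taylor_cong:
  assumes "r > 0" "\<And>z. z \<in> ball 0 r \<Longrightarrow> f z = g z"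
  shows "taylor f i = taylor g i"
  unfolding taylor_def using assms
  by (subst higher_deriv_cong_ev[of f g]) (auto intro!: eventually_mono[OF eventually_nhds_in_open[of "ball 0 r"]])

lemma taylor_sums:
  assumes "f holomorphic_on ball 0 r" "norm z < r"
  shows "(\<lambda>i. taylor f i * z ^ i) sums f z"
  using holomorphic_power_series[OF assms(1), of z] assms(2) by (simp add: taylor_def)

text \<open>This makes composition of operators correspond to multiplication of matrices. Since
  \<open>\<psi>\<close> maps the disc into a smaller one, \<open>f\<close> can be expanded in powers
  of \<open>\<psi> z\<close>, and uniform convergence near 0 allows differentiation term by
  term.\<close>

lemma taylor_compose_sums:
  assumes f: "f holomorphic_on ball 0 1" and \<phi>: "\<phi> holomorphic_on ball 0 1" and \<psi>: "\<psi> holomorphic_on ball 0 1"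
    and r: "r < 1" "\<And>z. norm z < 1 \<Longrightarrow> norm (\<psi> z) \<le> r"
  shows "(\<lambda>k. taylor (\<lambda>z. \<phi> z * \<psi> z ^ k) i * taylor f k) sums taylor (\<lambda>z. \<phi> z * f (\<psi> z)) i"
proof -
  have r0: "r \<ge> 0" using order_trans[OF norm_ge_zero r(2)[of 0]] by simp
  \<comment> \<open>Convergence at \<open>\<rho>\<close>, strictly between \<open>r\<close> and 1,
    becomes absolute convergence at \<open>r\<close>.\<close>
  obtain \<rho> where \<rho>: "r < \<rho>" "\<rho> < 1" using r(1) dense by blast
  have "summable (\<lambda>k. taylor f k * (of_real \<rho>) ^ k)"
    using taylor_sums[OF f, of "of_real \<rho>"] \<rho> r0 by (auto simp: sums_iff)
  then have s: "summable (\<lambda>k. norm (taylor f k * (of_real r) ^ k))"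
    by (rule powser_insidea) (use \<rho> r0 in simp)
  \<comment> \<open>On the open unit disc \<open>\<phi>\<close> may be unbounded; a smaller disc
    around 0 suffices for derivatives at 0.\<close>
  have "continuous_on (cball 0 (1 / 2)) \<phi>"
    using holomorphic_on_imp_continuous_on[OF \<phi>] by (rule continuous_on_subset) auto
  then have "bounded (\<phi> ` cball 0 (1 / 2))" using compact_continuous_image compact_imp_bounded compact_cball by blast
  then obtain C where "\<forall>y\<in>\<phi> ` cball 0 (1 / 2). norm y \<le> C" unfolding bounded_iff by blast
  then have C: "norm (\<phi> z) \<le> C" if "norm z \<le> 1 / 2" for z using that by simp
  define A where "A = ball (0::complex) (1 / 2)"
  have A: "A \<subseteq> ball 0 1" "open A" "0 \<in> A" by (auto simp: A_def)
  define T where "T = (\<lambda>k z. taylor f k * (\<phi> z * \<psi> z ^ k))"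
  have hol: "(\<lambda>z. \<phi> z * \<psi> z ^ k) holomorphic_on A" for k
    using holomorphic_on_subset[OF \<phi> A(1)] holomorphic_on_subset[OF \<psi> A(1)] by (intro holomorphic_intros)
  have ul: "uniform_limit A (\<lambda>N z. \<Sum>k<N. T k z) (\<lambda>z. \<Sum>k. T k z) sequentially"
  proof (rule Weierstrass_m_test)
    show "summable (\<lambda>k. C * norm (taylor f k * of_real r ^ k))" by (rule summable_mult[OF s])
    fix k z assume z: "z \<in> A"
    have "norm (T k z) = norm (\<phi> z) * (norm (taylor f k) * norm (\<psi> z) ^ k)"
      by (simp add: T_def norm_mult norm_power)
    also have "\<dots> \<le> C * (norm (taylor f k) * r ^ k)"
      using C[of z] r(2)[of z] z r0 order_trans[OF norm_ge_zero C[of 0]]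
      by (intro mult_mono power_mono) (auto simp: A_def)
    finally show "norm (T k z) \<le> C * norm (taylor f k * of_real r ^ k)"
      using r0 by (simp add: norm_mult norm_power)
  qed
  have lim: "(\<Sum>k. T k z) = \<phi> z * f (\<psi> z)" if "z \<in> A" for z
  proof -
    have "norm (\<psi> z) < 1" using r(2)[of z] r(1) that by (auto simp: A_def)
    from sums_mult[OF taylor_sums[OF f this], of "\<phi> z"] show ?thesis
      by (simp add: T_def sums_iff mult_ac)
  qed
  have "((\<lambda>N. (deriv ^^ i) (\<lambda>z. \<Sum>k<N. T k z) 0) \<longlongrightarrow> (deriv ^^ i) (\<lambda>z. \<Sum>k. T k z) 0) sequentially"
  proof (intro higher_deriv_complex_uniform_limit[OF ul] always_eventually allI)
    show "(\<lambda>z. \<Sum>k<N. T k z) holomorphic_on A" for N unfolding T_def by (intro holomorphic_on_sum holomorphic_on_mult[OF holomorphic_on_const hol])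
  qed (use A in auto)
  moreover have "(deriv ^^ i) (\<lambda>z. \<Sum>k<N. T k z) 0 = (\<Sum>k<N. taylor f k * (deriv ^^ i) (\<lambda>z. \<phi> z * \<psi> z ^ k) 0)" for N
  proof (induction N)
    case (Suc N)
    have "(\<lambda>z. \<Sum>k<N. T k z) holomorphic_on A" "T N holomorphic_on A"
      unfolding T_def by (intro holomorphic_on_sum holomorphic_on_mult[OF holomorphic_on_const hol])+
    then show ?case using Suc A higher_deriv_add[of "\<lambda>z. \<Sum>k<N. T k z" A "T N" 0 i] higher_deriv_cmult[OF hol A(3,2), of i _ N]
      by (simp add: T_def)
  qed (induction i, simp_all)
  moreover have "(deriv ^^ i) (\<lambda>z. \<Sum>k. T k z) 0 = (deriv ^^ i) (\<lambda>z. \<phi> z * f (\<psi> z)) 0"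
    using A lim by (intro higher_deriv_cong_ev eventually_mono[OF eventually_nhds_in_open[of A]]) auto
  ultimately have "(\<lambda>k. taylor f k * (deriv ^^ i) (\<lambda>z. \<phi> z * \<psi> z ^ k) 0) sums (deriv ^^ i) (\<lambda>z. \<phi> z * f (\<psi> z)) 0"
    by (simp add: sums_def)
  from sums_divide[OF this, of "fact i"] show ?thesis by (simp add: taylor_def mult_ac)
qed

text \<open>Summing the geometric series under the Cauchy integrals of the diagonal coefficients leaves one
  simple pole, at the fixed point of \<open>\<psi>\<close>.\<close>

lemma taylor_trace_sums:
  assumes R: "R > 1" and \<phi>: "\<phi> holomorphic_on ball 0 R" and \<psi>: "\<psi> holomorphic_on ball 0 R"
    and r: "r < 1" "\<And>z. norm z = 1 \<Longrightarrow> norm (\<psi> z) \<le> r"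
    and g: "continuous_on (cball 0 1) g" "g holomorphic_on ball 0 1" and x: "norm x < 1"
    and eq: "\<And>z. norm z = 1 \<Longrightarrow> \<phi> z / (z - \<psi> z) = g z / (z - x)"
  shows "(\<lambda>i. taylor (\<lambda>z. \<phi> z * \<psi> z ^ i) i) sums g x"
proof -
  have r0: "r \<ge> 0" using order_trans[OF norm_ge_zero r(2)[of 1]] by simp
  have sub: "cball 0 1 \<subseteq> ball (0::complex) R" using R by auto
  have hol: "(\<lambda>z. \<phi> z * \<psi> z ^ i) holomorphic_on ball 0 R" for i using \<phi> \<psi> by (intro holomorphic_intros)
  define c where "c = circlepath (0::complex) 1"
  have int: "((\<lambda>z. \<phi> z * \<psi> z ^ i / z ^ Suc i) has_contour_integral (2 * pi * \<i> * taylor (\<lambda>z. \<phi> z * \<psi> z ^ i) i)) c" for i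
  proof -
    have "((\<lambda>u. \<phi> u * \<psi> u ^ i / (u - 0) ^ Suc i) has_contour_integral (2 * pi * \<i> / fact i * (deriv ^^ i) (\<lambda>z. \<phi> z * \<psi> z ^ i) 0)) (circlepath 0 1)"
    proof (rule Cauchy_has_contour_integral_higher_derivative_circlepath)
      show "continuous_on (cball 0 1) (\<lambda>u. \<phi> u * \<psi> u ^ i)"
        using holomorphic_on_imp_continuous_on[OF hol] sub by (rule continuous_on_subset)
      show "(\<lambda>u. \<phi> u * \<psi> u ^ i) holomorphic_on ball 0 1"
        using hol sub by (meson ball_subset_cball holomorphic_on_subset order_trans)
    qed simp
    then show ?thesis by (simp add: c_def taylor_def)
  qed
  have intN: "((\<lambda>z. \<Sum>i<N. \<phi> z * \<psi> z ^ i / z ^ Suc i) has_contour_integral (\<Sum>i<N. 2 * pi * \<i> * taylor (\<lambda>z. \<phi> z * \<psi> z ^ i) i)) c" for N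
    by (intro has_contour_integral_sum int) simp
  have "continuous_on (sphere 0 1) \<phi>"
    using holomorphic_on_imp_continuous_on[OF \<phi>] by (rule continuous_on_subset) (use R in auto)
  then have "bounded (\<phi> ` sphere 0 1)" using compact_continuous_image compact_imp_bounded compact_sphere by blast
  then obtain C where "\<forall>y\<in>\<phi> ` sphere 0 1. norm y \<le> C" unfolding bounded_iff by blast
  then have C: "norm (\<phi> z) \<le> C" if "norm z = 1" for z using that by simp
  have ul: "uniform_limit (sphere 0 1) (\<lambda>N z. \<Sum>i<N. \<phi> z * \<psi> z ^ i / z ^ Suc i) (\<lambda>z. \<Sum>i. \<phi> z * \<psi> z ^ i / z ^ Suc i) sequentially"
  proof (rule Weierstrass_m_test)
    show "summable (\<lambda>i. C * r ^ i)" using r r0 by (intro summable_mult summable_geometric) auto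
    fix i z assume "z \<in> sphere (0::complex) 1"
    then have z: "norm z = 1" by simp
    show "norm (\<phi> z * \<psi> z ^ i / z ^ Suc i) \<le> C * r ^ i"
      unfolding norm_mult norm_divide norm_power z using C[OF z] r(2)[OF z] r0 order_trans[OF norm_ge_zero C[OF z]]
      by (auto intro!: mult_mono power_mono)
  qed
  have lim: "(\<Sum>i. \<phi> z * \<psi> z ^ i / z ^ Suc i) = g z / (z - x)" if z: "norm z = 1" for z
  proof -
    have z0: "z \<noteq> 0" using z by auto
    have "norm (\<psi> z / z) < 1" using r(2)[OF z] r(1) z by (simp add: norm_divide)
    from sums_mult[OF geometric_sums[OF this], of "\<phi> z / z"]
    have "(\<lambda>i. \<phi> z / z * (\<psi> z / z) ^ i) sums (\<phi> z / z * (1 / (1 - \<psi> z / z)))" .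
    moreover have "\<phi> z / z * (1 / (1 - \<psi> z / z)) = \<phi> z / (z - \<psi> z)" using z0 by (simp add: field_simps)
    moreover have "\<phi> z / z * (\<psi> z / z) ^ i = \<phi> z * \<psi> z ^ i / z ^ Suc i" for i by (simp add: power_divide)
    ultimately show ?thesis using eq[OF z] by (simp add: sums_iff)
  qed
  have "((\<lambda>N. contour_integral c (\<lambda>z. \<Sum>i<N. \<phi> z * \<psi> z ^ i / z ^ Suc i)) \<longlongrightarrow> contour_integral c (\<lambda>z. \<Sum>i. \<phi> z * \<psi> z ^ i / z ^ Suc i)) sequentially"
    unfolding c_def
  proof (rule contour_integral_uniform_limit_circlepath(2)[OF _ ul])
    show "\<forall>\<^sub>F N in sequentially. (\<lambda>z. \<Sum>i<N. \<phi> z * \<psi> z ^ i / z ^ Suc i) contour_integrable_on circlepath 0 1"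
      using intN unfolding c_def contour_integrable_on_def by (intro always_eventually allI) blast
  qed auto
  moreover have "contour_integral c (\<lambda>z. \<Sum>i<N. \<phi> z * \<psi> z ^ i / z ^ Suc i) = (\<Sum>i<N. 2 * pi * \<i> * taylor (\<lambda>z. \<phi> z * \<psi> z ^ i) i)" for N
    by (rule contour_integral_unique[OF intN])
  moreover have "contour_integral c (\<lambda>z. \<Sum>i. \<phi> z * \<psi> z ^ i / z ^ Suc i) = 2 * pi * \<i> * g x"
  proof (rule contour_integral_unique)
    have "((\<lambda>z. g z / (z - x)) has_contour_integral (2 * pi * \<i> * g x)) c"
      unfolding c_def using Cauchy_integral_circlepath[OF g, of x] x by simp
    then show "((\<lambda>z. \<Sum>i. \<phi> z * \<psi> z ^ i / z ^ Suc i) has_contour_integral (2 * pi * \<i> * g x)) c"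
    proof (rule has_contour_integral_eq)
      fix y assume "y \<in> path_image c"
      then have "norm y = 1" by (simp add: c_def)
      from lim[OF this] show "g y / (y - x) = (\<Sum>i. \<phi> y * \<psi> y ^ i / y ^ Suc i)" by (rule sym)
    qed
  qed
  ultimately have "(\<lambda>i. 2 * pi * \<i> * taylor (\<lambda>z. \<phi> z * \<psi> z ^ i) i) sums (2 * pi * \<i> * g x)"
    by (simp add: sums_def)
  then show ?thesis by (subst (asm) sums_mult_iff) auto
qed

text \<open>Real \<open>s\<close> keeps all traces nonnegative, and \<open>s \<ge> 1\<close> bounds
  the dependence on a letter \<open>n\<close> by \<open>\<bar>n\<bar> powr (- 2)\<close> whatever
  the indices.\<close>

locale hecke_real = hecke_parameter +
  fixes s :: real assumes s: "s \<ge> 1"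
begin

text \<open>A holomorphic version of \<open>\<bar>a - c * z\<bar> powr (- 2 * s)\<close>: the factor
  \<open>sgn a\<close> moves the base into the right half-plane, away from the branch cut, and makes
  the value insensitive to the sign of the matrix.\<close>

definition weight :: "int list \<Rightarrow> complex \<Rightarrow> complex" where
  "weight l z = (case word_mat w l of (a, b, c, d) \<Rightarrow> (of_real (sgn a) * (of_real a - of_real c * z)) powr of_real (- 2 * s))"

text \<open>The action of the inverse of the word, which is the contracting direction.\<close>

definition branch :: "int list \<Rightarrow> complex \<Rightarrow> complex" where
  "branch l z = (case word_mat w l of (a, b, c, d) \<Rightarrow> (of_real d * z - of_real b) / (of_real a - of_real c * z))"

lemma denom_Re_pos:
  assumes l: "word_mat w l = (a, b, c, d)" "0 \<notin> set l" and z: "norm z < w / 2"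
  shows "Re (of_real (sgn a) * (of_real a - of_real c * z)) > 0"
proof -
  note D = word_mat_dominant[OF l]
  have "\<bar>sgn a * (c * Re z)\<bar> \<le> \<bar>c\<bar> * norm z"
    using abs_Re_le_cmod[of z] by (auto simp: abs_mult abs_sgn_eq intro!: mult_left_mono)
  moreover have "\<bar>c\<bar> * norm z < \<bar>a\<bar>"
  proof (cases "c = 0")
    case False
    then have "\<bar>c\<bar> * norm z < \<bar>c\<bar> * (w / 2)" using z by (intro mult_strict_left_mono) auto
    then show ?thesis using D(1) by (simp add: mult.commute)
  qed (use D(2) in simp)
  moreover have "sgn a * a = \<bar>a\<bar>" by (simp add: abs_sgn mult.commute)
  ultimately show ?thesis by (simp add: right_diff_distrib)
qed

lemma denom_nonzero:
  assumes "word_mat w l = (a, b, c, d)" "0 \<notin> set l" "norm z < w / 2"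
  shows "of_real a - of_real c * z \<noteq> (0::complex)"
  using denom_Re_pos[OF assms] by (metis mult_zero_right zero_complex.sel(1) less_irrefl)

lemma weight_holomorphic: "0 \<notin> set l \<Longrightarrow> weight l holomorphic_on ball 0 (w / 2)"
proof -
  assume l: "0 \<notin> set l"
  obtain a b c d where m: "word_mat w l = (a, b, c, d)" by (metis prod_cases4)
  have "(\<lambda>z. (of_real (sgn a) * (of_real a - of_real c * z)) powr of_real (- 2 * s)) holomorphic_on ball 0 (w / 2)"
    using denom_Re_pos[OF m l] by (intro holomorphic_intros) (force simp: complex_nonpos_Reals_iff)
  then show ?thesis by (simp add: weight_def[abs_def] m)
qed

lemma branch_holomorphic: "0 \<notin> set l \<Longrightarrow> branch l holomorphic_on ball 0 (w / 2)"
proof -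
  assume l: "0 \<notin> set l"
  obtain a b c d where m: "word_mat w l = (a, b, c, d)" by (metis prod_cases4)
  have "(\<lambda>z. (of_real d * z - of_real b) / (of_real a - of_real c * z)) holomorphic_on ball 0 (w / 2)"
    using denom_nonzero[OF m l] by (intro holomorphic_intros) auto
  then show ?thesis by (simp add: branch_def[abs_def] m)
qed

lemma norm_branch_le:
  assumes l: "l \<in> nz_words" and z: "norm z < w / 2"
  shows "norm (branch l z) \<le> 2 / w"
proof -
  obtain a b c d where m: "word_mat w l = (a, b, c, d)" by (metis prod_cases4)
  have "w / 2 * norm (of_real d * z - of_real b) \<le> norm (of_real a - of_real c * z)"
    using word_mat_contracts[OF m l, of z] z by simp
  moreover have "of_real a - of_real c * z \<noteq> 0" using denom_nonzero[OF m] l z by (simp add: nz_words_def)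
  ultimately show ?thesis using w by (simp add: branch_def m norm_divide field_simps)
qed

lemma letter_nz: "n \<noteq> 0 \<Longrightarrow> [n] \<in> nz_words"
  by (simp add: nz_words_def)

text \<open>The cocycle rule: the denominator of a product of matrices factors as
  \<open>p * q\<close>. Powers multiply because both factors, with signs adjusted, lie in the right
  half-plane; the signs multiply since \<open>\<bar>c\<bar> < \<bar>n * w * a\<bar>\<close>.\<close>

lemma weight_branch_Cons:
  assumes n: "n \<noteq> 0" and l: "0 \<notin> set l" and z: "norm z < w / 2"
  shows "weight (n # l) z = weight [n] z * weight l (branch [n] z)"
    "branch (n # l) z = branch l (branch [n] z)"
proof -
  obtain a b c d where m: "word_mat w l = (a, b, c, d)" by (metis prod_cases4)
  define p where "p = complex_of_real (n * w) - z"
  define y where "y = branch [n] z"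
  have n1: "word_mat w [n] = (n * w, - 1, 1, 0)" by simp
  have p0: "p \<noteq> 0" using denom_nonzero[OF n1] n z by (simp add: p_def)
  have y: "y = 1 / p" by (simp add: y_def branch_def p_def)
  have "norm y \<le> 2 / w" unfolding y_def by (rule norm_branch_le[OF letter_nz[OF n] z])
  moreover have "2 / w < 1" "1 < w / 2" using w by auto
  ultimately have y1: "norm y < w / 2" by linarith
  define q where "q = complex_of_real a - of_real c * y"
  have q0: "q \<noteq> 0" unfolding q_def by (rule denom_nonzero[OF m l y1])
  have py: "p * y = 1" using p0 y by simp
  have "p * q = of_real a * p - of_real c * (p * y)" by (simp add: q_def algebra_simps)
  then have pq: "of_real (n * w * a - c) - of_real a * z = p * q" unfolding py by (simp add: p_def algebra_simps)
  have Rq: "Re (of_real (sgn a) * q) > 0" unfolding q_def by (rule denom_Re_pos[OF m l y1])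
  have Rp: "Re (of_real (sgn (n * w)) * p) > 0" using denom_Re_pos[OF n1, of z] n z by (simp add: p_def)
  have a0: "\<bar>a\<bar> \<ge> 1" using word_mat_dominant(2)[OF m l] by simp
  have "sgn (n * w * a - c) = sgn (n * w * a)"
  proof -
    have "w / 2 * \<bar>c\<bar> \<le> \<bar>a\<bar>" by (rule word_mat_dominant(1)[OF m l])
    moreover have "1 * \<bar>c\<bar> \<le> w / 2 * \<bar>c\<bar>" using w by (intro mult_right_mono) auto
    ultimately have c: "\<bar>c\<bar> \<le> \<bar>a\<bar>" by simp
    have "\<bar>n * w\<bar> * \<bar>a\<bar> \<ge> w * \<bar>a\<bar>" using abs_letter[OF n] by (intro mult_right_mono) auto
    moreover have "w * \<bar>a\<bar> > 1 * \<bar>a\<bar>" using w a0 by (intro mult_strict_right_mono) auto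
    ultimately have "\<bar>n * w * a\<bar> > \<bar>c\<bar>" using c by (simp add: abs_mult)
    then show ?thesis by (auto simp: sgn_if)
  qed
  also have "\<dots> = sgn (n * w) * sgn a" by (simp add: sgn_mult)
  finally have sg: "sgn (n * w * a - c) = sgn (n * w) * sgn a" .
  have mc: "word_mat w (n # l) = (n * w * a - c, n * w * b - d, a, b)" using m by simp
  have "weight (n # l) z = ((of_real (sgn (n * w)) * p) * (of_real (sgn a) * q)) powr of_real (- 2 * s)"
    unfolding weight_def mc prod.case sg pq by (simp add: mult_ac)
  also have "\<dots> = (of_real (sgn (n * w)) * p) powr of_real (- 2 * s) * (of_real (sgn a) * q) powr of_real (- 2 * s)"
    by (rule powr_mult_right_half_plane[OF Rp Rq])
  also have "\<dots> = weight [n] z * weight l (branch [n] z)"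
    unfolding weight_def n1 m prod.case y_def[symmetric] by (simp add: p_def q_def)
  finally show "weight (n # l) z = weight [n] z * weight l (branch [n] z)" .
  have "p * (of_real d * y - of_real b) = of_real d * (p * y) - of_real b * p" by (simp add: algebra_simps)
  then have pq': "of_real b * z - of_real (n * w * b - d) = p * (of_real d * y - of_real b)"
    unfolding py by (simp add: p_def algebra_simps)
  have "branch (n # l) z = (p * (of_real d * y - of_real b)) / (p * q)"
    unfolding branch_def mc prod.case pq pq' ..
  also have "\<dots> = branch l y" using p0 by (simp add: branch_def m q_def)
  finally show "branch (n # l) z = branch l (branch [n] z)" by (simp add: y_def)
qed

text \<open>The effect of conjugating by the diagonal matrix with entries
  \<open>sqrt (i + 1)\<close>: the factors telescope in products and equal 1 on the diagonal, so
  traces are unchanged.\<close>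

definition conj_factor :: "nat \<Rightarrow> nat \<Rightarrow> real" where
  "conj_factor i j = sqrt ((real j + 1) / (real i + 1))"

lemma conj_factor_mult: "conj_factor i k * conj_factor k j = conj_factor i j"
  by (simp add: conj_factor_def real_sqrt_mult[symmetric])

definition word_entry :: "int list \<Rightarrow> nat \<Rightarrow> nat \<Rightarrow> complex" where
  "word_entry l i j = of_real (conj_factor i j) * taylor (\<lambda>z. weight l z * branch l z ^ j) i"

lemma word_entry_Cons_sums:
  assumes n: "n \<noteq> 0" and l: "0 \<notin> set l"
  shows "(\<lambda>k. word_entry [n] i k * word_entry l k j) sums word_entry (n # l) i j"
proof -
  have sub: "ball 0 1 \<subseteq> ball (0::complex) (w / 2)" using w by auto
  have "(\<lambda>k. taylor (\<lambda>z. weight [n] z * branch [n] z ^ k) i * taylor (\<lambda>z. weight l z * branch l z ^ j) k)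
     sums taylor (\<lambda>z. weight [n] z * (weight l (branch [n] z) * branch l (branch [n] z) ^ j)) i"
  proof (rule taylor_compose_sums[of "\<lambda>z. weight l z * branch l z ^ j" _ _ "2 / w"])
    show "(\<lambda>z. weight l z * branch l z ^ j) holomorphic_on ball 0 1"
      by (rule holomorphic_on_subset[OF _ sub]) (intro holomorphic_intros weight_holomorphic branch_holomorphic l)
    show "weight [n] holomorphic_on ball 0 1" "branch [n] holomorphic_on ball 0 1"
      using weight_holomorphic[of "[n]"] branch_holomorphic[of "[n]"] n sub by (auto intro: holomorphic_on_subset)
    show "norm (branch [n] z) \<le> 2 / w" if "norm z < 1" for z
      using norm_branch_le[OF letter_nz[OF n], of z] that w by simp
  qed (use w in auto)
  also have "taylor (\<lambda>z. weight [n] z * (weight l (branch [n] z) * branch l (branch [n] z) ^ j)) i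
      = taylor (\<lambda>z. weight (n # l) z * branch (n # l) z ^ j) i"
    by (rule taylor_cong[of "w / 2"]) (use w weight_branch_Cons[OF n l] in auto)
  finally have "(\<lambda>k. of_real (conj_factor i j) * (taylor (\<lambda>z. weight [n] z * branch [n] z ^ k) i * taylor (\<lambda>z. weight l z * branch l z ^ j) k))
     sums word_entry (n # l) i j" unfolding word_entry_def by (rule sums_mult)
  moreover have "of_real (conj_factor i j) * (taylor (\<lambda>z. weight [n] z * branch [n] z ^ k) i * taylor (\<lambda>z. weight l z * branch l z ^ j) k)
    = word_entry [n] i k * word_entry l k j" for k
    unfolding word_entry_def conj_factor_mult[of i k j, symmetric] by (simp add: mult_ac)
  ultimately show ?thesis by simp
qed

lemma word_entry_Nil: "word_entry [] i j = (if i = j then 1 else 0)"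
proof -
  have "taylor (\<lambda>z. weight [] z * branch [] z ^ j) i = (if i = j then 1 else 0)"
  proof (rule taylor_eqI[of 1])
    fix z :: complex
    have "(\<lambda>k. if k = j then z ^ j else 0) sums z ^ j" by (rule sums_single)
    moreover have "(if k = j then 1 else 0) * z ^ k = (if k = j then z ^ j else 0)" for k by simp
    ultimately show "(\<lambda>k. (if k = j then 1 else 0) * z ^ k) sums (weight [] z * branch [] z ^ j)"
      by (simp add: weight_def branch_def)
  qed simp
  then show ?thesis by (simp add: word_entry_def conj_factor_def)
qed

text \<open>With \<open>\<sigma> = sgn n\<close> and \<open>p = \<bar>n\<bar> * w\<close>, the image
  of \<open>z ^ j\<close> is a constant times
  \<open>(1 - \<sigma> * z / p) powr (- (2 * s + j))\<close>, expanded by the binomial series. The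
  sign collects \<open>\<sigma> ^ j\<close> from the branch and \<open>\<sigma> ^ i\<close> from the
  expansion.\<close>

lemma word_entry_letter:
  assumes n: "n \<noteq> 0"
  shows "word_entry [n] i j = of_real (sgn (of_int n) ^ (i + j) * \<bar>of_int n\<bar> powr (- (2 * s + real i + real j)) * (w powr (- 2 * s) * entry_bound (2 * s) i j))"
proof -
  define \<sigma> where "\<sigma> = sgn (real_of_int n)"
  define p where "p = \<bar>real_of_int n\<bar> * w"
  have \<sigma>: "\<bar>\<sigma>\<bar> = 1" "\<sigma> * \<sigma> = 1" using n by (auto simp: \<sigma>_def sgn_if)
  have nw: "of_int n * w = \<sigma> * p" by (simp add: \<sigma>_def p_def sgn_mult_abs flip: mult.assoc)
  have p: "p \<ge> w" using abs_letter[OF n] w by (simp add: p_def abs_mult)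
  then have p0: "p > 0" using w by simp
  have m: "word_mat w [n] = (of_int n * w, - 1, 1, 0)" by simp
  have sg: "sgn (of_int n * w) = \<sigma>" using w by (simp add: \<sigma>_def sgn_mult)
  define a where "a = (\<lambda>i. of_real (\<sigma> ^ j * p powr (- (2 * s + real j)) * rising_binomial (2 * s + real j) i * (\<sigma> / p) ^ i) :: complex)"
  have "taylor (\<lambda>z. weight [n] z * branch [n] z ^ j) i = a i"
  proof (rule taylor_eqI[of 1])
    fix z :: complex assume z: "norm z < 1"
    define v where "v = 1 - of_real (\<sigma> / p) * z"
    have nv: "norm (of_real (\<sigma> / p) * z) < 1"
    proof -
      have "norm (of_real (\<sigma> / p) * z) = norm z / p" using \<sigma> p0 by (simp add: norm_mult norm_divide abs_divide)
      also have "\<dots> < 1" using z p w by simp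
      finally show ?thesis .
    qed
    have "\<bar>Re (of_real (\<sigma> / p) * z)\<bar> < 1" using abs_Re_le_cmod nv by (rule le_less_trans)
    then have Rv: "Re v > 0" unfolding v_def minus_complex.sel one_complex.sel by linarith
    have v0: "v \<noteq> 0" using Rv by auto
    have den: "of_real \<sigma> * (of_real (of_int n * w) - z) = of_real p * v"
    proof -
      have "of_real p * v = of_real p - of_real \<sigma> * z" using p0 by (simp add: v_def right_diff_distrib)
      moreover have "\<sigma> * (\<sigma> * p) = p" using \<sigma>(2) by (simp flip: mult.assoc)
      ultimately show ?thesis unfolding nw right_diff_distrib by (simp flip: of_real_mult)
    qed
    have W: "weight [n] z = of_real (p powr (- 2 * s)) * v powr of_real (- 2 * s)"
    proof -
      have "weight [n] z = (of_real p * v) powr of_real (- 2 * s)"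
        unfolding weight_def m prod.case sg using den by simp
      also have "\<dots> = of_real p powr of_real (- 2 * s) * v powr of_real (- 2 * s)"
        by (rule powr_mult_right_half_plane) (use p0 Rv in auto)
      finally show ?thesis unfolding powr_of_real[OF less_imp_le[OF p0]] .
    qed
    have B: "branch [n] z = of_real \<sigma> / (of_real p * v)"
    proof -
      have "of_real (of_int n * w) - z = of_real \<sigma> * (of_real p * v)"
        unfolding den[symmetric] using \<sigma>(2) by (simp flip: of_real_mult mult.assoc)
      moreover have "of_real \<sigma> \<noteq> (0::complex)" using \<sigma> by auto
      moreover have "1 / of_real \<sigma> = (of_real \<sigma> :: complex)"
        using \<sigma>(2) \<open>of_real \<sigma> \<noteq> 0\<close> by (simp add: field_simps flip: of_real_mult)
      ultimately show ?thesis unfolding branch_def m prod.case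
        by (simp add: divide_simps)
    qed
    have "branch [n] z ^ j = of_real (\<sigma> ^ j * p powr (- real j)) * v powr of_real (- real j)"
    proof -
      have "v powr of_real (- real j) = 1 / v ^ j" using v0 by (simp add: powr_minus powr_nat' divide_inverse)
      moreover have "p powr (- real j) = 1 / p ^ j" using p0 by (simp add: powr_minus powr_realpow divide_inverse)
      ultimately show ?thesis unfolding B by (simp add: power_divide power_mult_distrib)
    qed
    then have "weight [n] z * branch [n] z ^ j = of_real (\<sigma> ^ j * (p powr (- 2 * s) * p powr (- real j))) * (v powr of_real (- 2 * s) * v powr of_real (- real j))"
      unfolding W by (simp add: mult_ac)
    also have "p powr (- 2 * s) * p powr (- real j) = p powr (- (2 * s + real j))" by (simp flip: powr_add)
    also have "v powr of_real (- 2 * s) * v powr of_real (- real j) = v powr (- of_real (2 * s + real j))"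
      by (simp flip: powr_add)
    finally have f: "weight [n] z * branch [n] z ^ j = of_real (\<sigma> ^ j * p powr (- (2 * s + real j))) * v powr (- of_real (2 * s + real j))" .
    have "(\<lambda>i. (-1) ^ i * ((of_real (2 * s + real j) + of_nat i - 1) gchoose i) * (- (of_real (\<sigma> / p) * z)) ^ i) sums (1 + - (of_real (\<sigma> / p) * z)) powr (- of_real (2 * s + real j))"
      by (rule one_plus_neg_powr_powser) (use nv in simp)
    then have "(\<lambda>i. (-1) ^ i * rising_binomial (of_real (2 * s + real j)) i * (- (of_real (\<sigma> / p) * z)) ^ i) sums v powr (- of_real (2 * s + real j))"
      unfolding gbinomial_conv_rising by (simp add: v_def)
    from sums_mult[OF this, of "of_real (\<sigma> ^ j * p powr (- (2 * s + real j)))"]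
    show "(\<lambda>i. a i * z ^ i) sums (weight [n] z * branch [n] z ^ j)"
      unfolding f
    proof (rule sums_cong[THEN iffD1, rotated])
      fix i
      have "(-1) ^ i * (- (of_real (\<sigma> / p) * z)) ^ i = (of_real (\<sigma> / p) ^ i * z ^ i :: complex)"
        by (simp add: power_mult_distrib[symmetric] flip: power_mult_distrib)
      moreover have "rising_binomial (complex_of_real (2 * s + real j)) i = of_real (rising_binomial (2 * s + real j) i)"
        using pochhammer_of_real[of "2 * s + real j" i, where ?'a = complex] by (simp add: rising_binomial_def)
      ultimately show "of_real (\<sigma> ^ j * p powr (- (2 * s + real j))) * ((-1) ^ i * rising_binomial (of_real (2 * s + real j)) i * (- (of_real (\<sigma> / p) * z)) ^ i) = a i * z ^ i"
        unfolding a_def by (simp add: mult_ac)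
    qed
  qed simp
  moreover have "p powr (- (2 * s + real j)) * (\<sigma> / p) ^ i = \<sigma> ^ i * (\<bar>of_int n\<bar> powr (- (2 * s + real i + real j)) * (w powr (- 2 * s) * w powr (- (real i + real j))))"
  proof -
    have "p powr (- (2 * s + real j)) * (\<sigma> / p) ^ i = \<sigma> ^ i * (p powr (- (2 * s + real j)) * p powr (- real i))"
      using p0 by (simp add: powr_minus powr_realpow divide_inverse power_mult_distrib power_inverse)
    also have "p powr (- (2 * s + real j)) * p powr (- real i) = p powr (- (2 * s + real i + real j))"
      by (simp add: algebra_simps flip: powr_add)
    also have "\<dots> = \<bar>of_int n\<bar> powr (- (2 * s + real i + real j)) * w powr (- (2 * s + real i + real j))"
      unfolding p_def using w by (simp add: powr_mult)
    also have "w powr (- (2 * s + real i + real j)) = w powr (- 2 * s) * w powr (- (real i + real j))"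
      by (simp add: algebra_simps flip: powr_add)
    finally show ?thesis .
  qed
  ultimately show ?thesis
    unfolding word_entry_def a_def entry_bound_def conj_factor_def \<sigma>_def[symmetric]
    by (simp add: power_add mult_ac flip: of_real_mult)
qed

text \<open>Here \<open>\<mu> = a - c x\<close> satisfies \<open>z - \<psi> z = (z - x) ((a - c z) - 1 / \<mu>) / (a - c z)\<close>.\<close>

lemma word_trace_sums:
  assumes l: "l \<in> nz_words"
  shows "(\<lambda>i. word_entry l i i) sums of_real (exp (- s * word_length l) / (1 - exp (- word_length l)))"
proof -
  have l0: "0 \<notin> set l" using l by (simp add: nz_words_def)
  obtain a b c d where m: "word_mat w l = (a, b, c, d)" by (metis prod_cases4)
  obtain x where x: "\<bar>x\<bar> < 1" "c * x\<^sup>2 + (d - a) * x - b = 0" "\<bar>a - c * x\<bar> \<ge> w - 1"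
    "(a - c * x) * (d + c * x) = 1" "word_length l = 2 * ln \<bar>a - c * x\<bar>"
    by (rule word_length_fixed_point[OF m l]) blast
  define \<mu> where "\<mu> = a - c * x"
  have mu: "\<bar>\<mu>\<bar> > 1" using x w by (simp add: \<mu>_def)
  then have mu0: "\<mu> \<noteq> 0" by auto
  have imu: "d + c * x = 1 / \<mu>" using x(4) mu0 by (simp add: \<mu>_def field_simps)
  have den: "norm (of_real a - of_real c * z) \<ge> w - 1" if "norm z \<le> 1" for z :: complex
    using word_mat_denom[OF m l0 that] word_mat_dominant(3)[OF m l0] l by (simp add: nz_words_def)
  \<comment> \<open>On the closed disc \<open>a - c * z\<close> has modulus at least
    \<open>w - 1 > 1\<close>, whereas \<open>1 / \<bar>\<mu>\<bar> < 1\<close>; so the fixed point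
    \<open>x\<close> is the only pole.\<close>
  have ne: "of_real a - of_real c * z - of_real (1 / \<mu>) \<noteq> (0::complex)" if "norm z \<le> 1" for z
  proof
    assume "of_real a - of_real c * z - of_real (1 / \<mu>) = (0::complex)"
    then have "norm (of_real a - of_real c * z) = norm (complex_of_real (1 / \<mu>))" by simp
    also have "\<dots> = 1 / \<bar>\<mu>\<bar>" by (simp only: norm_of_real abs_divide abs_one)
    also have "\<dots> < 1" using mu by simp
    finally show False using den[OF that] w by simp
  qed
  \<comment> \<open>The regular factor left when the simple pole at \<open>x\<close> is split off
    from \<open>weight l z / (z - branch l z)\<close>.\<close>
  define g where "g = (\<lambda>z. weight l z * (of_real a - of_real c * z) / (of_real a - of_real c * z - of_real (1 / \<mu>)))"
  have sub: "cball 0 1 \<subseteq> ball (0::complex) (w / 2)" using w by auto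
  have wh: "weight l holomorphic_on cball 0 1" by (rule holomorphic_on_subset[OF weight_holomorphic[OF l0] sub])
  have gh: "g holomorphic_on cball 0 1" unfolding g_def using ne by (intro holomorphic_intros wh) auto
  have "(\<lambda>i. taylor (\<lambda>z. weight l z * branch l z ^ i) i) sums g (of_real x)"
  proof (rule taylor_trace_sums[where R = "w / 2" and r = "2 / w" and g = g])
    show "continuous_on (cball 0 1) g" by (rule holomorphic_on_imp_continuous_on[OF gh])
    show "g holomorphic_on ball 0 1" by (rule holomorphic_on_subset[OF gh]) auto
    show "weight l z / (z - branch l z) = g z / (z - of_real x)" if z: "norm z = 1" for z
    proof -
      define D where "D = of_real a - of_real c * z"
      have D: "D \<noteq> 0" unfolding D_def using den[of z] z w by auto
      have zx: "z - of_real x \<noteq> 0" using z x(1) by auto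
      have "of_real d + of_real c * of_real x = complex_of_real (1 / \<mu>)" by (simp only: imu[symmetric] of_real_add of_real_mult)
      moreover have b: "of_real b = complex_of_real c * of_real x ^ 2 + (of_real d - of_real a) * of_real x"
      proof -
        have "b = c * x\<^sup>2 + (d - a) * x" using x(2) by simp
        then show ?thesis by simp
      qed
      ultimately have e: "complex_of_real (1 / \<mu>) = of_real d + of_real c * of_real x" by simp
      have "z * D - (of_real d * z - of_real b) = (z - of_real x) * (D - of_real (1 / \<mu>))"
        unfolding e b D_def by (simp add: algebra_simps power2_eq_square)
      moreover have "z - branch l z = (z * D - (of_real d * z - of_real b)) / D"
        unfolding branch_def m prod.case D_def[symmetric] using D by (simp add: field_simps)
      ultimately have zb: "z - branch l z = (z - of_real x) * (D - of_real (1 / \<mu>)) / D" by simp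
      show ?thesis unfolding g_def D_def[symmetric] zb by (simp add: mult.commute)
    qed
    show "norm (branch l z) \<le> 2 / w" if "norm z = 1" for z
      using norm_branch_le[OF l, of z] that w by simp
  qed (use w x weight_holomorphic[OF l0] branch_holomorphic[OF l0] in auto)
  moreover have "g (of_real x) = of_real (exp (- s * word_length l) / (1 - exp (- word_length l)))"
  proof -
    have "complex_of_real a - of_real c * of_real x = of_real \<mu>" by (simp add: \<mu>_def)
    moreover have "weight l (of_real x) = of_real (\<bar>\<mu>\<bar> powr (- 2 * s))"
    proof -
      have r: "Re (of_real (sgn a) * (of_real a - of_real c * complex_of_real x)) > 0"
        by (rule denom_Re_pos[OF m l0]) (use x w in simp)
      have "of_real (sgn a) * (of_real a - of_real c * complex_of_real x) = of_real (sgn a * \<mu>)" by (simp add: \<mu>_def)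
      moreover have "sgn a * \<mu> > 0" using r unfolding calculation by simp
      then have "sgn a * \<mu> = \<bar>sgn a * \<mu>\<bar>" by simp
      then have "sgn a * \<mu> = \<bar>sgn a\<bar> * \<bar>\<mu>\<bar>" unfolding abs_mult .
      moreover have "\<bar>sgn a\<bar> = 1" using \<open>sgn a * \<mu> > 0\<close> by (auto simp: abs_sgn_eq)
      ultimately have "weight l (of_real x) = complex_of_real \<bar>\<mu>\<bar> powr of_real (- 2 * s)"
        unfolding weight_def m prod.case by simp
      also have "\<dots> = of_real (\<bar>\<mu>\<bar> powr (- 2 * s))" by (rule powr_of_real) simp
      finally show ?thesis .
    qed
    ultimately have "g (of_real x) = of_real (\<bar>\<mu>\<bar> powr (- 2 * s) * \<mu> / (\<mu> - 1 / \<mu>))" by (simp add: g_def)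
    moreover have "\<bar>\<mu>\<bar> powr (- 2 * s) * \<mu> / (\<mu> - 1 / \<mu>) = \<bar>\<mu>\<bar> powr (- 2 * s) / (1 - 1 / \<mu>\<^sup>2)"
    proof -
      have "\<mu> - 1 / \<mu> = \<mu> * (1 - 1 / \<mu>\<^sup>2)" using mu0 by (simp add: field_simps power2_eq_square)
      then show ?thesis using mu0 by simp
    qed
    moreover have "exp (- s * word_length l) = \<bar>\<mu>\<bar> powr (- 2 * s)"
      unfolding x(5) \<mu>_def[symmetric] using mu0 by (simp add: powr_def mult_ac)
    moreover have "exp (- word_length l) = 1 / \<mu>\<^sup>2"
    proof -
      have "exp (- word_length l) = \<bar>\<mu>\<bar> powr (- 2)" unfolding x(5) \<mu>_def[symmetric] using mu0 by (simp add: powr_def)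
      also have "\<dots> = 1 / \<mu>\<^sup>2" using mu0 powr_realpow[of "\<bar>\<mu>\<bar>" 2] by (simp add: powr_minus_divide)
      finally show ?thesis .
    qed
    ultimately show ?thesis by (simp only:)
  qed
  ultimately show ?thesis by (simp add: word_entry_def conj_factor_def)
qed

end

section \<open>The transfer operator for real parameters\<close>

lemma nonzero_int_decomp:
  "range (\<lambda>k. int (Suc k)) \<union> range (\<lambda>k. - int (Suc k)) = UNIV - {0}"
proof (intro equalityI subsetI)
  fix n :: int assume "n \<in> UNIV - {0}"
  then have "n = int (Suc (nat (n - 1))) \<or> n = - int (Suc (nat (- n - 1)))" by auto
  then show "n \<in> range (\<lambda>k. int (Suc k)) \<union> range (\<lambda>k. - int (Suc k))" by blast
qed auto

lemma int_nonzero_powr_summable: "(\<lambda>n::int. \<bar>real_of_int n\<bar> powr (- 2)) summable_on UNIV - {0}"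
proof -
  have h: "(\<lambda>k. real (Suc k) powr (- 2)) summable_on UNIV"
    using summable_ignore_initial_segment[of "\<lambda>n. real n powr (- 2)" 1]
    by (subst summable_on_UNIV_nonneg_real_iff) (auto simp: summable_real_powr_iff)
  have P: "(\<lambda>n::int. \<bar>real_of_int n\<bar> powr (- 2)) summable_on range (\<lambda>k. int (Suc k))"
    by (subst summable_on_reindex) (use h in \<open>auto simp: inj_on_def o_def add.commute\<close>)
  have M: "(\<lambda>n::int. \<bar>real_of_int n\<bar> powr (- 2)) summable_on range (\<lambda>k. - int (Suc k))"
    by (subst summable_on_reindex) (use h in \<open>auto simp: inj_on_def o_def add.commute\<close>)
  note nonzero_int_decomp
  moreover have "range (\<lambda>k. int (Suc k)) \<inter> range (\<lambda>k. - int (Suc k)) = {}" by auto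
  ultimately show ?thesis using summable_on_Un_disjoint[OF P M] by simp
qed

context hecke_real
begin

abbreviation nonzero :: "int set" where "nonzero \<equiv> UNIV - {0}"

lemma norm_word_entry_letter_le:
  assumes n: "n \<in> nonzero"
  shows "norm (word_entry [n] i k) \<le> \<bar>of_int n\<bar> powr (- 2) * (w powr (- 2 * s) * entry_bound (2 * s) i k)"
proof -
  have n0: "n \<noteq> 0" using n by simp
  have n1: "\<bar>real_of_int n\<bar> \<ge> 1" using n0 by linarith
  have e0: "entry_bound (2 * s) i k \<ge> 0" using s by (intro entry_bound_nonneg) auto
  have "\<bar>sgn (real_of_int n) ^ (i + k)\<bar> = 1" using n0 by (simp add: power_abs abs_sgn_eq)
  then have "norm (word_entry [n] i k) = \<bar>of_int n\<bar> powr (- (2 * s + real i + real k)) * (w powr (- 2 * s) * entry_bound (2 * s) i k)"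
    unfolding word_entry_letter[OF n0] norm_of_real abs_mult using e0 by simp
  also have "\<dots> \<le> \<bar>of_int n\<bar> powr (- 2) * (w powr (- 2 * s) * entry_bound (2 * s) i k)"
    using n1 s e0 by (intro mult_right_mono powr_mono) auto
  finally show ?thesis .
qed

definition letter_sum :: real where
  "letter_sum = (\<Sum>\<^sub>\<infinity>n\<in>nonzero. \<bar>real_of_int n\<bar> powr (- 2))"

lemma letters_summable:
  shows "(\<lambda>(i, n, k). word_entry [n] i k) abs_summable_on UNIV \<times> (nonzero \<times> UNIV)"
    "(\<Sum>\<^sub>\<infinity>(i, n, k)\<in>UNIV \<times> (nonzero \<times> UNIV). norm (word_entry [n] i k)) \<le> letter_sum * (w powr (- 2 * s) * entry_bound_total (2 * s))"
proof -
  have s0: "2 * s \<ge> 0" using s by simp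
  define u where "u = (\<lambda>n::int. \<bar>real_of_int n\<bar> powr (- 2))"
  define v where "v = (\<lambda>p. w powr (- 2 * s) * entry_bound (2 * s) (fst p) (snd p))"
  have u: "u summable_on nonzero" unfolding u_def by (rule int_nonzero_powr_summable)
  have v: "v summable_on UNIV" "infsum v UNIV \<le> w powr (- 2 * s) * entry_bound_total (2 * s)"
    using entry_bound_summable[OF s0] unfolding v_def infsum_cmult_right'
    by (auto simp: case_prod_unfold simp del: mult_minus_left intro!: summable_on_cmult_right mult_left_mono)
  have u0: "u n \<ge> 0" and v0: "v p \<ge> 0" for n p
    using entry_bound_nonneg[OF s0] by (auto simp: u_def v_def)
  define f where "f = (\<lambda>(n, p). u n * v p)"
  have vle: "(\<lambda>y. f (n, y)) summable_on UNIV" "(\<Sum>\<^sub>\<infinity>y. f (n, y)) \<le> u n * (w powr (- 2 * s) * entry_bound_total (2 * s))" for n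
    unfolding f_def using v u0[of n] by (auto simp: infsum_cmult_right' intro!: summable_on_cmult_right mult_left_mono)
  have f0: "f (n, p) \<ge> 0" for n p using u0 v0 by (simp add: f_def)
  note S = summable_on_Sigma_bound[of nonzero "\<lambda>_. UNIV" f, OF f0 vle summable_on_cmult_left[OF u]]
  have total: "(\<Sum>\<^sub>\<infinity>n\<in>nonzero. u n * (w powr (- 2 * s) * entry_bound_total (2 * s))) = letter_sum * (w powr (- 2 * s) * entry_bound_total (2 * s))"
    by (simp add: infsum_cmult_left' letter_sum_def u_def)
  have bij: "bij_betw (\<lambda>(i, n, k). (n, (i, k))) ((UNIV::nat set) \<times> (nonzero \<times> (UNIV::nat set))) (nonzero \<times> UNIV)"
    by (rule bij_betwI[where g = "\<lambda>(n, (i, k)). (i, n, k)"]) auto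
  define f' where "f' = (\<lambda>(i, n, k). f (n, (i, k)))"
  have f': "f' summable_on UNIV \<times> (nonzero \<times> UNIV)" "infsum f' (UNIV \<times> (nonzero \<times> UNIV)) \<le> letter_sum * (w powr (- 2 * s) * entry_bound_total (2 * s))"
    using S(1) S(2)[unfolded total] summable_on_reindex_bij_betw[OF bij, of f] infsum_reindex_bij_betw[OF bij, of f]
    by (simp_all add: f'_def case_prod_unfold)
  have le: "norm (word_entry [fst (snd p)] (fst p) (snd (snd p))) \<le> f' p" if "p \<in> UNIV \<times> (nonzero \<times> UNIV)" for p
    using norm_word_entry_letter_le[of "fst (snd p)" "fst p" "snd (snd p)"] that
    unfolding f'_def f_def u_def v_def by (simp add: case_prod_unfold mem_Times_iff)
  have s1: "(\<lambda>p. norm (word_entry [fst (snd p)] (fst p) (snd (snd p)))) summable_on UNIV \<times> (nonzero \<times> UNIV)"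
    by (rule summable_on_comparison_test[OF f'(1)]) (use le in auto)
  then show "(\<lambda>(i, n, k). word_entry [n] i k) abs_summable_on UNIV \<times> (nonzero \<times> UNIV)"
    by (simp add: case_prod_unfold)
  have "infsum (\<lambda>p. norm (word_entry [fst (snd p)] (fst p) (snd (snd p)))) (UNIV \<times> (nonzero \<times> UNIV)) \<le> infsum f' (UNIV \<times> (nonzero \<times> UNIV))"
    by (rule infsum_mono[OF s1 f'(1) le])
  then show "(\<Sum>\<^sub>\<infinity>(i, n, k)\<in>UNIV \<times> (nonzero \<times> UNIV). norm (word_entry [n] i k)) \<le> letter_sum * (w powr (- 2 * s) * entry_bound_total (2 * s))"
    using f'(2) by (simp add: case_prod_unfold)
qed

sublocale N: nuclear_family "\<lambda>n. word_entry [n]" nonzero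
  by unfold_locales (rule letters_summable(1))

lemma total_norm_le: "N.total_norm \<le> letter_sum * (w powr (- 2 * s) * entry_bound_total (2 * s))"
proof -
  have "N.total_norm = (\<Sum>\<^sub>\<infinity>p\<in>UNIV \<times> (nonzero \<times> UNIV). norm (word_entry [fst (snd p)] (fst p) (snd (snd p))))"
    unfolding N.total_norm_def N.row_norm_def
    using infsum_Sigma'_banach[of "\<lambda>i p. norm (word_entry [fst p] i (snd p))" UNIV "\<lambda>_. nonzero \<times> UNIV"] letters_summable(1)
    by (simp add: case_prod_unfold)
  then show ?thesis using letters_summable(2) by (simp add: case_prod_unfold)
qed

text \<open>The letters \<open>k + 1\<close> and \<open>- (k + 1)\<close> contribute equally up to
  the sign \<open>(-1) ^ (i + j)\<close>. For even \<open>i + j\<close> they double the Dirichlet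
  series, for odd \<open>i + j\<close> they cancel: hence the factor 2 and the zero pattern of
  \<open>L_entry\<close>.\<close>

lemma L_eq: "N.L i j = L_entry w (of_real s) i j"
proof -
  define t where "t = 2 * s + real i + real j"
  have t: "t > 1" using s by (simp add: t_def)
  define c where "c = w powr (- 2 * s) * entry_bound (2 * s) i j"
  define Z where "Z = (\<Sum>k. real (Suc k) powr (- t))"
  have hs: "summable (\<lambda>k. real (Suc k) powr (- t))"
    using summable_ignore_initial_segment[of "\<lambda>n. real n powr (- t)" 1] t by (simp add: summable_real_powr_iff)
  have h: "((\<lambda>k. real (Suc k) powr (- t)) has_sum Z) UNIV"
    unfolding Z_def using summable_sums[OF hs] by (intro sums_nonneg_imp_has_sum) auto
  have zeta: "Riemann_zeta (of_real t) = of_real Z"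
  proof -
    have "(\<lambda>k. 1 / of_nat (Suc k) powr complex_of_real t) sums Riemann_zeta (of_real t)"
      using t by (intro Riemann_zeta_sums) simp
    moreover have "1 / of_nat (Suc k) powr complex_of_real t = of_real (real (Suc k) powr (- t))" for k
      using powr_of_real[of "real (Suc k)" t] by (simp add: powr_minus_divide)
    moreover have "(\<lambda>k. complex_of_real (real (Suc k) powr (- t))) sums of_real Z"
      unfolding Z_def using summable_sums[OF hs] by (rule sums_of_real)
    ultimately show ?thesis by (simp add: sums_iff)
  qed
  define f where "f = (\<lambda>n::int. sgn (real_of_int n) ^ (i + j) * \<bar>of_int n\<bar> powr (- t) * c)"
  have wf: "word_entry [n] i j = of_real (f n)" if "n \<in> nonzero" for n
    using word_entry_letter[of n i j] that by (simp add: f_def t_def c_def mult_ac)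
  have P: "(f has_sum (Z * c)) (range (\<lambda>k. int (Suc k)))"
  proof (subst has_sum_reindex)
    show "inj (\<lambda>k. int (Suc k))" by (auto simp: inj_on_def)
    have "f \<circ> (\<lambda>k. int (Suc k)) = (\<lambda>k. real (Suc k) powr (- t) * c)" by (auto simp: f_def)
    then show "(f \<circ> (\<lambda>k. int (Suc k)) has_sum Z * c) UNIV" using has_sum_cmult_left[OF h, of c] by simp
  qed
  have M: "(f has_sum ((-1) ^ (i + j) * (Z * c))) (range (\<lambda>k. - int (Suc k)))"
  proof (subst has_sum_reindex)
    show "inj (\<lambda>k. - int (Suc k))" by (auto simp: inj_on_def)
    have "f \<circ> (\<lambda>k. - int (Suc k)) = (\<lambda>k. (-1) ^ (i + j) * (real (Suc k) powr (- t) * c))"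
    proof
      fix k
      have "real_of_int (- int (Suc k)) = - real (Suc k)" by simp
      moreover have "sgn (- real (Suc k)) = -1" by simp
      ultimately show "(f \<circ> (\<lambda>k. - int (Suc k))) k = (-1) ^ (i + j) * (real (Suc k) powr (- t) * c)"
        unfolding f_def o_def by (simp only: abs_minus abs_of_nat mult.assoc)
    qed
    then show "(f \<circ> (\<lambda>k. - int (Suc k)) has_sum (-1) ^ (i + j) * (Z * c)) UNIV"
      using has_sum_cmult_right[OF has_sum_cmult_left[OF h, of c], of "(-1) ^ (i + j)"] by simp
  qed
  note nonzero_int_decomp
  moreover have "range (\<lambda>k. int (Suc k)) \<inter> range (\<lambda>k. - int (Suc k)) = {}" by auto
  ultimately have "(f has_sum (Z * c + (-1) ^ (i + j) * (Z * c))) nonzero"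
    using has_sum_Un_disjoint[OF P M] by simp
  then have "((\<lambda>n. complex_of_real (f n)) has_sum of_real (Z * c + (-1) ^ (i + j) * (Z * c))) nonzero"
    by (rule has_sum_of_real)
  then have L: "N.L i j = of_real (Z * c + (-1) ^ (i + j) * (Z * c))"
    unfolding N.L_def using infsum_cong[of nonzero "\<lambda>n. word_entry [n] i j" "\<lambda>n. of_real (f n)"] wf by (simp add: infsumI)
  show ?thesis
  proof (cases "even (i + j)")
    case True
    have "complex_of_real w powr of_real t = of_real (w powr t)" using w by (simp add: powr_of_real)
    moreover have "of_real t = 2 * complex_of_real s + of_nat i + of_nat j" by (simp add: t_def)
    moreover have "(2 * complex_of_real s + of_nat i + of_nat j - 1) gchoose i = of_real (rising_binomial (2 * s + real j) i)"
      using gbinomial_conv_rising[of "2 * complex_of_real s + of_nat j" i]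
        pochhammer_of_real[of "2 * s + real j" i, where ?'a = complex] by (simp add: rising_binomial_def add_ac)
    ultimately have "L_entry w (of_real s) i j = of_real (2 * sqrt ((real j + 1) / (real i + 1)) * (Z / w powr t) * rising_binomial (2 * s + real j) i)"
      using True zeta by (simp add: L_entry_def)
    moreover have "Z / w powr t = Z * (w powr (- 2 * s) * w powr (- (real i + real j)))"
      using powr_minus_divide[of w t] by (simp add: t_def algebra_simps flip: powr_add)
    ultimately show ?thesis unfolding L using True by (simp add: c_def entry_bound_def mult_ac)
  next
    case False
    then show ?thesis unfolding L by (simp add: L_entry_def)
  qed
qed

lemma words_over_nonzero: "l \<in> words_over nonzero m \<longleftrightarrow> 0 \<notin> set l \<and> length l = m"
  by (auto simp: words_over_def)

text \<open>\<open>Mp\<close> is built with unordered sums, while \<open>word_entry\<close> composes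
  by series. The entries for the tail word are bounded, so the products are absolutely summable and
  both sums have the same value.\<close>

lemma Mp_eq: "0 \<notin> set l \<Longrightarrow> N.Mp l i j = word_entry l i j"
proof (induction l arbitrary: i)
  case Nil
  then show ?case by (simp add: word_entry_Nil)
next
  case (Cons n l)
  then have n: "n \<in> nonzero" and l: "0 \<notin> set l" by auto
  have b: "norm (N.Mp l k j) \<le> N.total_norm ^ length l" for k
    by (rule order_trans[OF N.norm_Mp_le N.row_bound_le]) (use l in \<open>simp add: words_over_nonzero\<close>)
  have "(\<lambda>k. word_entry [n] i k * N.Mp l k j) abs_summable_on UNIV"
  proof (rule Infinite_Sum.abs_summable_on_comparison_test')
    show "(\<lambda>k. norm (word_entry [n] i k) * N.total_norm ^ length l) summable_on UNIV"
      by (rule summable_on_cmult_left[OF N.A_row_summable[OF n]])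
    show "norm (word_entry [n] i k * N.Mp l k j) \<le> norm (word_entry [n] i k) * N.total_norm ^ length l" for k
      unfolding norm_mult by (rule mult_left_mono[OF b]) simp
  qed
  from has_sum_imp_sums[OF has_sum_infsum[OF Infinite_Sum.abs_summable_summable[OF this]]]
  have "(\<lambda>k. word_entry [n] i k * N.Mp l k j) sums N.Mp (n # l) i j" by simp
  moreover have "(\<lambda>k. word_entry [n] i k * N.Mp l k j) sums word_entry (n # l) i j"
    using word_entry_Cons_sums[of n l i j] n l Cons.IH[OF l] by simp
  ultimately show ?case by (rule sums_unique2)
qed

definition trace_value :: "int list \<Rightarrow> real" where
  "trace_value l = exp (- s * word_length l) / (1 - exp (- word_length l))"

lemma trace_value_nonneg: "l \<in> nz_words \<Longrightarrow> trace_value l \<ge> 0"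
  unfolding trace_value_def using word_length_pos[of l] by auto

lemma word_trace_eq:
  assumes l: "l \<in> nz_words"
  shows "N.word_trace l = of_real (trace_value l)"
proof -
  have l0: "0 \<notin> set l" "length l > 0" using l by (auto simp: nz_words_def)
  have "(\<lambda>i. N.Mp l i i) abs_summable_on UNIV"
    by (rule Infinite_Sum.abs_summable_on_comparison_test'[OF N.row_bound_summable[OF l0(2)]])
      (rule N.norm_Mp_le, use l0 in \<open>simp add: words_over_nonzero\<close>)
  then have "(\<lambda>i. N.Mp l i i) sums N.word_trace l"
    unfolding N.word_trace_def by (rule has_sum_imp_sums[OF has_sum_infsum[OF Infinite_Sum.abs_summable_summable]])
  moreover have "(\<lambda>i. N.Mp l i i) sums of_real (trace_value l)"
    using word_trace_sums[OF l] l0 by (simp add: Mp_eq trace_value_def)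
  ultimately show ?thesis by (rule sums_unique2)
qed

lemma nz_words_bij: "bij_betw snd (Sigma UNIV (\<lambda>m. words_over nonzero (Suc m))) nz_words"
  by (rule bij_betwI[where g = "\<lambda>l. (length l - 1, l)"]) (auto simp: words_over_nonzero nz_words_def)

text \<open>The determinant formula groups words by length and divides by that length. Nonnegative
  traces and a geometric bound per length allow regrouping into one sum over all words.\<close>

lemma Z_limit_real:
  assumes small: "N.total_norm < 1"
  shows "(\<lambda>l. trace_value l / length l) summable_on nz_words"
    "Z_limit (of_real s) = exp (- of_real (\<Sum>\<^sub>\<infinity>l\<in>nz_words. trace_value l / length l))"
proof -
  define f where "f = (\<lambda>p::nat \<times> int list. trace_value (snd p) / length (snd p))"
  have mem: "l \<in> nz_words" "length l = Suc m" if "l \<in> words_over nonzero (Suc m)" for l m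
    using that by (auto simp: words_over_nonzero nz_words_def)
  have tr: "norm (N.word_trace l) = trace_value l" if "l \<in> words_over nonzero (Suc m)" for l m
    using word_trace_eq[OF mem(1)[OF that]] trace_value_nonneg[OF mem(1)[OF that]] by simp
  have tv: "trace_value summable_on words_over nonzero (Suc m)" "infsum trace_value (words_over nonzero (Suc m)) \<le> N.total_norm ^ Suc m" for m
    using N.word_trace_summable(1,2)[of "Suc m"] tr summable_on_cong[of "words_over nonzero (Suc m)" "\<lambda>l. norm (N.word_trace l)" trace_value]
      infsum_cong[of "words_over nonzero (Suc m)" "\<lambda>l. norm (N.word_trace l)" trace_value] by auto
  have fm: "f (m, l) = trace_value l * (1 / real (Suc m))" if "l \<in> words_over nonzero (Suc m)" for m l
    using mem(2)[OF that] by (simp add: f_def)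
  have fs: "(\<lambda>l. f (m, l)) summable_on words_over nonzero (Suc m)" for m
    using summable_on_cmult_left[OF tv(1)[of m], where c = "1 / real (Suc m)"] fm by (subst summable_on_cong[of _ _ "\<lambda>l. trace_value l * (1 / real (Suc m))"]) auto
  have fi: "(\<Sum>\<^sub>\<infinity>l\<in>words_over nonzero (Suc m). f (m, l)) = infsum trace_value (words_over nonzero (Suc m)) * (1 / real (Suc m))" for m
    using infsum_cong[of "words_over nonzero (Suc m)" "\<lambda>l. f (m, l)" "\<lambda>l. trace_value l * (1 / real (Suc m))"] fm
    by (simp add: infsum_cmult_left' del: times_divide_eq_right)
  have fle: "(\<Sum>\<^sub>\<infinity>l\<in>words_over nonzero (Suc m). f (m, l)) \<le> N.total_norm ^ Suc m" for m
  proof -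
    have "infsum trace_value (words_over nonzero (Suc m)) * (1 / real (Suc m)) \<le> infsum trace_value (words_over nonzero (Suc m)) * 1"
      using trace_value_nonneg mem(1) by (intro mult_left_mono infsum_nonneg) auto
    then show ?thesis using tv(2)[of m] unfolding fi by simp
  qed
  have f0: "f (m, l) \<ge> 0" if "l \<in> words_over nonzero (Suc m)" for m l
    using trace_value_nonneg[OF mem(1)[OF that]] by (simp add: f_def)
  have geo: "(\<lambda>m. N.total_norm ^ Suc m) summable_on UNIV"
  proof (subst summable_on_UNIV_nonneg_real_iff)
    show "summable (\<lambda>m. N.total_norm ^ Suc m)"
      using small N.total_norm_nonneg by (simp add: summable_mult summable_geometric)
  qed (use N.total_norm_nonneg in simp)
  have S: "f summable_on Sigma UNIV (\<lambda>m. words_over nonzero (Suc m))"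
    by (rule summable_on_Sigma_bound(1)[of _ _ f, OF f0 fs fle geo])
  then show sm: "(\<lambda>l. trace_value l / length l) summable_on nz_words"
    using summable_on_reindex_bij_betw[OF nz_words_bij, of "\<lambda>l. trace_value l / length l"] by (simp add: f_def)
  have "(\<lambda>m. \<Sum>\<^sub>\<infinity>l\<in>words_over nonzero (Suc m). f (m, l)) summable_on UNIV"
    using summable_on_Sigma_banach[of "\<lambda>m l. f (m, l)" UNIV "\<lambda>m. words_over nonzero (Suc m)"] S by (simp add: case_prod_unfold)
  then have "(\<lambda>m. \<Sum>\<^sub>\<infinity>l\<in>words_over nonzero (Suc m). f (m, l)) sums (\<Sum>\<^sub>\<infinity>m. \<Sum>\<^sub>\<infinity>l\<in>words_over nonzero (Suc m). f (m, l))"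
    by (intro has_sum_imp_sums has_sum_infsum)
  also have "(\<Sum>\<^sub>\<infinity>m. \<Sum>\<^sub>\<infinity>l\<in>words_over nonzero (Suc m). f (m, l)) = infsum f (Sigma UNIV (\<lambda>m. words_over nonzero (Suc m)))"
    using infsum_Sigma'_banach[of "\<lambda>m l. f (m, l)" UNIV "\<lambda>m. words_over nonzero (Suc m)"] S by (simp add: case_prod_unfold)
  also have "\<dots> = (\<Sum>\<^sub>\<infinity>l\<in>nz_words. trace_value l / length l)"
    using infsum_reindex_bij_betw[OF nz_words_bij, of "\<lambda>l. trace_value l / length l"] by (simp add: f_def)
  finally have "(\<lambda>m. complex_of_real (infsum trace_value (words_over nonzero (Suc m)) * (1 / real (Suc m)))) sums of_real (\<Sum>\<^sub>\<infinity>l\<in>nz_words. trace_value l / length l)"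
    unfolding fi by (rule sums_of_real)
  moreover have "(\<Sum>\<^sub>\<infinity>l\<in>words_over nonzero (Suc m). N.word_trace l) / of_nat (Suc m) = complex_of_real (infsum trace_value (words_over nonzero (Suc m)) * (1 / real (Suc m)))" for m
  proof -
    have "(\<Sum>\<^sub>\<infinity>l\<in>words_over nonzero (Suc m). N.word_trace l) = (\<Sum>\<^sub>\<infinity>l\<in>words_over nonzero (Suc m). of_real (trace_value l))"
      using word_trace_eq mem(1) by (intro infsum_cong) auto
    also have "\<dots> = of_real (infsum trace_value (words_over nonzero (Suc m)))"
      by (rule infsumI[OF has_sum_of_real[OF has_sum_infsum[OF tv(1)[of m]]]])
    finally show ?thesis by simp
  qed
  ultimately have e: "(\<Sum>m. (\<Sum>\<^sub>\<infinity>l\<in>words_over nonzero (Suc m). N.word_trace l) / of_nat (Suc m)) = of_real (\<Sum>\<^sub>\<infinity>l\<in>nz_words. trace_value l / length l)"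
    by (simp only: sums_iff)
  have "N.L_trunc M = L_mat w M (of_real s)" for M by (simp add: N.L_trunc_def L_mat_def L_eq)
  then have "(\<lambda>M. F_det w M (of_real s)) \<longlonglongrightarrow> exp (- of_real (\<Sum>\<^sub>\<infinity>l\<in>nz_words. trace_value l / length l))"
    using N.det_L_trunc_tendsto[OF small] unfolding e by (simp add: F_det_def)
  moreover have "(\<lambda>M. F_det w M (of_real s)) \<longlonglongrightarrow> Z_limit (of_real s)"
    using s by (intro F_det_tendsto Re_gt_half_zeta_domain) simp
  ultimately show "Z_limit (of_real s) = exp (- of_real (\<Sum>\<^sub>\<infinity>l\<in>nz_words. trace_value l / length l))"
    by (rule LIMSEQ_unique[rotated])
qed

end

section \<open>The Selberg product as a sum over words\<close>

text \<open>Minus the logarithm of the factor of a class of length \<open>x\<close>, with the sum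
  over \<open>k\<close> carried out as a geometric series; the term for \<open>r\<close> belongs to
  the power \<open>Suc r\<close> of the class.\<close>

definition local_log :: "complex \<Rightarrow> real \<Rightarrow> complex" where
  "local_log s x = (\<Sum>r. exp (- s * of_real (real (Suc r) * x)) / of_real (1 - exp (- (real (Suc r) * x))) / of_nat (Suc r))"

lemma prodinf_local_log:
  assumes s: "Re s > 0" and x: "x > 0"
  shows "(\<Prod>k. 1 - exp (- (s + of_nat k) * of_real x)) = exp (- local_log s x)"
proof -
  define z where "z = (\<lambda>k::nat. exp (- (s + of_nat k) * of_real x))"
  have nz: "norm (z k) = exp (- (Re s * x)) * exp (- x) ^ k" for k
    by (simp add: z_def exp_of_nat_mult[symmetric] flip: exp_add) (simp add: algebra_simps)
  have qs: "exp (- (Re s * x)) < 1" and q: "exp (- x) < 1" using s x by auto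
  have zle: "norm (z k) \<le> exp (- (Re s * x))" for k
    unfolding nz using q by (intro mult_left_le power_le_one) auto
  have z1: "norm (z k) < 1" for k by (rule le_less_trans[OF zle qs])
  define F where "F = (\<lambda>k r. z k ^ Suc r / of_nat (Suc r))"
  have Fle: "norm (F k r) \<le> exp (- x) ^ k * exp (- (Re s * x)) ^ Suc r" for k r
  proof -
    have "norm (F k r) = norm (z k) ^ Suc r / real (Suc r)" unfolding F_def norm_divide norm_power norm_of_nat ..
    also have "\<dots> \<le> norm (z k) ^ Suc r / 1" by (intro divide_left_mono) auto
    also have "norm (z k) ^ Suc r / 1 = exp (- (Re s * x)) ^ Suc r * (exp (- x) ^ k) ^ Suc r"
      unfolding nz by (simp add: power_mult_distrib)
    \<comment> \<open>The true exponent of \<open>exp (- x)\<close> is \<open>k * Suc r\<close>;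
      lowering it to \<open>k\<close> separates the variables, as a product majorant must.\<close>
    also have "\<dots> \<le> exp (- (Re s * x)) ^ Suc r * (exp (- x) ^ k) ^ 1"
      using q by (intro mult_left_mono power_decreasing) (auto intro: power_le_one)
    finally show ?thesis by (simp add: mult.commute)
  qed
  have sa: "summable (\<lambda>k. exp (- x) ^ k)" using q by (intro summable_geometric) auto
  have sb: "summable (\<lambda>r. exp (- (Re s * x)) ^ Suc r)" using qs by (simp add: summable_mult summable_geometric)
  have 1: "(\<lambda>r. \<Sum>k. F k r) sums (\<Sum>k. \<Sum>r. F k r)"
    by (rule suminf_swap_dominated[OF Fle sa sb]) auto
  have Fle': "norm (F k r) \<le> exp (- (Re s * x)) ^ Suc r * exp (- x) ^ k" for r k
    using Fle[of k r] by (simp add: mult.commute)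
  have 2: "(\<lambda>k. \<Sum>r. F k r) sums (\<Sum>r. \<Sum>k. F k r)"
    by (rule suminf_swap_dominated[of "\<lambda>r k. F k r", OF Fle' sb sa]) auto
  have Ln: "Ln (1 - z k) = - (\<Sum>r. F k r)" for k
  proof -
    have "(\<lambda>n. - ((- (- z k)) ^ n) / of_nat n) sums Ln (1 + (- z k))"
      using z1[of k] by (intro Ln_series') simp
    then have "(\<lambda>n. - (z k ^ n / of_nat n)) sums Ln (1 - z k)" by simp
    then have "(\<lambda>r. - F k r) sums Ln (1 - z k)" unfolding F_def by (subst sums_Suc_iff) simp
    from sums_minus[OF this] show ?thesis by (simp add: sums_iff)
  qed
  have inner: "(\<Sum>k. F k r) = exp (- s * of_real (real (Suc r) * x)) / of_real (1 - exp (- (real (Suc r) * x))) / of_nat (Suc r)" for r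
  proof -
    define t where "t = real (Suc r) * x"
    have t: "t > 0" using x by (simp add: t_def)
    have zt: "z k ^ Suc r = exp (- s * of_real t) * of_real (exp (- t)) ^ k" for k
    proof -
      have "z k ^ Suc r = exp (of_nat (Suc r) * (- (s + of_nat k) * of_real x))"
        unfolding z_def by (rule exp_of_nat_mult[symmetric])
      also have "of_nat (Suc r) * (- (s + of_nat k) * of_real x) = - s * of_real t + of_nat k * (of_real (- t))"
        by (simp add: t_def algebra_simps)
      also have "exp \<dots> = exp (- s * of_real t) * exp (of_real (- t)) ^ k" by (simp only: exp_add exp_of_nat_mult)
      finally show ?thesis by (simp only: exp_of_real)
    qed
    have "norm (complex_of_real (exp (- t))) < 1" using t by simp
    from sums_mult[OF geometric_sums[OF this], of "exp (- s * of_real t) / of_nat (Suc r)"]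
    have "(\<lambda>k. exp (- s * of_real t) / of_nat (Suc r) * of_real (exp (- t)) ^ k) sums (exp (- s * of_real t) / of_nat (Suc r) * (1 / (1 - of_real (exp (- t)))))" .
    moreover have "exp (- s * of_real t) / of_nat (Suc r) * of_real (exp (- t)) ^ k = F k r" for k
      unfolding F_def zt by simp
    ultimately have "(\<Sum>k. F k r) = exp (- s * of_real t) / of_nat (Suc r) * (1 / (1 - of_real (exp (- t))))"
      by (simp only: sums_iff)
    then show ?thesis unfolding t_def[symmetric] by simp
  qed
  have "(\<Sum>k. \<Sum>r. F k r) = (\<Sum>r. \<Sum>k. F k r)" using 1 by (simp add: sums_iff)
  also have "\<dots> = local_log s x" unfolding inner local_log_def ..
  finally have sum: "(\<Sum>k. \<Sum>r. F k r) = local_log s x" .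
  have LnS: "(\<lambda>k. Ln (1 - z k)) sums (- local_log s x)"
    unfolding Ln sum[symmetric] using 2 by (intro sums_minus summable_sums) (auto simp: sums_iff)
  have "1 - z k \<noteq> 0" for k using z1[of k] by auto
  then have "(\<Prod>k. 1 - z k) = (\<Prod>k. exp (Ln (1 - z k)))" by simp
  also have "\<dots> = exp (\<Sum>k. Ln (1 - z k))" by (rule prodinf_exp[OF sums_summable[OF LnS]])
  also have "(\<Sum>k. Ln (1 - z k)) = - local_log s x" using LnS by (simp add: sums_iff)
  finally show ?thesis by (simp add: z_def)
qed

context hecke_parameter
begin

definition log_term :: "complex \<Rightarrow> int list \<Rightarrow> complex" where
  "log_term s l = exp (- s * of_real (word_length l)) / of_real (1 - exp (- word_length l)) / of_nat (length l)"

definition word_class :: "int list \<Rightarrow> real mat set set" where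
  "word_class u = conjugacy_class Hecke (H.W u)"

lemma prim_hyp_classes_eq: "prim_hyp_classes Hecke = word_class ` prim_words"
  unfolding prim_hyp_classes_def word_class_def by (rule H.conjugacy_classes_eq)

lemma class_length_word_class: "u \<in> prim_words \<Longrightarrow> class_length (word_class u) = word_length u"
  unfolding word_class_def by (rule class_length_eq) (simp add: prim_words_def)

lemma norm_log_term:
  assumes "l \<in> nz_words"
  shows "norm (log_term s l) = exp (- Re s * word_length l) / (1 - exp (- word_length l)) / length l"
proof -
  have "1 - exp (- word_length l) > 0" using word_length_pos[OF assms] by simp
  then have n: "norm (complex_of_real (1 - exp (- word_length l))) = 1 - exp (- word_length l)"
    by (simp only: norm_of_real abs_of_pos)
  show ?thesis unfolding log_term_def norm_divide n norm_of_nat norm_exp_eq_Re by simp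
qed

text \<open>Each class of length \<open>x\<close> is counted by its \<open>d\<close> rotations, each with weight \<open>1 / d\<close>.\<close>

lemma class_sum:
  fixes f :: "real \<Rightarrow> complex"
  assumes s: "(\<lambda>u. f (word_length u) / of_nat (length u)) abs_summable_on prim_words"
  shows "(\<lambda>K. f (class_length K)) abs_summable_on prim_hyp_classes Hecke"
    "(\<Sum>\<^sub>\<infinity>K\<in>prim_hyp_classes Hecke. f (class_length K)) = (\<Sum>\<^sub>\<infinity>u\<in>prim_words. f (word_length u) / of_nat (length u))"
proof -
  define fib where "fib = (\<lambda>K. {u \<in> prim_words. word_class u = K})"
  define g where "g = (\<lambda>u. f (word_length u) / of_nat (length u))"
  have bij: "bij_betw snd (Sigma (prim_hyp_classes Hecke) fib) prim_words"
    unfolding prim_hyp_classes_eq fib_def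
  proof (rule bij_betwI[where g = "\<lambda>u. (word_class u, u)"])
    show "(\<lambda>u. (word_class u, u)) \<in> prim_words \<rightarrow> (SIGMA K:word_class ` prim_words. {u \<in> prim_words. word_class u = K})"
      by blast
    show "snd \<in> (SIGMA K:word_class ` prim_words. {u \<in> prim_words. word_class u = K}) \<rightarrow> prim_words"
      by fastforce
  qed fastforce+
  have gs: "(\<lambda>p. g (snd p)) abs_summable_on Sigma (prim_hyp_classes Hecke) fib"
    using s summable_on_reindex_bij_betw[OF bij, of "\<lambda>u. norm (g u)"] by (simp add: g_def)
  have fibre: "(\<Sum>\<^sub>\<infinity>u\<in>fib K. norm (g u)) = norm (f (class_length K)) \<and> (\<Sum>\<^sub>\<infinity>u\<in>fib K. g u) = f (class_length K)"
    if K: "K \<in> prim_hyp_classes Hecke" for K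
  proof -
    obtain u where u: "u \<in> prim_words" "K = word_class u" using K by (auto simp: prim_hyp_classes_eq)
    have len: "length u > 0" using u by (simp add: prim_words_def nz_words_def)
    have fu: "fib K = (\<lambda>i. rotate i u) ` {..<length u}"
      unfolding fib_def u(2) word_class_def by (rule H.conjugacy_class_fibre[OF u(1)])
    have card: "card (fib K) = length u"
      unfolding fib_def u(2) word_class_def by (rule H.card_conjugacy_class_fibre[OF u(1)])
    have gv: "g v = f (class_length K) / of_nat (length u)" if "v \<in> fib K" for v
    proof -
      have "word_length v = class_length K" using that class_length_word_class[of v] by (auto simp: fib_def)
      moreover have "length v = length u" using that unfolding fu by auto
      ultimately show ?thesis by (simp add: g_def)
    qed
    have fin: "finite (fib K)" unfolding fu by simp
    have "(\<Sum>u\<in>fib K. g u) = (\<Sum>v\<in>fib K. f (class_length K) / of_nat (length u))"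
      by (rule sum.cong[OF refl gv])
    also have "\<dots> = f (class_length K)" using len by (simp add: card)
    finally have 1: "(\<Sum>u\<in>fib K. g u) = f (class_length K)" .
    have "(\<Sum>u\<in>fib K. norm (g u)) = (\<Sum>v\<in>fib K. norm (f (class_length K) / of_nat (length u)))"
      by (rule sum.cong[OF refl]) (simp only: gv)
    also have "\<dots> = norm (f (class_length K))" using len by (simp add: card norm_divide)
    finally show ?thesis using 1 fin by simp
  qed
  have A: "(\<lambda>K. norm (\<Sum>\<^sub>\<infinity>u\<in>fib K. norm (g u))) summable_on prim_hyp_classes Hecke"
    using gs by (simp add: Infinite_Sum.abs_summable_on_Sigma_iff)
  show "(\<lambda>K. f (class_length K)) abs_summable_on prim_hyp_classes Hecke"
    by (rule summable_on_cong[THEN iffD1, OF _ A]) (simp add: fibre)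
  have "(\<Sum>\<^sub>\<infinity>u\<in>prim_words. g u) = (\<Sum>\<^sub>\<infinity>p\<in>Sigma (prim_hyp_classes Hecke) fib. g (snd p))"
    using infsum_reindex_bij_betw[OF bij, of g] by simp
  also have "\<dots> = (\<Sum>\<^sub>\<infinity>K\<in>prim_hyp_classes Hecke. \<Sum>\<^sub>\<infinity>u\<in>fib K. g u)"
    using infsum_Sigma'_banach[of "\<lambda>K u. g u" "prim_hyp_classes Hecke" fib] Infinite_Sum.abs_summable_summable[OF gs]
    by (simp add: case_prod_unfold)
  also have "\<dots> = (\<Sum>\<^sub>\<infinity>K\<in>prim_hyp_classes Hecke. f (class_length K))"
    by (rule infsum_cong) (simp add: fibre)
  finally show "(\<Sum>\<^sub>\<infinity>K\<in>prim_hyp_classes Hecke. f (class_length K)) = (\<Sum>\<^sub>\<infinity>u\<in>prim_words. f (word_length u) / of_nat (length u))"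
    by (simp add: g_def)
qed

text \<open>Existence and uniqueness of primitive roots; the exponent is shifted by one because only
  positive powers are nonempty.\<close>

lemma nz_words_root_bij: "bij_betw (\<lambda>(u, r). word_power (Suc r) u) (prim_words \<times> UNIV) nz_words"
  unfolding bij_betw_def
proof (intro conjI inj_onI equalityI subsetI)
  fix p q assume pq: "p \<in> prim_words \<times> UNIV" "q \<in> prim_words \<times> UNIV"
    "(\<lambda>(u, r). word_power (Suc r) u) p = (\<lambda>(u, r). word_power (Suc r) u) q"
  obtain u r v t where "p = (u, r)" "q = (v, t)" by (metis surj_pair)
  then show "p = q"
    using primitive_root_unique[of u v "Suc r" "Suc t"] pq by (auto simp: prim_words_def simp del: word_power_Suc)
next
  fix l assume "l \<in> (\<lambda>(u, r). word_power (Suc r) u) ` (prim_words \<times> UNIV)"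
  then obtain u r where "u \<in> prim_words" "l = word_power (Suc r) u" by auto
  then show "l \<in> nz_words" using word_power_nz_iff[of "Suc r" u] by (simp add: prim_words_def del: word_power_Suc)
next
  fix l assume l: "l \<in> nz_words"
  then have "l \<noteq> []" by (simp add: nz_words_def)
  then obtain v n where v: "primitive_word v" "n > 0" "l = word_power n v" using primitive_root_exists by blast
  then have "v \<in> prim_words" using l word_power_nz_iff[of n v] by (simp add: prim_words_def)
  moreover have "l = word_power (Suc (n - 1)) v" using v by (simp del: word_power_Suc)
  ultimately show "l \<in> (\<lambda>(u, r). word_power (Suc r) u) ` (prim_words \<times> UNIV)" by force
qed

lemma log_term_power:
  assumes "u \<in> prim_words"
  shows "log_term s (word_power (Suc r) u) = exp (- s * of_real (real (Suc r) * word_length u)) /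
    of_real (1 - exp (- (real (Suc r) * word_length u))) / of_nat (Suc r) / of_nat (length u)"
proof -
  have "u \<in> nz_words" using assms by (simp add: prim_words_def)
  then have "word_length (word_power (Suc r) u) = real (Suc r) * word_length u"
    using word_length_power by blast
  then show ?thesis unfolding log_term_def by (simp only: length_word_power of_nat_mult divide_divide_eq_left mult.assoc)
qed

text \<open>For a word \<open>word_power (Suc r) u\<close> the weight \<open>1 / length\<close>
  factors as \<open>1 / Suc r\<close>, the coefficient of the logarithmic series, times
  \<open>1 / length u\<close>, which averages over the rotations of the root.\<close>

lemma local_log_sum:
  assumes s: "log_term s abs_summable_on nz_words"
  shows "(\<lambda>u. local_log s (word_length u) / of_nat (length u)) abs_summable_on prim_words"
    "(\<Sum>\<^sub>\<infinity>u\<in>prim_words. local_log s (word_length u) / of_nat (length u)) = (\<Sum>\<^sub>\<infinity>l\<in>nz_words. log_term s l)"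
proof -
  define g where "g = (\<lambda>(u, r). log_term s (word_power (Suc r) u))"
  have g: "g abs_summable_on prim_words \<times> UNIV"
    using s summable_on_reindex_bij_betw[OF nz_words_root_bij, of "\<lambda>l. norm (log_term s l)"]
    by (simp add: g_def case_prod_unfold del: word_power_Suc)
  have inner: "(\<Sum>\<^sub>\<infinity>r. g (u, r)) = local_log s (word_length u) / of_nat (length u)" if u: "u \<in> prim_words" for u
  proof -
    define h where "h = (\<lambda>r. exp (- s * of_real (real (Suc r) * word_length u)) / of_real (1 - exp (- (real (Suc r) * word_length u))) / of_nat (Suc r))"
    have gh: "g (u, r) = h r / of_nat (length u)" for r
      unfolding g_def case_prod_conv log_term_power[OF u] h_def ..
    have "(\<lambda>r. g (u, r)) abs_summable_on UNIV" using g u by (simp add: Infinite_Sum.abs_summable_on_Sigma_iff)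
    then have su: "(\<lambda>r. g (u, r)) summable_on UNIV" by (rule Infinite_Sum.abs_summable_summable)
    then have "(\<lambda>r. g (u, r)) sums (\<Sum>\<^sub>\<infinity>r. g (u, r))" by (rule has_sum_imp_sums[OF has_sum_infsum])
    from sums_mult[OF this, of "of_nat (length u)"]
    have "h sums (of_nat (length u) * (\<Sum>\<^sub>\<infinity>r. g (u, r)))"
      using u unfolding gh by (simp add: prim_words_def nz_words_def)
    then have "local_log s (word_length u) = of_nat (length u) * (\<Sum>\<^sub>\<infinity>r. g (u, r))"
      unfolding local_log_def h_def by (simp only: sums_iff)
    then show ?thesis using u by (simp add: prim_words_def nz_words_def)
  qed
  have A: "(\<lambda>u. norm (\<Sum>\<^sub>\<infinity>r. g (u, r))) summable_on prim_words"
    using abs_summable_infsum_fibre(1)[OF g] .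
  show "(\<lambda>u. local_log s (word_length u) / of_nat (length u)) abs_summable_on prim_words"
    by (rule summable_on_cong[THEN iffD1, OF _ A]) (simp add: inner)
  have "(\<Sum>\<^sub>\<infinity>l\<in>nz_words. log_term s l) = (\<Sum>\<^sub>\<infinity>(u, r)\<in>prim_words \<times> UNIV. g (u, r))"
    using infsum_reindex_bij_betw[OF nz_words_root_bij, of "log_term s"]
    by (simp add: g_def case_prod_unfold del: word_power_Suc)
  also have "\<dots> = (\<Sum>\<^sub>\<infinity>u\<in>prim_words. \<Sum>\<^sub>\<infinity>r. g (u, r))"
    using Infinite_Sum.abs_summable_summable[OF g] by (intro infsum_Sigma'_banach[symmetric]) (simp add: case_prod_unfold)
  also have "\<dots> = (\<Sum>\<^sub>\<infinity>u\<in>prim_words. local_log s (word_length u) / of_nat (length u))"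
    by (rule infsum_cong) (simp add: inner)
  finally show "(\<Sum>\<^sub>\<infinity>u\<in>prim_words. local_log s (word_length u) / of_nat (length u)) = (\<Sum>\<^sub>\<infinity>l\<in>nz_words. log_term s l)"
    by (rule sym)
qed

text \<open>Finite partial products are exponentials of finite partial sums over classes, so
  unordered summability of the logarithms is convergence along the very net that defines the
  product.\<close>

lemma Selberg_product_eq:
  assumes Re: "Re s > 0" and s: "log_term s abs_summable_on nz_words"
  shows "Selberg_product Hecke s = exp (- (\<Sum>\<^sub>\<infinity>l\<in>nz_words. log_term s l))"
proof -
  let ?F = "finite_subsets_at_top (prim_hyp_classes Hecke)"
  have len: "class_length K > 0" if "K \<in> prim_hyp_classes Hecke" for K
    using that class_length_word_class word_length_pos unfolding prim_hyp_classes_eq by (auto simp: prim_words_def)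
  note L = local_log_sum[OF s]
  note C = class_sum[of "local_log s", OF L(1)]
  have "((\<lambda>K. local_log s (class_length K)) has_sum (\<Sum>\<^sub>\<infinity>l\<in>nz_words. log_term s l)) (prim_hyp_classes Hecke)"
    using has_sum_infsum[OF Infinite_Sum.abs_summable_summable[OF C(1)]] C(2) L(2) by simp
  then have "((\<lambda>X. exp (- (\<Sum>K\<in>X. local_log s (class_length K)))) \<longlongrightarrow> exp (- (\<Sum>\<^sub>\<infinity>l\<in>nz_words. log_term s l))) ?F"
    unfolding has_sum_def by (intro tendsto_exp tendsto_minus)
  moreover have "\<forall>\<^sub>F X in ?F. exp (- (\<Sum>K\<in>X. local_log s (class_length K))) =
      (\<Prod>K\<in>X. \<Prod>k. 1 - exp (- (s + of_nat k) * of_real (class_length K)))"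
  proof (rule eventually_finite_subsets_at_top_weakI)
    fix X assume X: "finite X" "X \<subseteq> prim_hyp_classes Hecke"
    have "exp (- (\<Sum>K\<in>X. local_log s (class_length K))) = (\<Prod>K\<in>X. exp (- local_log s (class_length K)))"
      using X(1) by (simp add: sum_negf[symmetric] exp_sum)
    also have "\<dots> = (\<Prod>K\<in>X. \<Prod>k. 1 - exp (- (s + of_nat k) * of_real (class_length K)))"
      using X(2) len by (intro prod.cong refl prodinf_local_log[OF Re, symmetric]) auto
    finally show "exp (- (\<Sum>K\<in>X. local_log s (class_length K))) = (\<Prod>K\<in>X. \<Prod>k. 1 - exp (- (s + of_nat k) * of_real (class_length K)))" .
  qed
  ultimately have "((\<lambda>X. \<Prod>K\<in>X. \<Prod>k. 1 - exp (- (s + of_nat k) * of_real (class_length K))) \<longlongrightarrow> exp (- (\<Sum>\<^sub>\<infinity>l\<in>nz_words. log_term s l))) ?F"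
    by (rule Lim_transform_eventually)
  then show ?thesis unfolding Selberg_product_def by (intro tendsto_Lim finite_subsets_at_top_neq_bot)
qed

text \<open>Restricting the sum to primitive words keeps the first powers. For these the denominator
  \<open>1 - exp (- x)\<close> in the absolute value is exactly what the geometric sum over
  \<open>k\<close> produces.\<close>

lemma Selberg_product_converges_if:
  assumes s: "log_term s abs_summable_on nz_words"
  shows "Selberg_product_converges Hecke s"
proof -
  define f where "f = (\<lambda>x. exp (- s * of_real x) / of_real (1 - exp (- x)))"
  have "(\<lambda>u. f (word_length u) / of_nat (length u)) abs_summable_on prim_words"
    using summable_on_subset_banach[OF s, of prim_words] by (auto simp: f_def log_term_def prim_words_def)
  from class_sum(1)[OF this] have fs: "(\<lambda>K. norm (f (class_length K))) summable_on prim_hyp_classes Hecke" .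
  have len: "class_length K > 0" if "K \<in> prim_hyp_classes Hecke" for K
    using that class_length_word_class word_length_pos unfolding prim_hyp_classes_eq by (auto simp: prim_words_def)
  define h where "h = (\<lambda>(K, k::nat). norm (exp (- (s + of_nat k) * of_real (class_length K))))"
  have inner: "((\<lambda>k. h (K, k)) has_sum norm (f (class_length K))) UNIV" if K: "K \<in> prim_hyp_classes Hecke" for K
  proof -
    define x where "x = class_length K"
    have x: "x > 0" using len[OF K] by (simp add: x_def)
    have hk: "h (K, k) = exp (- (Re s * x)) * exp (- x) ^ k" for k
      by (simp add: h_def x_def[symmetric] exp_of_nat_mult[symmetric] flip: exp_add) (simp add: algebra_simps)
    have "(\<lambda>k. exp (- (Re s * x)) * exp (- x) ^ k) sums (exp (- (Re s * x)) * (1 / (1 - exp (- x))))"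
      using x by (intro sums_mult geometric_sums) simp
    moreover have "norm (f x) = exp (- (Re s * x)) * (1 / (1 - exp (- x)))"
    proof -
      have "norm (complex_of_real (1 - exp (- x))) = 1 - exp (- x)"
        unfolding norm_of_real using x by simp
      then show ?thesis by (simp add: f_def norm_divide)
    qed
    ultimately show ?thesis unfolding hk x_def[symmetric] by (intro sums_nonneg_imp_has_sum) auto
  qed
  have "h summable_on Sigma (prim_hyp_classes Hecke) (\<lambda>_. UNIV)"
    by (rule summable_on_Sigma_bound(1)[of _ _ h "\<lambda>K. norm (f (class_length K))"])
      (use inner fs in \<open>auto simp: has_sum_iff h_def\<close>)
  then show ?thesis by (simp add: Selberg_product_converges_def h_def)
qed

text \<open>The powers of \<open>w\<close> cancel between the entries and the binomial sum, so the
  total norm is at most \<open>A * (w - 1) powr (- 2 * s)\<close>, which tends to 0 because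
  \<open>w - 1 > 1\<close>.\<close>

lemma Z_limit_real_eventually:
  obtains s0 :: real where "s0 \<ge> 1"
    "\<And>s. s \<ge> s0 \<Longrightarrow> log_term (of_real s) abs_summable_on nz_words"
    "\<And>s. s \<ge> s0 \<Longrightarrow> Z_limit (of_real s) = exp (- (\<Sum>\<^sub>\<infinity>l\<in>nz_words. log_term (of_real s) l))"
proof -
  define A where "A = (\<Sum>\<^sub>\<infinity>n\<in>UNIV - {0}. \<bar>real_of_int n\<bar> powr (- 2)) * ((w - 1) * polylog (- 1 / 2) (1 / (w - 1)))"
  have A: "A \<ge> 0" unfolding A_def using w by (intro mult_nonneg_nonneg infsum_nonneg polylog_nonneg) auto
  \<comment> \<open>Chosen such that \<open>(w - 1) powr (2 * s) \<ge> A + 1\<close> for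
    \<open>s \<ge> s0\<close>; the maximum with 1 meets the assumption of
    \<open>hecke_real\<close>.\<close>
  define s0 where "s0 = max 1 (ln (A + 1) / (2 * ln (w - 1)))"
  have lw: "ln (w - 1) > 0" using w by simp
  show ?thesis
  proof (rule that[of s0])
    show s01: "s0 \<ge> 1" by (simp add: s0_def)
    fix s assume s: "s \<ge> s0"
    interpret S: hecke_real w s by unfold_locales (use s s01 in simp)
    have "w powr (- 2 * s) * (w / (w - 1)) powr (2 * s) = (w - 1) powr (- 2 * s)"
      using w by (simp add: powr_divide powr_minus field_simps)
    then have "S.letter_sum * (w powr (- 2 * s) * entry_bound_total (2 * s)) = A * (w - 1) powr (- 2 * s)"
      unfolding S.letter_sum_def A_def entry_bound_total_def by (simp add: mult_ac)
    then have "S.N.total_norm \<le> A * (w - 1) powr (- 2 * s)" using S.total_norm_le by simp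
    also have "\<dots> < 1"
    proof -
      have "ln (A + 1) / (2 * ln (w - 1)) \<le> s" using s by (simp add: s0_def)
      then have "ln (A + 1) \<le> s * (2 * ln (w - 1))" using lw by (simp add: pos_divide_le_eq)
      then have "exp (ln (A + 1)) \<le> exp (2 * s * ln (w - 1))" by (simp add: mult_ac)
      then have "A + 1 \<le> (w - 1) powr (2 * s)" using A w by (simp add: powr_def)
      then have "A < (w - 1) powr (2 * s)" by simp
      moreover have "(w - 1) powr (2 * s) > 0" using w by simp
      ultimately show ?thesis using powr_minus_divide[of "w - 1" "2 * s"] by simp
    qed
    finally have small: "S.N.total_norm < 1" .
    have lt: "log_term (of_real s) l = of_real (S.trace_value l / length l)" for l
      by (simp add: log_term_def S.trace_value_def exp_of_real[symmetric])
    have nn: "norm (log_term (of_real s) l) = S.trace_value l / length l" if "l \<in> nz_words" for l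
      unfolding lt norm_of_real using S.trace_value_nonneg[OF that] by simp
    show "log_term (of_real s) abs_summable_on nz_words"
      by (rule summable_on_cong[THEN iffD2, OF nn S.Z_limit_real(1)[OF small]])
    have "(\<Sum>\<^sub>\<infinity>l\<in>nz_words. log_term (of_real s) l) = of_real (\<Sum>\<^sub>\<infinity>l\<in>nz_words. S.trace_value l / length l)"
      unfolding lt by (rule infsumI[OF has_sum_of_real[OF has_sum_infsum[OF S.Z_limit_real(1)[OF small]]]])
    then show "Z_limit (of_real s) = exp (- (\<Sum>\<^sub>\<infinity>l\<in>nz_words. log_term (of_real s) l))"
      using S.Z_limit_real(2)[OF small] by simp
  qed
qed

lemma norm_log_term_mono:
  assumes "l \<in> nz_words" "Re s' \<le> Re s"
  shows "norm (log_term s l) \<le> norm (log_term s' l)"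
  unfolding norm_log_term[OF assms(1)] using assms(2) word_length_pos[OF assms(1)]
  by (intro divide_right_mono) (auto intro!: mult_right_mono)

lemma log_term_holomorphic: "(\<lambda>s. log_term s l) holomorphic_on UNIV"
proof -
  have "(\<lambda>s. exp (- s * of_real (word_length l)) * (1 / of_real (1 - exp (- word_length l)) / of_nat (length l))) holomorphic_on UNIV"
    by (intro holomorphic_intros)
  then show ?thesis by (simp add: log_term_def[abs_def])
qed

text \<open>Absolute values of the terms decrease with the real part, so the terms at
  \<open>s0\<close> are a majorant to its right. The uniform limit is taken along the net of finite
  sets of words.\<close>

lemma log_sum_holomorphic:
  assumes "log_term (of_real s0) abs_summable_on nz_words"
  shows "(\<lambda>s. \<Sum>\<^sub>\<infinity>l\<in>nz_words. log_term s l) holomorphic_on {s. Re s > s0}"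
proof -
  have "(\<lambda>s. \<Sum>\<^sub>\<infinity>l\<in>nz_words. log_term s l) analytic_on {s. Re s > s0}"
    unfolding analytic_on_def
  proof
    fix z assume "z \<in> {s. Re s > s0}"
    then obtain r where r: "r > 0" "cball z r \<subseteq> {s. Re s > s0}"
      using open_halfspace_Re_gt[of s0] open_contains_cball by blast
    have "uniform_limit (cball z r) (\<lambda>X s. \<Sum>l\<in>X. log_term s l) (\<lambda>s. \<Sum>\<^sub>\<infinity>l\<in>nz_words. log_term s l) (finite_subsets_at_top nz_words)"
      by (rule Weierstrass_m_test_general[OF _ assms]) (use r in \<open>auto intro!: norm_log_term_mono\<close>)
    moreover have "(\<lambda>s. \<Sum>l\<in>X. log_term s l) holomorphic_on UNIV" for X
      by (intro holomorphic_on_sum log_term_holomorphic)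
    then have "\<forall>\<^sub>F X in finite_subsets_at_top nz_words. continuous_on (cball z r) (\<lambda>s. \<Sum>l\<in>X. log_term s l)
        \<and> (\<lambda>s. \<Sum>l\<in>X. log_term s l) holomorphic_on ball z r"
      by (intro always_eventually allI conjI) (auto intro: holomorphic_on_imp_continuous_on holomorphic_on_subset)
    ultimately show "\<exists>e>0. (\<lambda>s. \<Sum>\<^sub>\<infinity>l\<in>nz_words. log_term s l) holomorphic_on ball z e"
      using holomorphic_uniform_limit[of z r "\<lambda>X s. \<Sum>l\<in>X. log_term s l" "finite_subsets_at_top nz_words"] r
      by (metis finite_subsets_at_top_neq_bot)
  qed
  then show ?thesis by (rule analytic_imp_holomorphic)
qed

lemma Z_limit_eq_Selberg_product:
  obtains s0 :: real where "s0 \<ge> 1" "\<And>s. Re s > s0 \<Longrightarrow> Selberg_product_converges Hecke s"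
    "\<And>s. Re s > s0 \<Longrightarrow> Z_limit s = Selberg_product Hecke s"
proof -
  obtain s0 where s0: "s0 \<ge> 1" "\<And>s. s \<ge> s0 \<Longrightarrow> log_term (of_real s) abs_summable_on nz_words"
    "\<And>s. s \<ge> s0 \<Longrightarrow> Z_limit (of_real s) = exp (- (\<Sum>\<^sub>\<infinity>l\<in>nz_words. log_term (of_real s) l))"
    by (rule Z_limit_real_eventually) blast
  define S where "S = {s. Re s > s0}"
  have S: "open S" "connected S" "S \<subseteq> zeta_domain"
    unfolding S_def using s0(1) Re_gt_half_zeta_domain
    by (auto intro!: open_halfspace_Re_gt convex_connected convex_halfspace_Re_gt)
  have summ: "log_term s abs_summable_on nz_words" if "Re s > s0" for s
    by (rule summable_on_comparison_test[OF s0(2)[of s0]]) (use that in \<open>auto intro!: norm_log_term_mono\<close>)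
  have hol: "(\<lambda>s. Z_limit s - exp (- (\<Sum>\<^sub>\<infinity>l\<in>nz_words. log_term s l))) holomorphic_on S"
    unfolding S_def using Z_limit_holomorphic S(3) log_sum_holomorphic[OF s0(2)[of s0]]
    by (intro holomorphic_intros) (auto simp: S_def intro: holomorphic_on_subset)
  \<comment> \<open>The trace computation covers real points only; this ray accumulates at
    \<open>s0 + 1\<close>, an interior point of the half-plane.\<close>
  define U where "U = complex_of_real ` {s0<..}"
  have eq: "Z_limit s = exp (- (\<Sum>\<^sub>\<infinity>l\<in>nz_words. log_term s l))" if "Re s > s0" for s
  proof -
    have "Z_limit s - exp (- (\<Sum>\<^sub>\<infinity>l\<in>nz_words. log_term s l)) = 0"
    proof (rule analytic_continuation[OF hol S(1,2)])
      show "U \<subseteq> S" by (auto simp: U_def S_def)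
      show "complex_of_real (s0 + 1) \<in> S" by (simp add: S_def)
      show "complex_of_real (s0 + 1) islimpt U" unfolding islimpt_approachable
      proof (intro allI impI)
        fix e :: real assume e: "e > 0"
        have "complex_of_real (s0 + 1 + e / 2) \<in> U" using e unfolding U_def by (intro imageI) simp
        moreover have "dist (complex_of_real (s0 + 1 + e / 2)) (of_real (s0 + 1)) = e / 2"
          unfolding dist_of_real using e by (simp add: dist_real_def)
        moreover have "complex_of_real (s0 + 1 + e / 2) \<noteq> of_real (s0 + 1)"
          unfolding of_real_eq_iff using e by simp
        ultimately show "\<exists>x'\<in>U. x' \<noteq> complex_of_real (s0 + 1) \<and> dist x' (complex_of_real (s0 + 1)) < e"
          using e by (intro bexI[of _ "complex_of_real (s0 + 1 + e / 2)"]) auto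
      qed
      show "Z_limit z - exp (- (\<Sum>\<^sub>\<infinity>l\<in>nz_words. log_term z l)) = 0" if "z \<in> U" for z
        using that s0(3) by (auto simp: U_def)
      show "s \<in> S" using that by (simp add: S_def)
    qed
    then show ?thesis by simp
  qed
  show ?thesis
  proof (rule that[OF s0(1)])
    fix s assume s: "Re s > s0"
    show "Selberg_product_converges Hecke s" by (rule Selberg_product_converges_if[OF summ[OF s]])
    have "Re s > 0" using s s0(1) by simp
    then show "Z_limit s = Selberg_product Hecke s" using Selberg_product_eq summ[OF s] eq[OF s] by simp
  qed
qed

end

theorem theorem1p1:
  fixes w :: real
  assumes "w > 2"
  shows "\<exists>Z. Selberg_zeta_continuation (Hecke_group w) zeta_domain Z \<and>
           (\<forall>s\<in>zeta_domain. \<forall>N::nat. N \<ge> 1 \<longrightarrow>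
              cmod (Z s - F_det w N s) \<le> P_bound w N s * exp (P_bound w N s + Q_bound w s + 1))"
proof -
  interpret hecke_parameter w by unfold_locales (rule assms)
  obtain s0 where s0: "s0 \<ge> 1" "\<And>s. Re s > s0 \<Longrightarrow> Selberg_product_converges Hecke s"
    "\<And>s. Re s > s0 \<Longrightarrow> Z_limit s = Selberg_product Hecke s"
    by (rule Z_limit_eq_Selberg_product) blast
  have "Z_limit nicely_meromorphic_on zeta_domain"
    using Z_limit_holomorphic open_zeta_domain by (simp add: analytic_on_imp_nicely_meromorphic_on analytic_on_open)
  moreover have "s \<in> zeta_domain" if "Re s > s0" for s
    using Re_gt_half_zeta_domain[of s] that s0(1) by simp
  ultimately have "Selberg_zeta_continuation Hecke zeta_domain Z_limit"
    unfolding Selberg_zeta_continuation_def using s0(2,3) by blast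
  then show ?thesis using Z_limit_bound by blast
qed

end
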